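(* Let $(\mathcal V,\mathcal G)$ be a polygraph couple. The free strict effectful category over $(\mathcal V,\mathcal G)$ is $\mathrm{Mon}(\mathcal V)\to \mathrm{Eff}(\mathcal V,\mathcal G)$. That is: the functor $\mathrm{Mon}(\mathcal V)\to \mathrm{Eff}(\mathcal V,\mathcal G)$ described in the context is a strict effectful category, and for every strict effectful category $\mathbb V\to\mathbb C$ and every morphism of polygraph couples $F\colon(\mathcal V,\mathcal G)\to\mathcal U(\mathbb V,\mathbb C)$ there is a unique strict effectful functor $H$ from $(\mathrm{Mon}(\mathcal V)\to \mathrm{Eff}(\mathcal V,\mathcal G))$ to $(\mathbb V\to\mathbb C)$ such that $F$ equals the composite of the inclusion of generators $\eta\colon(\mathcal V,\mathcal G)\to\mathcal U(\mathrm{Mon}(\mathcal V),\mathrm{Eff}(\mathcal V,\mathcal G))$ with $\mathcal U(H)$. Moreover, the morphisms $A\to B$ of $\mathrm{Eff}(\mathcal V,\mathcal G)$ are in bijection with the morphisms $R\otimes A\to R\otimes B$ of the runtime monoidal category: $$\mathrm{Eff}(\mathcal V,\mathcal G)(A,B)\;\cong\;\mathrm{MonRun}(\mathcal V,\mathcal G)(R\otimes A,\,R\otimes B).$$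
   Context: Composition is written diagrammatically: $f;g$ is first $f$, then $g$. **Premonoidal categories.** A *binoidal category* is a category $\mathbb C$ with an object $I$, an object $A\otimes B$ for each pair of objects $A,B$, and functors $(A\otimes\bullet),(\bullet\otimes B)\colon\mathbb C\to\mathbb C$ (whiskerings) whose values on objects are $A\otimes B$; no joint functoriality is assumed. A morphism $f\colon A\to B$ is *central* if for every $g\colon A'\to B'$ both $(f\otimes A');(B\otimes g)=(A\otimes g);(f\otimes B')$ and $(A'\otimes f);(g\otimes B)=(g\otimes A);(B'\otimes f)$. A *premonoidal category* is a binoidal category with central isomorphisms $\alpha_{A,B,C}\colon A\otimes(B\otimes C)\to(A\otimes B)\otimes C$, $\rho_A\colon A\otimes I\to A$, $\lambda_A\colon I\otimes A\to A$, natural separately in each variable, satisfying the pentagon and triangle equations. It is *strict* if these are identities. **Effectful categories.** An *effectful category* is an identity-on-objects functor $\mathbb V\to\mathbb C$ from a monoidal category $\mathbb V$ to a premonoidal category $\mathbb C$ that strictly preserves all the premonoidal structure and whose image is central. It is strict when both $\mathbb V$ and $\mathbb C$ are strict. An *effectful functor* from $\mathbb V\to\mathbb C$ to $\mathbb W\to\mathbb D$ is $(F,F_0,\varepsilon,\mu)$ with functors $F\colon\mathbb C\to\mathbb D$, $F_0\colon\mathbb V\to\mathbb W$ making the square with the identity-on-objects functors commute, and isomorphisms $\varepsilon\colon J\cong F(I)$ (where $J$ is the unit of $\mathbb W$) and $\mu\colon F(A\otimes B)\cong F(A)\otimes F(B)$ that are natural (in each variable) and pure (come from $\mathbb W$),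 making $F_0$ a monoidal functor. It is *strict* if $\varepsilon$ and $\mu$ are identities (so $F$ strictly preserves unit, tensor of objects and whiskerings). **Polygraphs.** A *polygraph* $\mathcal G$ is a set of objects $\mathcal G_{\mathrm{obj}}$ and a set of arrows $\mathcal G(A_0,\dots,A_n;B_0,\dots,B_m)$ for any two finite (possibly empty) sequences of objects. A morphism of polygraphs is a function on objects together with compatible functions on arrow sets. A *polygraph couple* $(\mathcal V,\mathcal G)$ is a pair of polygraphs with $\mathcal V_{\mathrm{obj}}=\mathcal G_{\mathrm{obj}}$; a morphism of polygraph couples is a pair of polygraph morphisms agreeing on objects. For a strict effectful category $\mathbb V\to\mathbb C$, $\mathcal U(\mathbb V,\mathbb C)$ is the polygraph couple on the common set of objects whose arrows $A_0,\dots,A_n\to B_0,\dots,B_m$ are the morphisms $A_0\otimes\dots\otimes A_n\to B_0\otimes\dots\otimes B_m$ of $\mathbb V$ and of $\mathbb C$, respectively. $\mathrm{Mon}(\mathcal V)$ is the free strict monoidal category on the polygraph $\mathcal V$; its objects are finite lists of elements of $\mathcal V_{\mathrm{obj}}$. **Runtime monoidal category.** $\mathrm{MonRun}(\mathcal V,\mathcal G)$ is the strict monoidal category presented as follows. Object generators: $\mathcal V_{\mathrm{obj}}=\mathcal G_{\mathrm{obj}}$ together with one new object $R$ (the runtime). Morphism generators: each $v\in\mathcal V(A_0,\dots,A_n;B_0,\dots,B_m)$ as $v\colon A_0\otimes\dots\otimes A_n\to B_0\otimes\dots\otimes B_m$; each $g\in\mathcal G(A_0,\dots,A_n;B_0,\dots,B_m)$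 as $g\colon R\otimes A_0\otimes\dots\otimes A_n\to R\otimes B_0\otimes\dots\otimes B_m$; and, for each object $X\neq R$ among the generators, braidings $R\otimes X\to X\otimes R$ and $X\otimes R\to R\otimes X$. Relations: the two braidings for each $X$ are mutually inverse; and, writing $\sigma_{R,A}\colon R\otimes A\to A\otimes R$ for the evident composite of braidings for a list $A$ of objects of $\mathcal V$, the braidings are natural with respect to every generator $v\colon A\to B$ of $\mathcal V$, i.e. $(\mathrm{id}_R\otimes v);\sigma_{R,B}=\sigma_{R,A};(v\otimes\mathrm{id}_R)$. **Braid cliques.** For a list $A=(A_0,\dots,A_n)$ of objects of $\mathcal V$, the *braid clique* $\mathrm{Braid}(A_0,\dots,A_n)$ is the family of objects $A_{(i)}=A_0\otimes\dots\otimes R_{(i)}\otimes\dots\otimes A_n$ of $\mathrm{MonRun}(\mathcal V,\mathcal G)$ obtained by inserting $R$ at position $i$, $0\le i\le n+1$, with the commuting isomorphisms $\sigma_{i,j}\colon A_{(i)}\to A_{(j)}$ built by braiding $R$. A *braid clique morphism* $f\colon\mathrm{Braid}(A)\to\mathrm{Braid}(B)$ is a family of morphisms $f_{ik}\colon A_{(i)}\to B_{(k)}$ of $\mathrm{MonRun}(\mathcal V,\mathcal G)$ with $f_{ij};\sigma_{jk}=\sigma_{il};f_{lk}$ for all indices. Such an $f$ is determined by its leftmost component $f_{00}\colon R\otimes A\to R\otimes B$ (here $A$ also denotes $A_0\otimes\dots\otimes A_n$). **$\mathrm{Eff}(\mathcal V,\mathcal G)$.** Objects: the braid cliques $\mathrm{Braid}(A)$,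 indexed by finite lists $A$ of objects of $\mathcal V$ (so objects are identified with those of $\mathrm{Mon}(\mathcal V)$). Morphisms: braid clique morphisms, represented by leftmost components; identities and composition are those of $\mathrm{MonRun}(\mathcal V,\mathcal G)$ on leftmost components. The tensor of objects is concatenation of lists and the unit is the empty list. For $f\colon R\otimes A\to R\otimes B$, the right whiskering by $C$ is $f\otimes\mathrm{id}_C$ and the left whiskering by $C$ is $(\sigma_{R,C}\otimes\mathrm{id}_A);(\mathrm{id}_C\otimes f);(\sigma_{R,C}^{-1}\otimes\mathrm{id}_B)\colon R\otimes C\otimes A\to R\otimes C\otimes B$. Associators and unitors are identities. The functor $\mathrm{Mon}(\mathcal V)\to\mathrm{Eff}(\mathcal V,\mathcal G)$ is the identity on objects (lists) and sends $v\colon A\to B$ to the clique morphism with leftmost component $\mathrm{id}_R\otimes v$. The inclusion of generators $\eta$ sends $v\in\mathcal V$ to the corresponding generating morphism of $\mathrm{Mon}(\mathcal V)$ and $g\in\mathcal G$ to the braid clique morphism with leftmost component the generator $g\colon R\otimes A_0\otimes\dots\otimes A_n\to R\otimes B_0\otimes\dots\otimes B_m$. *)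

theory Defs
  imports Main "HOL-Library.FuncSet"
begin

section \<open>Categories and functors\<close>

text \<open>Composition is diagrammatic. A category has a set of objects and a set of arrows inside
  ambient types; the operations carry no information outside these sets.\<close>

record ('o, 'm) cat =
  Obj :: "'o set"
  Arr :: "'m set"
  Dom :: "'m \<Rightarrow> 'o"
  Cod :: "'m \<Rightarrow> 'o"
  Ide :: "'o \<Rightarrow> 'm"
  Comp :: "'m \<Rightarrow> 'm \<Rightarrow> 'm"  (infixl ";;\<index>" 55)

definition Hom :: "('o, 'm, 'z) cat_scheme \<Rightarrow> 'o \<Rightarrow> 'o \<Rightarrow> 'm set" where
  "Hom C A B = {f \<in> Arr C. Dom C f = A \<and> Cod C f = B}"

locale category =
  fixes C :: "('o, 'm, 'z) cat_scheme" (structure)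
  assumes Dom_closed: "f \<in> Arr C \<Longrightarrow> Dom C f \<in> Obj C"
    and Cod_closed: "f \<in> Arr C \<Longrightarrow> Cod C f \<in> Obj C"
    and Ide_Hom: "A \<in> Obj C \<Longrightarrow> Ide C A \<in> Hom C A A"
    and Comp_Hom: "f \<in> Hom C A B \<Longrightarrow> g \<in> Hom C B D \<Longrightarrow> f ;; g \<in> Hom C A D"
    and Ide_left: "f \<in> Hom C A B \<Longrightarrow> Ide C A ;; f = f"
    and Ide_right: "f \<in> Hom C A B \<Longrightarrow> f ;; Ide C B = f"
    and Comp_assoc: "f \<in> Hom C A B \<Longrightarrow> g \<in> Hom C B D \<Longrightarrow> h \<in> Hom C D E \<Longrightarrow>
      (f ;; g) ;; h = f ;; (g ;; h)"

definition inverse_arrows :: "('o, 'm, 'z) cat_scheme \<Rightarrow> 'm \<Rightarrow> 'm \<Rightarrow> bool" where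
  "inverse_arrows C f g \<longleftrightarrow> f \<in> Arr C \<and> g \<in> Hom C (Cod C f) (Dom C f) \<and>
     f ;;\<^bsub>C\<^esub> g = Ide C (Dom C f) \<and> g ;;\<^bsub>C\<^esub> f = Ide C (Cod C f)"

definition iso_arrow :: "('o, 'm, 'z) cat_scheme \<Rightarrow> 'm \<Rightarrow> bool" where
  "iso_arrow C f \<longleftrightarrow> (\<exists>g. inverse_arrows C f g)"

definition prod_cat ::
  "('o, 'm, 'y) cat_scheme \<Rightarrow> ('p, 'n, 'z) cat_scheme \<Rightarrow> ('o \<times> 'p, 'm \<times> 'n) cat" where
  "prod_cat C D = \<lparr>
     Obj = Obj C \<times> Obj D,
     Arr = Arr C \<times> Arr D,
     Dom = (\<lambda>(f, g). (Dom C f, Dom D g)),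
     Cod = (\<lambda>(f, g). (Cod C f, Cod D g)),
     Ide = (\<lambda>(A, B). (Ide C A, Ide D B)),
     Comp = (\<lambda>(f, g) (f', g'). (f ;;\<^bsub>C\<^esub> f', g ;;\<^bsub>D\<^esub> g')) \<rparr>"

locale cat_functor = src: category C + tgt: category D
  for C :: "('o, 'm, 'y) cat_scheme" and D :: "('p, 'n, 'z) cat_scheme"
    and Fo :: "'o \<Rightarrow> 'p" and Fa :: "'m \<Rightarrow> 'n" +
  assumes Fo_closed: "A \<in> Obj C \<Longrightarrow> Fo A \<in> Obj D"
    and Fa_Hom: "f \<in> Hom C A B \<Longrightarrow> Fa f \<in> Hom D (Fo A) (Fo B)"
    and Fa_Ide: "A \<in> Obj C \<Longrightarrow> Fa (Ide C A) = Ide D (Fo A)"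
    and Fa_Comp: "f \<in> Hom C A B \<Longrightarrow> g \<in> Hom C B E \<Longrightarrow>
      Fa (f ;;\<^bsub>C\<^esub> g) = Fa f ;;\<^bsub>D\<^esub> Fa g"


section \<open>Premonoidal and monoidal categories\<close>

text \<open>The associator goes from \<open>A \<otimes> (B \<otimes> C)\<close> to \<open>(A \<otimes> B) \<otimes> C\<close>.\<close>

record ('o, 'm) tensor_cat = "('o, 'm) cat" +
  Unit :: 'o
  TObj :: "'o \<Rightarrow> 'o \<Rightarrow> 'o"  (infixl "\<otimes>\<index>" 70)
  Assoc :: "'o \<Rightarrow> 'o \<Rightarrow> 'o \<Rightarrow> 'm"
  RUnit :: "'o \<Rightarrow> 'm"
  LUnit :: "'o \<Rightarrow> 'm"

record ('o, 'm) premon_cat = "('o, 'm) tensor_cat" +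
  LWhisk :: "'o \<Rightarrow> 'm \<Rightarrow> 'm"  (infixl "\<ltimes>\<index>" 70)
  RWhisk :: "'m \<Rightarrow> 'o \<Rightarrow> 'm"  (infixl "\<rtimes>\<index>" 70)

record ('o, 'm) mon_cat = "('o, 'm) tensor_cat" +
  TArr :: "'m \<Rightarrow> 'm \<Rightarrow> 'm"  (infixl "\<boxtimes>\<index>" 70)

locale binoidal_category = category C
  for C :: "('o, 'm, 'z) premon_cat_scheme" (structure) +
  assumes Unit_closed: "Unit C \<in> Obj C"
    and LWhisk_functor: "A \<in> Obj C \<Longrightarrow> cat_functor C C (\<lambda>B. A \<otimes> B) (\<lambda>f. A \<ltimes> f)"
    and RWhisk_functor: "B \<in> Obj C \<Longrightarrow> cat_functor C C (\<lambda>A. A \<otimes> B) (\<lambda>f. f \<rtimes> B)"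

definition central :: "('o, 'm, 'z) premon_cat_scheme \<Rightarrow> 'm \<Rightarrow> bool" where
  "central C f \<longleftrightarrow> f \<in> Arr C \<and>
     (let A = Dom C f; B = Cod C f in
      \<forall>g \<in> Arr C. let A' = Dom C g; B' = Cod C g in
        (f \<rtimes>\<^bsub>C\<^esub> A') ;;\<^bsub>C\<^esub> (B \<ltimes>\<^bsub>C\<^esub> g) = (A \<ltimes>\<^bsub>C\<^esub> g) ;;\<^bsub>C\<^esub> (f \<rtimes>\<^bsub>C\<^esub> B') \<and>
        (A' \<ltimes>\<^bsub>C\<^esub> f) ;;\<^bsub>C\<^esub> (g \<rtimes>\<^bsub>C\<^esub> B) = (g \<rtimes>\<^bsub>C\<^esub> A) ;;\<^bsub>C\<^esub> (B' \<ltimes>\<^bsub>C\<^esub> f))"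

locale premonoidal_category = binoidal_category C
  for C :: "('o, 'm, 'z) premon_cat_scheme" (structure) +
  assumes Assoc_Hom: "\<lbrakk>A \<in> Obj C; B \<in> Obj C; D \<in> Obj C\<rbrakk> \<Longrightarrow>
      Assoc C A B D \<in> Hom C (A \<otimes> (B \<otimes> D)) ((A \<otimes> B) \<otimes> D)"
    and Assoc_iso: "\<lbrakk>A \<in> Obj C; B \<in> Obj C; D \<in> Obj C\<rbrakk> \<Longrightarrow> iso_arrow C (Assoc C A B D)"
    and Assoc_central: "\<lbrakk>A \<in> Obj C; B \<in> Obj C; D \<in> Obj C\<rbrakk> \<Longrightarrow> central C (Assoc C A B D)"
    and RUnit_Hom: "A \<in> Obj C \<Longrightarrow> RUnit C A \<in> Hom C (A \<otimes> Unit C) A"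
    and RUnit_iso: "A \<in> Obj C \<Longrightarrow> iso_arrow C (RUnit C A)"
    and RUnit_central: "A \<in> Obj C \<Longrightarrow> central C (RUnit C A)"
    and LUnit_Hom: "A \<in> Obj C \<Longrightarrow> LUnit C A \<in> Hom C (Unit C \<otimes> A) A"
    and LUnit_iso: "A \<in> Obj C \<Longrightarrow> iso_arrow C (LUnit C A)"
    and LUnit_central: "A \<in> Obj C \<Longrightarrow> central C (LUnit C A)"
    and Assoc_natural_1: "\<lbrakk>f \<in> Hom C A A'; B \<in> Obj C; D \<in> Obj C\<rbrakk> \<Longrightarrow>
      (f \<rtimes> (B \<otimes> D)) ;; Assoc C A' B D = Assoc C A B D ;; ((f \<rtimes> B) \<rtimes> D)"
    and Assoc_natural_2: "\<lbrakk>A \<in> Obj C; f \<in> Hom C B B'; D \<in> Obj C\<rbrakk> \<Longrightarrow>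
      (A \<ltimes> (f \<rtimes> D)) ;; Assoc C A B' D = Assoc C A B D ;; ((A \<ltimes> f) \<rtimes> D)"
    and Assoc_natural_3: "\<lbrakk>A \<in> Obj C; B \<in> Obj C; f \<in> Hom C D D'\<rbrakk> \<Longrightarrow>
      (A \<ltimes> (B \<ltimes> f)) ;; Assoc C A B D' = Assoc C A B D ;; ((A \<otimes> B) \<ltimes> f)"
    and RUnit_natural: "f \<in> Hom C A B \<Longrightarrow> (f \<rtimes> Unit C) ;; RUnit C B = RUnit C A ;; f"
    and LUnit_natural: "f \<in> Hom C A B \<Longrightarrow> (Unit C \<ltimes> f) ;; LUnit C B = LUnit C A ;; f"
    and pentagon: "\<lbrakk>A \<in> Obj C; B \<in> Obj C; D \<in> Obj C; E \<in> Obj C\<rbrakk> \<Longrightarrow>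
      Assoc C A B (D \<otimes> E) ;; Assoc C (A \<otimes> B) D E
        = (A \<ltimes> Assoc C B D E) ;; Assoc C A (B \<otimes> D) E ;; (Assoc C A B D \<rtimes> E)"
    and triangle: "\<lbrakk>A \<in> Obj C; B \<in> Obj C\<rbrakk> \<Longrightarrow>
      Assoc C A (Unit C) B ;; (RUnit C A \<rtimes> B) = A \<ltimes> LUnit C B"

locale monoidal_category = category C
  for C :: "('o, 'm, 'z) mon_cat_scheme" (structure) +
  assumes Unit_closed: "Unit C \<in> Obj C"
    and tensor_functor: "cat_functor (prod_cat C C) C (\<lambda>(A, B). A \<otimes> B) (\<lambda>(f, g). f \<boxtimes> g)"
    and Assoc_Hom: "\<lbrakk>A \<in> Obj C; B \<in> Obj C; D \<in> Obj C\<rbrakk> \<Longrightarrow>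
      Assoc C A B D \<in> Hom C (A \<otimes> (B \<otimes> D)) ((A \<otimes> B) \<otimes> D)"
    and Assoc_iso: "\<lbrakk>A \<in> Obj C; B \<in> Obj C; D \<in> Obj C\<rbrakk> \<Longrightarrow> iso_arrow C (Assoc C A B D)"
    and RUnit_Hom: "A \<in> Obj C \<Longrightarrow> RUnit C A \<in> Hom C (A \<otimes> Unit C) A"
    and RUnit_iso: "A \<in> Obj C \<Longrightarrow> iso_arrow C (RUnit C A)"
    and LUnit_Hom: "A \<in> Obj C \<Longrightarrow> LUnit C A \<in> Hom C (Unit C \<otimes> A) A"
    and LUnit_iso: "A \<in> Obj C \<Longrightarrow> iso_arrow C (LUnit C A)"
    and Assoc_natural: "\<lbrakk>f \<in> Hom C A A'; g \<in> Hom C B B'; h \<in> Hom C D D'\<rbrakk> \<Longrightarrow>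
      (f \<boxtimes> (g \<boxtimes> h)) ;; Assoc C A' B' D' = Assoc C A B D ;; ((f \<boxtimes> g) \<boxtimes> h)"
    and RUnit_natural: "f \<in> Hom C A B \<Longrightarrow>
      (f \<boxtimes> Ide C (Unit C)) ;; RUnit C B = RUnit C A ;; f"
    and LUnit_natural: "f \<in> Hom C A B \<Longrightarrow>
      (Ide C (Unit C) \<boxtimes> f) ;; LUnit C B = LUnit C A ;; f"
    and pentagon: "\<lbrakk>A \<in> Obj C; B \<in> Obj C; D \<in> Obj C; E \<in> Obj C\<rbrakk> \<Longrightarrow>
      Assoc C A B (D \<otimes> E) ;; Assoc C (A \<otimes> B) D E
        = (Ide C A \<boxtimes> Assoc C B D E) ;; Assoc C A (B \<otimes> D) E ;; (Assoc C A B D \<boxtimes> Ide C E)"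
    and triangle: "\<lbrakk>A \<in> Obj C; B \<in> Obj C\<rbrakk> \<Longrightarrow>
      Assoc C A (Unit C) B ;; (RUnit C A \<boxtimes> Ide C B) = Ide C A \<boxtimes> LUnit C B"

text \<open>Together with the typing of the associators and unitors, this forces
  \<open>A \<otimes> (B \<otimes> D) = (A \<otimes> B) \<otimes> D\<close>, \<open>A \<otimes> I = A\<close> and \<open>I \<otimes> A = A\<close> on objects.\<close>

definition strict_tensor :: "('o, 'm, 'z) tensor_cat_scheme \<Rightarrow> bool" where
  "strict_tensor C \<longleftrightarrow>
     (\<forall>A\<in>Obj C. \<forall>B\<in>Obj C. \<forall>D\<in>Obj C. Assoc C A B D = Ide C (A \<otimes>\<^bsub>C\<^esub> (B \<otimes>\<^bsub>C\<^esub> D))) \<and>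
     (\<forall>A\<in>Obj C. RUnit C A = Ide C A) \<and>
     (\<forall>A\<in>Obj C. LUnit C A = Ide C A)"

fun tensor_list :: "('o, 'm, 'z) tensor_cat_scheme \<Rightarrow> 'o list \<Rightarrow> 'o" where
  "tensor_list C [] = Unit C"
| "tensor_list C (A # As) = A \<otimes>\<^bsub>C\<^esub> tensor_list C As"


section \<open>Effectful categories and effectful functors\<close>

text \<open>The identity-on-objects functor is given by its action on arrows.\<close>

record ('o, 'n, 'm) eff_cat =
  Pure :: "('o, 'n) mon_cat"
  Eff :: "('o, 'm) premon_cat"
  Incl :: "'n \<Rightarrow> 'm"

locale effectful_category =
  fixes E :: "('o, 'n, 'm) eff_cat"
  assumes pure_monoidal: "monoidal_category (Pure E)"
    and eff_premonoidal: "premonoidal_category (Eff E)"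
    and same_Obj: "Obj (Eff E) = Obj (Pure E)"
    and incl_functor: "cat_functor (Pure E) (Eff E) (\<lambda>A. A) (Incl E)"
    and same_Unit: "Unit (Eff E) = Unit (Pure E)"
    and same_TObj: "\<lbrakk>A \<in> Obj (Pure E); B \<in> Obj (Pure E)\<rbrakk> \<Longrightarrow>
      A \<otimes>\<^bsub>Eff E\<^esub> B = A \<otimes>\<^bsub>Pure E\<^esub> B"
    and incl_LWhisk: "\<lbrakk>A \<in> Obj (Pure E); v \<in> Arr (Pure E)\<rbrakk> \<Longrightarrow>
      Incl E (Ide (Pure E) A \<boxtimes>\<^bsub>Pure E\<^esub> v) = A \<ltimes>\<^bsub>Eff E\<^esub> Incl E v"
    and incl_RWhisk: "\<lbrakk>A \<in> Obj (Pure E); v \<in> Arr (Pure E)\<rbrakk> \<Longrightarrow>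
      Incl E (v \<boxtimes>\<^bsub>Pure E\<^esub> Ide (Pure E) A) = Incl E v \<rtimes>\<^bsub>Eff E\<^esub> A"
    and incl_Assoc: "\<lbrakk>A \<in> Obj (Pure E); B \<in> Obj (Pure E); D \<in> Obj (Pure E)\<rbrakk> \<Longrightarrow>
      Incl E (Assoc (Pure E) A B D) = Assoc (Eff E) A B D"
    and incl_RUnit: "A \<in> Obj (Pure E) \<Longrightarrow> Incl E (RUnit (Pure E) A) = RUnit (Eff E) A"
    and incl_LUnit: "A \<in> Obj (Pure E) \<Longrightarrow> Incl E (LUnit (Pure E) A) = LUnit (Eff E) A"
    and incl_central: "v \<in> Arr (Pure E) \<Longrightarrow> central (Eff E) (Incl E v)"

locale strict_effectful_category = effectful_category E
  for E :: "('o, 'n, 'm) eff_cat" +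
  assumes strict_pure: "strict_tensor (Pure E)"
    and strict_eff: "strict_tensor (Eff E)"

text \<open>\<open>FObj\<close>, \<open>FArr\<close> is the functor between the effectful parts, \<open>F0Obj\<close>, \<open>F0Arr\<close> the one between
  the pure parts. The isomorphisms \<open>Eps\<close> and \<open>Mu\<close> are pure: they are arrows of the pure part of the
  codomain.\<close>

record ('o, 'n, 'm, 'p, 'l, 'k) eff_fun =
  FObj :: "'o \<Rightarrow> 'p"
  FArr :: "'m \<Rightarrow> 'k"
  F0Obj :: "'o \<Rightarrow> 'p"
  F0Arr :: "'n \<Rightarrow> 'l"
  Eps :: 'l
  Mu :: "'o \<times> 'o \<Rightarrow> 'l"

text \<open>\<open>Mu\<close> goes from \<open>F (A \<otimes> B)\<close> to \<open>F A \<otimes> F B\<close>, whereas \<open>Eps\<close> goes from the unit to the image of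
  the unit, so that the unit coherence laws involve the inverse of \<open>Eps\<close>.\<close>

locale iso_monoidal_functor =
  cat_functor V W Fo Fa + src: monoidal_category V + tgt: monoidal_category W
  for V :: "('o, 'n, 'y) mon_cat_scheme" and W :: "('p, 'l, 'z) mon_cat_scheme"
    and Fo :: "'o \<Rightarrow> 'p" and Fa :: "'n \<Rightarrow> 'l" and e :: 'l and m :: "'o \<times> 'o \<Rightarrow> 'l" +
  assumes e_Hom: "e \<in> Hom W (Unit W) (Fo (Unit V))"
    and e_iso: "iso_arrow W e"
    and m_Hom: "\<lbrakk>A \<in> Obj V; B \<in> Obj V\<rbrakk> \<Longrightarrow>
      m (A, B) \<in> Hom W (Fo (A \<otimes>\<^bsub>V\<^esub> B)) (Fo A \<otimes>\<^bsub>W\<^esub> Fo B)"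
    and m_iso: "\<lbrakk>A \<in> Obj V; B \<in> Obj V\<rbrakk> \<Longrightarrow> iso_arrow W (m (A, B))"
    and m_natural: "\<lbrakk>f \<in> Hom V A A'; g \<in> Hom V B B'\<rbrakk> \<Longrightarrow>
      Fa (f \<boxtimes>\<^bsub>V\<^esub> g) ;;\<^bsub>W\<^esub> m (A', B') = m (A, B) ;;\<^bsub>W\<^esub> (Fa f \<boxtimes>\<^bsub>W\<^esub> Fa g)"
    and m_assoc: "\<lbrakk>A \<in> Obj V; B \<in> Obj V; D \<in> Obj V\<rbrakk> \<Longrightarrow>
      Fa (Assoc V A B D) ;;\<^bsub>W\<^esub> m (A \<otimes>\<^bsub>V\<^esub> B, D) ;;\<^bsub>W\<^esub> (m (A, B) \<boxtimes>\<^bsub>W\<^esub> Ide W (Fo D))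
        = m (A, B \<otimes>\<^bsub>V\<^esub> D) ;;\<^bsub>W\<^esub> (Ide W (Fo A) \<boxtimes>\<^bsub>W\<^esub> m (B, D)) ;;\<^bsub>W\<^esub> Assoc W (Fo A) (Fo B) (Fo D)"
    and m_runit: "\<lbrakk>A \<in> Obj V; inverse_arrows W e e'\<rbrakk> \<Longrightarrow>
      m (A, Unit V) ;;\<^bsub>W\<^esub> (Ide W (Fo A) \<boxtimes>\<^bsub>W\<^esub> e') ;;\<^bsub>W\<^esub> RUnit W (Fo A) = Fa (RUnit V A)"
    and m_lunit: "\<lbrakk>A \<in> Obj V; inverse_arrows W e e'\<rbrakk> \<Longrightarrow>
      m (Unit V, A) ;;\<^bsub>W\<^esub> (e' \<boxtimes>\<^bsub>W\<^esub> Ide W (Fo A)) ;;\<^bsub>W\<^esub> LUnit W (Fo A) = Fa (LUnit V A)"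

text \<open>All components are extensional functions, so that equality of records is equality of
  effectful functors.\<close>

locale effectful_functor =
  src: effectful_category E + tgt: effectful_category E'
  for E :: "('o, 'n, 'm) eff_cat" and E' :: "('p, 'l, 'k) eff_cat"
    and H :: "('o, 'n, 'm, 'p, 'l, 'k) eff_fun" +
  assumes F_functor: "cat_functor (Eff E) (Eff E') (FObj H) (FArr H)"
    and F0_monoidal: "iso_monoidal_functor (Pure E) (Pure E') (F0Obj H) (F0Arr H) (Eps H) (Mu H)"
    and square_Obj: "A \<in> Obj (Pure E) \<Longrightarrow> FObj H A = F0Obj H A"
    and square_Arr: "v \<in> Arr (Pure E) \<Longrightarrow> FArr H (Incl E v) = Incl E' (F0Arr H v)"
    and Mu_natural_1: "\<lbrakk>f \<in> Hom (Eff E) A A'; B \<in> Obj (Eff E)\<rbrakk> \<Longrightarrow>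
      FArr H (f \<rtimes>\<^bsub>Eff E\<^esub> B) ;;\<^bsub>Eff E'\<^esub> Incl E' (Mu H (A', B))
        = Incl E' (Mu H (A, B)) ;;\<^bsub>Eff E'\<^esub> (FArr H f \<rtimes>\<^bsub>Eff E'\<^esub> FObj H B)"
    and Mu_natural_2: "\<lbrakk>A \<in> Obj (Eff E); f \<in> Hom (Eff E) B B'\<rbrakk> \<Longrightarrow>
      FArr H (A \<ltimes>\<^bsub>Eff E\<^esub> f) ;;\<^bsub>Eff E'\<^esub> Incl E' (Mu H (A, B'))
        = Incl E' (Mu H (A, B)) ;;\<^bsub>Eff E'\<^esub> (FObj H A \<ltimes>\<^bsub>Eff E'\<^esub> FArr H f)"
    and extensional:
      "FObj H \<in> extensional (Obj (Eff E))" "FArr H \<in> extensional (Arr (Eff E))"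
      "F0Obj H \<in> extensional (Obj (Pure E))" "F0Arr H \<in> extensional (Arr (Pure E))"
      "Mu H \<in> extensional (Obj (Pure E) \<times> Obj (Pure E))"

locale strict_effectful_functor = effectful_functor E E' H
  for E :: "('o, 'n, 'm) eff_cat" and E' :: "('p, 'l, 'k) eff_cat"
    and H :: "('o, 'n, 'm, 'p, 'l, 'k) eff_fun" +
  assumes Eps_identity: "Eps H = Ide (Pure E') (Unit (Pure E'))"
    and Mu_identity: "\<lbrakk>A \<in> Obj (Pure E); B \<in> Obj (Pure E)\<rbrakk> \<Longrightarrow>
      Mu H (A, B) = Ide (Pure E') (F0Obj H A \<otimes>\<^bsub>Pure E'\<^esub> F0Obj H B)"


section \<open>Polygraphs\<close>

text \<open>Arrow sets for different boundaries need not be disjoint.\<close>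

record ('o, 'a) polygraph =
  PObj :: "'o set"
  PArr :: "'o list \<Rightarrow> 'o list \<Rightarrow> 'a set"

definition is_polygraph :: "('o, 'a) polygraph \<Rightarrow> bool" where
  "is_polygraph G \<longleftrightarrow>
     (\<forall>As Bs. PArr G As Bs \<noteq> {} \<longrightarrow> As \<in> lists (PObj G) \<and> Bs \<in> lists (PObj G))"

record ('o, 'a, 'p, 'b) poly_mor =
  MObj :: "'o \<Rightarrow> 'p"
  MArr :: "'o list \<Rightarrow> 'o list \<Rightarrow> 'a \<Rightarrow> 'b"

definition is_poly_mor ::
  "('o, 'a) polygraph \<Rightarrow> ('p, 'b) polygraph \<Rightarrow> ('o, 'a, 'p, 'b) poly_mor \<Rightarrow> bool" where
  "is_poly_mor G H F \<longleftrightarrow>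
     MObj F \<in> PObj G \<rightarrow>\<^sub>E PObj H \<and>
     (\<forall>As Bs. MArr F As Bs \<in> PArr G As Bs \<rightarrow>\<^sub>E PArr H (map (MObj F) As) (map (MObj F) Bs))"

definition poly_mor_comp :: "('o, 'a) polygraph \<Rightarrow> ('o, 'a, 'p, 'b) poly_mor \<Rightarrow>
    ('p, 'b, 'q, 'c) poly_mor \<Rightarrow> ('o, 'a, 'q, 'c) poly_mor" where
  "poly_mor_comp G F F' = \<lparr>
     MObj = compose (PObj G) (MObj F') (MObj F),
     MArr = (\<lambda>As Bs. compose (PArr G As Bs)
       (MArr F' (map (MObj F) As) (map (MObj F) Bs)) (MArr F As Bs)) \<rparr>"

type_synonym ('o, 'v, 'g) poly_couple = "('o, 'v) polygraph \<times> ('o, 'g) polygraph"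

type_synonym ('o, 'v, 'g, 'p, 'w, 'h) couple_mor =
  "('o, 'v, 'p, 'w) poly_mor \<times> ('o, 'g, 'p, 'h) poly_mor"

definition is_poly_couple :: "('o, 'v, 'g) poly_couple \<Rightarrow> bool" where
  "is_poly_couple = (\<lambda>(V, G). is_polygraph V \<and> is_polygraph G \<and> PObj V = PObj G)"

definition is_couple_mor :: "('o, 'v, 'g) poly_couple \<Rightarrow> ('p, 'w, 'h) poly_couple \<Rightarrow>
    ('o, 'v, 'g, 'p, 'w, 'h) couple_mor \<Rightarrow> bool" where
  "is_couple_mor = (\<lambda>(V, G) (W, K) (F0, F).
     is_poly_mor V W F0 \<and> is_poly_mor G K F \<and> MObj F0 = MObj F)"

definition couple_mor_comp :: "('o, 'v, 'g) poly_couple \<Rightarrow>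
    ('o, 'v, 'g, 'p, 'w, 'h) couple_mor \<Rightarrow> ('p, 'w, 'h, 'q, 'x, 'k) couple_mor \<Rightarrow>
    ('o, 'v, 'g, 'q, 'x, 'k) couple_mor" where
  "couple_mor_comp = (\<lambda>(V, G) (F0, F) (F0', F').
     (poly_mor_comp V F0 F0', poly_mor_comp G F F'))"

definition underlying_polygraph :: "('o, 'm, 'z) tensor_cat_scheme \<Rightarrow> ('o, 'm) polygraph" where
  "underlying_polygraph C = \<lparr>
     PObj = Obj C,
     PArr = (\<lambda>As Bs. if As \<in> lists (Obj C) \<and> Bs \<in> lists (Obj C)
       then Hom C (tensor_list C As) (tensor_list C Bs) else {}) \<rparr>"

definition underlying_couple :: "('o, 'n, 'm) eff_cat \<Rightarrow> ('o, 'n, 'm) poly_couple" where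
  "underlying_couple E = (underlying_polygraph (Pure E), underlying_polygraph (Eff E))"

text \<open>Only used for strict \<open>H\<close>, which sends \<open>A\<^sub>0 \<otimes> \<dots> \<otimes> A\<^sub>n\<close> to \<open>H A\<^sub>0 \<otimes> \<dots> \<otimes> H A\<^sub>n\<close>.\<close>

definition underlying_couple_mor :: "('o, 'n, 'm) eff_cat \<Rightarrow> ('o, 'n, 'm, 'p, 'l, 'k) eff_fun \<Rightarrow>
    ('o, 'n, 'm, 'p, 'l, 'k) couple_mor" where
  "underlying_couple_mor E H =
     (\<lparr> MObj = F0Obj H,
        MArr = (\<lambda>As Bs. restrict (F0Arr H) (PArr (underlying_polygraph (Pure E)) As Bs)) \<rparr>,
      \<lparr> MObj = FObj H,
        MArr = (\<lambda>As Bs. restrict (FArr H) (PArr (underlying_polygraph (Eff E)) As Bs)) \<rparr>)"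


section \<open>Presented strict monoidal categories\<close>

datatype ('x, 'g) mterm =
    TId "'x list"
  | TGen 'g
  | TComp "('x, 'g) mterm" "('x, 'g) mterm"
  | TTens "('x, 'g) mterm" "('x, 'g) mterm"

record ('x, 'g) presentation =
  OGens :: "'x set"
  MGens :: "'g set"
  GDom :: "'g \<Rightarrow> 'x list"
  GCod :: "'g \<Rightarrow> 'x list"
  Rels :: "(('x, 'g) mterm \<times> ('x, 'g) mterm) set"

inductive has_type :: "('x, 'g) presentation \<Rightarrow> ('x, 'g) mterm \<Rightarrow> 'x list \<Rightarrow> 'x list \<Rightarrow> bool"
  for P where
  type_Id: "A \<in> lists (OGens P) \<Longrightarrow> has_type P (TId A) A A"
| type_Gen: "\<lbrakk>g \<in> MGens P; GDom P g \<in> lists (OGens P); GCod P g \<in> lists (OGens P)\<rbrakk> \<Longrightarrow>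
    has_type P (TGen g) (GDom P g) (GCod P g)"
| type_Comp: "has_type P t A B \<Longrightarrow> has_type P u B C \<Longrightarrow> has_type P (TComp t u) A C"
| type_Tens: "has_type P t A B \<Longrightarrow> has_type P u A' B' \<Longrightarrow>
    has_type P (TTens t u) (A @ A') (B @ B')"

text \<open>The least congruence on typed terms containing the relations and the axioms of strict monoidal
  categories.\<close>

inductive mon_eq :: "('x, 'g) presentation \<Rightarrow> 'x list \<Rightarrow> 'x list \<Rightarrow>
    ('x, 'g) mterm \<Rightarrow> ('x, 'g) mterm \<Rightarrow> bool"
  for P where
  eq_refl: "has_type P t A B \<Longrightarrow> mon_eq P A B t t"
| eq_sym: "mon_eq P A B t u \<Longrightarrow> mon_eq P A B u t"
| eq_trans: "mon_eq P A B t u \<Longrightarrow> mon_eq P A B u w \<Longrightarrow> mon_eq P A B t w"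
| eq_Comp: "mon_eq P A B t t' \<Longrightarrow> mon_eq P B C u u' \<Longrightarrow> mon_eq P A C (TComp t u) (TComp t' u')"
| eq_Tens: "mon_eq P A B t t' \<Longrightarrow> mon_eq P A' B' u u' \<Longrightarrow>
    mon_eq P (A @ A') (B @ B') (TTens t u) (TTens t' u')"
| eq_rel: "\<lbrakk>(t, u) \<in> Rels P; has_type P t A B; has_type P u A B\<rbrakk> \<Longrightarrow> mon_eq P A B t u"
| eq_Comp_assoc: "\<lbrakk>has_type P t A B; has_type P u B C; has_type P w C D\<rbrakk> \<Longrightarrow>
    mon_eq P A D (TComp (TComp t u) w) (TComp t (TComp u w))"
| eq_Comp_left: "has_type P t A B \<Longrightarrow> mon_eq P A B (TComp (TId A) t) t"
| eq_Comp_right: "has_type P t A B \<Longrightarrow> mon_eq P A B (TComp t (TId B)) t"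
| eq_Tens_assoc: "\<lbrakk>has_type P t A B; has_type P u A' B'; has_type P w A'' B''\<rbrakk> \<Longrightarrow>
    mon_eq P (A @ A' @ A'') (B @ B' @ B'') (TTens (TTens t u) w) (TTens t (TTens u w))"
| eq_Tens_left: "has_type P t A B \<Longrightarrow> mon_eq P A B (TTens (TId []) t) t"
| eq_Tens_right: "has_type P t A B \<Longrightarrow> mon_eq P A B (TTens t (TId [])) t"
| eq_Tens_Id: "\<lbrakk>A \<in> lists (OGens P); B \<in> lists (OGens P)\<rbrakk> \<Longrightarrow>
    mon_eq P (A @ B) (A @ B) (TTens (TId A) (TId B)) (TId (A @ B))"
| eq_interchange: "\<lbrakk>has_type P t A B; has_type P u B C; has_type P t' A' B'; has_type P u' B' C'\<rbrakk>
    \<Longrightarrow> mon_eq P (A @ A') (C @ C')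
      (TTens (TComp t u) (TComp t' u')) (TComp (TTens t t') (TTens u u'))"

text \<open>An arrow is a class of terms together with its domain and codomain.\<close>

type_synonym ('x, 'g) marrow = "'x list \<times> 'x list \<times> ('x, 'g) mterm set"

definition mclass ::
  "('x, 'g) presentation \<Rightarrow> 'x list \<Rightarrow> 'x list \<Rightarrow> ('x, 'g) mterm \<Rightarrow> ('x, 'g) marrow" where
  "mclass P A B t = (A, B, {u. mon_eq P A B t u})"

definition presented_cat :: "('x, 'g) presentation \<Rightarrow> ('x list, ('x, 'g) marrow) mon_cat" where
  "presented_cat P = \<lparr>
     Obj = lists (OGens P),
     Arr = {mclass P A B t | A B t. has_type P t A B},
     Dom = (\<lambda>(A, B, c). A),
     Cod = (\<lambda>(A, B, c). B),
     Ide = (\<lambda>A. mclass P A A (TId A)),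
     Comp = (\<lambda>(A, B, c) (B', C, d). (A, C, {w. \<exists>t\<in>c. \<exists>u\<in>d. mon_eq P A C (TComp t u) w})),
     Unit = [],
     TObj = (@),
     Assoc = (\<lambda>A B C. mclass P (A @ B @ C) (A @ B @ C) (TId (A @ B @ C))),
     RUnit = (\<lambda>A. mclass P A A (TId A)),
     LUnit = (\<lambda>A. mclass P A A (TId A)),
     TArr = (\<lambda>(A, B, c) (A', B', d).
       (A @ A', B @ B', {w. \<exists>t\<in>c. \<exists>u\<in>d. mon_eq P (A @ A') (B @ B') (TTens t u) w})) \<rparr>"

definition polygraph_presentation ::
  "('o, 'v) polygraph \<Rightarrow> ('o, 'o list \<times> 'o list \<times> 'v) presentation" where
  "polygraph_presentation V = \<lparr>
     OGens = PObj V,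
     MGens = {(As, Bs, v) | As Bs v. v \<in> PArr V As Bs},
     GDom = (\<lambda>(As, Bs, v). As),
     GCod = (\<lambda>(As, Bs, v). Bs),
     Rels = {} \<rparr>"

definition Mon :: "('o, 'v) polygraph \<Rightarrow>
    ('o list, ('o, 'o list \<times> 'o list \<times> 'v) marrow) mon_cat" where
  "Mon V = presented_cat (polygraph_presentation V)"


section \<open>The runtime monoidal category\<close>

datatype 'o robj = Runtime | Plain 'o

text \<open>\<open>BraidR X\<close> is the braiding from \<open>R \<otimes> X\<close> to \<open>X \<otimes> R\<close>, moving the runtime to the right;
  \<open>BraidL X\<close> is the one from \<open>X \<otimes> R\<close> to \<open>R \<otimes> X\<close>.\<close>

datatype ('o, 'v, 'g) rgen =
    PureGen "'o list" "'o list" 'v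
  | EffGen "'o list" "'o list" 'g
  | BraidR 'o
  | BraidL 'o

type_synonym ('o, 'v, 'g) rterm = "('o robj, ('o, 'v, 'g) rgen) mterm"
type_synonym ('o, 'v, 'g) rarrow = "('o robj, ('o, 'v, 'g) rgen) marrow"

abbreviation plain :: "'o list \<Rightarrow> 'o robj list" where
  "plain \<equiv> map Plain"

fun rgen_dom :: "('o, 'v, 'g) rgen \<Rightarrow> 'o robj list" where
  "rgen_dom (PureGen As Bs v) = plain As"
| "rgen_dom (EffGen As Bs g) = Runtime # plain As"
| "rgen_dom (BraidR X) = [Runtime, Plain X]"
| "rgen_dom (BraidL X) = [Plain X, Runtime]"

fun rgen_cod :: "('o, 'v, 'g) rgen \<Rightarrow> 'o robj list" where
  "rgen_cod (PureGen As Bs v) = plain Bs"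
| "rgen_cod (EffGen As Bs g) = Runtime # plain Bs"
| "rgen_cod (BraidR X) = [Plain X, Runtime]"
| "rgen_cod (BraidL X) = [Runtime, Plain X]"

text \<open>\<open>sigma As\<close> is the composite of braidings from \<open>R \<otimes> A\<close> to \<open>A \<otimes> R\<close>, and \<open>sigma_inv As\<close> the
  one in the opposite direction.\<close>

fun sigma :: "'o list \<Rightarrow> ('o, 'v, 'g) rterm" where
  "sigma [] = TId [Runtime]"
| "sigma (A # As) =
     TComp (TTens (TGen (BraidR A)) (TId (plain As))) (TTens (TId [Plain A]) (sigma As))"

fun sigma_inv :: "'o list \<Rightarrow> ('o, 'v, 'g) rterm" where
  "sigma_inv [] = TId [Runtime]"
| "sigma_inv (A # As) =
     TComp (TTens (TId [Plain A]) (sigma_inv As)) (TTens (TGen (BraidL A)) (TId (plain As)))"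

definition runtime_presentation ::
  "('o, 'v, 'g) poly_couple \<Rightarrow> ('o robj, ('o, 'v, 'g) rgen) presentation" where
  "runtime_presentation = (\<lambda>(V, G). \<lparr>
     OGens = insert Runtime (Plain ` PObj V),
     MGens = {PureGen As Bs v | As Bs v. v \<in> PArr V As Bs}
           \<union> {EffGen As Bs g | As Bs g. g \<in> PArr G As Bs}
           \<union> BraidR ` PObj V \<union> BraidL ` PObj V,
     GDom = rgen_dom,
     GCod = rgen_cod,
     Rels = {(TComp (TGen (BraidR X)) (TGen (BraidL X)), TId [Runtime, Plain X]) | X. X \<in> PObj V}
          \<union> {(TComp (TGen (BraidL X)) (TGen (BraidR X)), TId [Plain X, Runtime]) | X. X \<in> PObj V}
          \<union> {(TComp (TTens (TId [Runtime]) (TGen (PureGen As Bs v))) (sigma Bs),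
              TComp (sigma As) (TTens (TGen (PureGen As Bs v)) (TId [Runtime])))
             | As Bs v. v \<in> PArr V As Bs} \<rparr>)"

definition MonRun :: "('o, 'v, 'g) poly_couple \<Rightarrow> ('o robj list, ('o, 'v, 'g) rarrow) mon_cat" where
  "MonRun VG = presented_cat (runtime_presentation VG)"


section \<open>Braid cliques\<close>

definition braid_clique :: "'o list \<Rightarrow> nat \<Rightarrow> 'o robj list" where
  "braid_clique As i = plain (take i As) @ [Runtime] @ plain (drop i As)"

definition clique_iso_term :: "'o list \<Rightarrow> nat \<Rightarrow> nat \<Rightarrow> ('o, 'v, 'g) rterm" where
  "clique_iso_term As i j =
     (if i \<le> j
      then TTens (TId (plain (take i As)))
             (TTens (sigma (drop i (take j As))) (TId (plain (drop j As))))
      else TTens (TId (plain (take j As)))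
             (TTens (sigma_inv (drop j (take i As))) (TId (plain (drop i As)))))"

definition clique_iso ::
  "('o, 'v, 'g) poly_couple \<Rightarrow> 'o list \<Rightarrow> nat \<Rightarrow> nat \<Rightarrow> ('o, 'v, 'g) rarrow" where
  "clique_iso VG As i j = mclass (runtime_presentation VG)
     (braid_clique As i) (braid_clique As j) (clique_iso_term As i j)"

text \<open>A braid clique morphism carries the lists indexing its domain and codomain cliques; the
  component at \<open>(i, k)\<close> goes from position \<open>i\<close> of the domain to position \<open>k\<close> of the codomain.\<close>

type_synonym ('o, 'v, 'g) clique_mor =
  "'o list \<times> 'o list \<times> (nat \<times> nat \<Rightarrow> ('o, 'v, 'g) rarrow)"

definition is_clique_mor :: "('o, 'v, 'g) poly_couple \<Rightarrow> ('o, 'v, 'g) clique_mor \<Rightarrow> bool" where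
  "is_clique_mor VG = (\<lambda>(As, Bs, f).
     As \<in> lists (PObj (fst VG)) \<and> Bs \<in> lists (PObj (fst VG)) \<and>
     f \<in> extensional ({..length As} \<times> {..length Bs}) \<and>
     (\<forall>i \<le> length As. \<forall>k \<le> length Bs.
        f (i, k) \<in> Hom (MonRun VG) (braid_clique As i) (braid_clique Bs k)) \<and>
     (\<forall>i \<le> length As. \<forall>l \<le> length As. \<forall>j \<le> length Bs. \<forall>k \<le> length Bs.
        f (i, j) ;;\<^bsub>MonRun VG\<^esub> clique_iso VG Bs j k = clique_iso VG As i l ;;\<^bsub>MonRun VG\<^esub> f (l, k)))"

definition leftmost :: "('o, 'v, 'g) clique_mor \<Rightarrow> ('o, 'v, 'g) rarrow" where
  "leftmost = (\<lambda>(As, Bs, f). f (0, 0))"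

text \<open>A clique morphism \<open>f\<close> satisfies \<open>f\<^sub>i\<^sub>k = \<sigma>\<^sub>i\<^sub>0 ; f\<^sub>0\<^sub>0 ; \<sigma>\<^sub>0\<^sub>k\<close>, so this is the one with leftmost component \<open>m\<close>.\<close>

definition clique_mor_of :: "('o, 'v, 'g) poly_couple \<Rightarrow> 'o list \<Rightarrow> 'o list \<Rightarrow>
    ('o, 'v, 'g) rarrow \<Rightarrow> ('o, 'v, 'g) clique_mor" where
  "clique_mor_of VG As Bs m = (As, Bs,
     restrict (\<lambda>(i, k). clique_iso VG As i 0 ;;\<^bsub>MonRun VG\<^esub> m ;;\<^bsub>MonRun VG\<^esub> clique_iso VG Bs 0 k)
       ({..length As} \<times> {..length Bs}))"


section \<open>The free effectful category\<close>

definition braiding :: "('o, 'v, 'g) poly_couple \<Rightarrow> 'o list \<Rightarrow> ('o, 'v, 'g) rarrow" where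
  "braiding VG As = mclass (runtime_presentation VG)
     (Runtime # plain As) (plain As @ [Runtime]) (sigma As)"

definition braiding_inv :: "('o, 'v, 'g) poly_couple \<Rightarrow> 'o list \<Rightarrow> ('o, 'v, 'g) rarrow" where
  "braiding_inv VG As = mclass (runtime_presentation VG)
     (plain As @ [Runtime]) (Runtime # plain As) (sigma_inv As)"

definition eff_Ide :: "('o, 'v, 'g) poly_couple \<Rightarrow> 'o list \<Rightarrow> ('o, 'v, 'g) clique_mor" where
  "eff_Ide VG As = clique_mor_of VG As As (Ide (MonRun VG) (Runtime # plain As))"

definition FreeEff ::
  "('o, 'v, 'g) poly_couple \<Rightarrow> ('o list, ('o, 'v, 'g) clique_mor) premon_cat" where
  "FreeEff VG = (let M = MonRun VG in \<lparr>
     Obj = lists (PObj (fst VG)),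
     Arr = {f. is_clique_mor VG f},
     Dom = (\<lambda>(As, Bs, f). As),
     Cod = (\<lambda>(As, Bs, f). Bs),
     Ide = eff_Ide VG,
     Comp = (\<lambda>f g. clique_mor_of VG (fst f) (fst (snd g)) (leftmost f ;;\<^bsub>M\<^esub> leftmost g)),
     Unit = [],
     TObj = (@),
     Assoc = (\<lambda>As Bs Cs. eff_Ide VG (As @ Bs @ Cs)),
     RUnit = eff_Ide VG,
     LUnit = eff_Ide VG,
     LWhisk = (\<lambda>Cs f. let As = fst f; Bs = fst (snd f) in clique_mor_of VG (Cs @ As) (Cs @ Bs)
       ((braiding VG Cs \<boxtimes>\<^bsub>M\<^esub> Ide M (plain As)) ;;\<^bsub>M\<^esub>
        (Ide M (plain Cs) \<boxtimes>\<^bsub>M\<^esub> leftmost f) ;;\<^bsub>M\<^esub>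
        (braiding_inv VG Cs \<boxtimes>\<^bsub>M\<^esub> Ide M (plain Bs)))),
     RWhisk = (\<lambda>f Cs. clique_mor_of VG (fst f @ Cs) (fst (snd f) @ Cs)
       (leftmost f \<boxtimes>\<^bsub>M\<^esub> Ide M (plain Cs))) \<rparr>)"

text \<open>The strict monoidal functor \<open>Mon(V) \<rightarrow> MonRun(V, G)\<close> induced by the inclusion of the generators of
  \<open>V\<close>: on terms, then on classes.\<close>

fun plain_gen :: "'o list \<times> 'o list \<times> 'v \<Rightarrow> ('o, 'v, 'g) rgen" where
  "plain_gen (As, Bs, v) = PureGen As Bs v"

definition pure_to_run :: "('o, 'v, 'g) poly_couple \<Rightarrow>
    ('o, 'o list \<times> 'o list \<times> 'v) marrow \<Rightarrow> ('o, 'v, 'g) rarrow" where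
  "pure_to_run VG = (\<lambda>(As, Bs, c). (plain As, plain Bs,
     {w. \<exists>t\<in>c. mon_eq (runtime_presentation VG) (plain As) (plain Bs) (map_mterm Plain plain_gen t) w}))"

definition free_effectful :: "('o, 'v, 'g) poly_couple \<Rightarrow>
    ('o list, ('o, 'o list \<times> 'o list \<times> 'v) marrow, ('o, 'v, 'g) clique_mor) eff_cat" where
  "free_effectful VG = \<lparr>
     Pure = Mon (fst VG),
     Eff = FreeEff VG,
     Incl = (\<lambda>v. clique_mor_of VG (Dom (Mon (fst VG)) v) (Cod (Mon (fst VG)) v)
       (Ide (MonRun VG) [Runtime] \<boxtimes>\<^bsub>MonRun VG\<^esub> pure_to_run VG v)) \<rparr>"

definition generators :: "('o, 'v, 'g) poly_couple \<Rightarrow>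
    ('o, 'v, 'g, 'o list, ('o, 'o list \<times> 'o list \<times> 'v) marrow, ('o, 'v, 'g) clique_mor) couple_mor"
  where
  "generators VG =
     (\<lparr> MObj = (\<lambda>A \<in> PObj (fst VG). [A]),
        MArr = (\<lambda>As Bs. \<lambda>v \<in> PArr (fst VG) As Bs.
          mclass (polygraph_presentation (fst VG)) As Bs (TGen (As, Bs, v))) \<rparr>,
      \<lparr> MObj = (\<lambda>A \<in> PObj (snd VG). [A]),
        MArr = (\<lambda>As Bs. \<lambda>g \<in> PArr (snd VG) As Bs.
          clique_mor_of VG As Bs (mclass (runtime_presentation VG)
            (Runtime # plain As) (Runtime # plain Bs) (TGen (EffGen As Bs g)))) \<rparr>)"

end

theory Submission
  imports Defs
begin

text \<open>An effectful category interprets every term of the runtime category whose domain contains at most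
  one runtime: the runtime is forgotten, braidings become identities, terms without runtime are sent
  to the pure part and terms with one runtime to the effectful part. Interchange holds because at
  most one of two tensored terms carries the runtime, and the other is then pure, hence central.
  This gives the functor out of the free category. It is unique because conjugating by braidings
  brings the runtime of any such term to the front, which exhibits each arrow from \<open>R \<otimes> A\<close> to
  \<open>R \<otimes> B\<close> as a composite of whiskered generators.\<close>

section \<open>Strict monoidal and premonoidal categories\<close>

text \<open>The presented category tensors everything with everything, so its terms include ones
  with two or more runtimes, to which a premonoidal target gives no meaning. Interpreting only the
  meaningful terms would call for a soundness argument with a partial tensor. Instead the target is
  completed to a total strict monoidal category: objects carry a runtime count capped at 2, and
  parallel arrows at count 2 are all equal. Generators preserve the count, so an arrow from
  \<open>R \<otimes> A\<close> to \<open>R \<otimes> B\<close> lives at count 1 and never meets the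
  collapsed part. For uniqueness the obstacle is that a term with the runtime in front at both ends
  may have it anywhere in between, and a tensor may hide it behind a pure factor. The induction
  therefore ranges over all boundaries with one runtime, and the conjugate of an arrow is
  characterised by a commuting square instead of by inverses. Squares paste along composites; for
  tensors, naturality of the braiding, imposed on generators and extended to all pure arrows, moves
  the runtime past the pure factor.\<close>

lemma Hom_iff: "f \<in> Hom C A B \<longleftrightarrow> f \<in> Arr C \<and> Dom C f = A \<and> Cod C f = B"
  by (auto simp: Hom_def)

context category
begin

lemma in_Hom: "f \<in> Arr C \<Longrightarrow> f \<in> Hom C (Dom C f) (Cod C f)"
  by (simp add: Hom_iff)

lemma Hom_Obj: "f \<in> Hom C A B \<Longrightarrow> A \<in> Obj C \<and> B \<in> Obj C"
  using Dom_closed Cod_closed by (auto simp: Hom_iff)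

lemma Ide_simps [simp]:
  assumes "A \<in> Obj C"
  shows "Ide C A \<in> Arr C" "Dom C (Ide C A) = A" "Cod C (Ide C A) = A"
  using Ide_Hom[OF assms] by (auto simp: Hom_iff)

lemma Comp_simps [simp]:
  assumes "f \<in> Arr C" "g \<in> Arr C" "Cod C f = Dom C g"
  shows "f ;; g \<in> Arr C" "Dom C (f ;; g) = Dom C f" "Cod C (f ;; g) = Cod C g"
  using Comp_Hom[of f "Dom C f" "Cod C f" g "Cod C g"] assms by (auto simp: Hom_iff)

lemma Ide_left_Arr [simp]: "f \<in> Arr C \<Longrightarrow> Dom C f = A \<Longrightarrow> Ide C A ;; f = f"
  using Ide_left by (auto simp: Hom_iff)

lemma Ide_right_Arr [simp]: "f \<in> Arr C \<Longrightarrow> Cod C f = A \<Longrightarrow> f ;; Ide C A = f"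
  using Ide_right by (auto simp: Hom_iff)

lemma Comp_assoc_Arr [simp]:
  "\<lbrakk>f \<in> Arr C; g \<in> Arr C; h \<in> Arr C; Cod C f = Dom C g; Cod C g = Dom C h\<rbrakk> \<Longrightarrow>
    (f ;; g) ;; h = f ;; (g ;; h)"
  using Comp_assoc by (auto simp: Hom_iff)

text \<open>Lets an equation between two-arrow composites act inside a longer composite, which
  \<open>Comp_assoc_Arr\<close> has nested to the right.\<close>

lemma Comp_reassoc:
  "\<lbrakk>f ;; g = h; f \<in> Arr C; g \<in> Arr C; k \<in> Arr C; Cod C f = Dom C g; Cod C g = Dom C k\<rbrakk> \<Longrightarrow>
    f ;; (g ;; k) = h ;; k"
  using Comp_assoc_Arr by metis

lemma Ide_iso: "A \<in> Obj C \<Longrightarrow> iso_arrow C (Ide C A)"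
  unfolding iso_arrow_def inverse_arrows_def
  by (rule exI[of _ "Ide C A"]) (simp add: Hom_iff)

text \<open>Serves the unit laws of \<open>iso_monoidal_functor\<close>, which quantify over an
  inverse of the unit comparison.\<close>

lemma inverse_Ide:
  assumes "A \<in> Obj C" "inverse_arrows C (Ide C A) e"
  shows "e = Ide C A"
  using assms Ide_left_Arr by (fastforce simp: inverse_arrows_def Hom_iff)

end

lemma cat_functorI:
  assumes "category C" "category D"
    and "\<And>A. A \<in> Obj C \<Longrightarrow> Fo A \<in> Obj D"
    and "\<And>f A B. f \<in> Hom C A B \<Longrightarrow> Fa f \<in> Hom D (Fo A) (Fo B)"
    and "\<And>A. A \<in> Obj C \<Longrightarrow> Fa (Ide C A) = Ide D (Fo A)"
    and "\<And>f g A B E. f \<in> Hom C A B \<Longrightarrow> g \<in> Hom C B E \<Longrightarrow> Fa (f ;;\<^bsub>C\<^esub> g) = Fa f ;;\<^bsub>D\<^esub> Fa g"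
  shows "cat_functor C D Fo Fa"
  using assms by (intro cat_functor.intro cat_functor_axioms.intro) auto

text \<open>The object part common to strict monoidal and strict premonoidal categories: a monoid of
  objects, which is all that \<open>tensor_list\<close> depends on.\<close>

locale strict_tensor_objects =
  fixes C :: "('o, 'm, 'z) tensor_cat_scheme" (structure)
  assumes Unit_closed [simp]: "Unit C \<in> Obj C"
    and TObj_closed [simp]: "\<lbrakk>A \<in> Obj C; B \<in> Obj C\<rbrakk> \<Longrightarrow> A \<otimes> B \<in> Obj C"
    and TObj_assoc [simp]: "\<lbrakk>A \<in> Obj C; B \<in> Obj C; D \<in> Obj C\<rbrakk> \<Longrightarrow> (A \<otimes> B) \<otimes> D = A \<otimes> (B \<otimes> D)"
    and TObj_unit_left [simp]: "A \<in> Obj C \<Longrightarrow> Unit C \<otimes> A = A"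
    and TObj_unit_right [simp]: "A \<in> Obj C \<Longrightarrow> A \<otimes> Unit C = A"
begin

lemma tensor_list_closed [simp]: "As \<in> lists (Obj C) \<Longrightarrow> tensor_list C As \<in> Obj C"
  by (induction As) auto

lemma tensor_list_append:
  "\<lbrakk>As \<in> lists (Obj C); Bs \<in> lists (Obj C)\<rbrakk> \<Longrightarrow>
    tensor_list C (As @ Bs) = tensor_list C As \<otimes> tensor_list C Bs"
  by (induction As) auto

end

text \<open>An identity has equal domain and codomain; reading this off the typing of associators
  and unitors gives the equations between objects.\<close>

lemma strict_tensor_objectsI:
  assumes "category C" "strict_tensor C" "Unit C \<in> Obj C"
    and closed: "\<And>A B. \<lbrakk>A \<in> Obj C; B \<in> Obj C\<rbrakk> \<Longrightarrow> A \<otimes>\<^bsub>C\<^esub> B \<in> Obj C"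
    and a: "\<And>A B D. \<lbrakk>A \<in> Obj C; B \<in> Obj C; D \<in> Obj C\<rbrakk> \<Longrightarrow>
      Assoc C A B D \<in> Hom C (A \<otimes>\<^bsub>C\<^esub> (B \<otimes>\<^bsub>C\<^esub> D)) ((A \<otimes>\<^bsub>C\<^esub> B) \<otimes>\<^bsub>C\<^esub> D)"
    and r: "\<And>A. A \<in> Obj C \<Longrightarrow> RUnit C A \<in> Hom C (A \<otimes>\<^bsub>C\<^esub> Unit C) A"
    and l: "\<And>A. A \<in> Obj C \<Longrightarrow> LUnit C A \<in> Hom C (Unit C \<otimes>\<^bsub>C\<^esub> A) A"
  shows "strict_tensor_objects C"
proof -
  interpret category C by fact
  have *: "A = B \<and> A = D" if "Ide C A \<in> Hom C B D" "A \<in> Obj C" for A B D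
    using that by (auto simp: Hom_iff)
  show ?thesis
  proof
    fix A B D assume "A \<in> Obj C" "B \<in> Obj C" "D \<in> Obj C"
    with a[OF this] closed * assms(2) show "(A \<otimes>\<^bsub>C\<^esub> B) \<otimes>\<^bsub>C\<^esub> D = A \<otimes>\<^bsub>C\<^esub> (B \<otimes>\<^bsub>C\<^esub> D)"
      unfolding strict_tensor_def by metis
  next
    fix A assume "A \<in> Obj C"
    with l[OF this] r[OF this] * assms(2)
    show "Unit C \<otimes>\<^bsub>C\<^esub> A = A" "A \<otimes>\<^bsub>C\<^esub> Unit C = A"
      unfolding strict_tensor_def by metis+
  qed (use assms in auto)
qed

text \<open>Laws are assumed for \<open>Hom\<close> and restated below for \<open>Arr\<close> with
  conditions on \<open>Dom\<close> and \<open>Cod\<close>, so that the simplifier can discharge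
  typing by computing boundaries.\<close>

locale strict_monoidal = category C + strict_tensor_objects C
  for C :: "('o, 'm, 'z) mon_cat_scheme" (structure) +
  assumes TArr_Hom: "\<lbrakk>f \<in> Hom C A B; g \<in> Hom C A' B'\<rbrakk> \<Longrightarrow> f \<boxtimes> g \<in> Hom C (A \<otimes> A') (B \<otimes> B')"
    and TArr_Ide: "\<lbrakk>A \<in> Obj C; B \<in> Obj C\<rbrakk> \<Longrightarrow> Ide C A \<boxtimes> Ide C B = Ide C (A \<otimes> B)"
    and interchange: "\<lbrakk>f \<in> Hom C A B; g \<in> Hom C B D; f' \<in> Hom C A' B'; g' \<in> Hom C B' D'\<rbrakk> \<Longrightarrow>
      (f ;; g) \<boxtimes> (f' ;; g') = (f \<boxtimes> f') ;; (g \<boxtimes> g')"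
    and TArr_assoc: "\<lbrakk>f \<in> Hom C A B; g \<in> Hom C A' B'; h \<in> Hom C A'' B''\<rbrakk> \<Longrightarrow>
      (f \<boxtimes> g) \<boxtimes> h = f \<boxtimes> (g \<boxtimes> h)"
    and TArr_unit_left: "f \<in> Hom C A B \<Longrightarrow> Ide C (Unit C) \<boxtimes> f = f"
    and TArr_unit_right: "f \<in> Hom C A B \<Longrightarrow> f \<boxtimes> Ide C (Unit C) = f"
begin

lemma TArr_simps [simp]:
  assumes "f \<in> Arr C" "g \<in> Arr C"
  shows "f \<boxtimes> g \<in> Arr C" "Dom C (f \<boxtimes> g) = Dom C f \<otimes> Dom C g" "Cod C (f \<boxtimes> g) = Cod C f \<otimes> Cod C g"
  using TArr_Hom[OF in_Hom in_Hom] assms by (auto simp: Hom_iff)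

lemma TArr_assoc_Arr [simp]:
  "\<lbrakk>f \<in> Arr C; g \<in> Arr C; h \<in> Arr C\<rbrakk> \<Longrightarrow> (f \<boxtimes> g) \<boxtimes> h = f \<boxtimes> (g \<boxtimes> h)"
  using TArr_assoc by (auto simp: Hom_iff)

lemma TArr_unit_Arr [simp]:
  assumes "f \<in> Arr C"
  shows "Ide C (Unit C) \<boxtimes> f = f" "f \<boxtimes> Ide C (Unit C) = f"
  using TArr_unit_left[OF in_Hom] TArr_unit_right[OF in_Hom] assms by auto

text \<open>Interchange in the merging direction: a composite of tensors becomes one tensor whose
  factors simplify separately.\<close>

lemma Comp_TArr:
  "\<lbrakk>f \<in> Arr C; f' \<in> Arr C; g \<in> Arr C; g' \<in> Arr C; Cod C f = Dom C g; Cod C f' = Dom C g'\<rbrakk> \<Longrightarrow>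
    (f \<boxtimes> f') ;; (g \<boxtimes> g') = (f ;; g) \<boxtimes> (f' ;; g')"
  using interchange by (auto simp: Hom_iff)

lemma Comp_TArr_reassoc:
  "\<lbrakk>f \<in> Arr C; f' \<in> Arr C; g \<in> Arr C; g' \<in> Arr C; h \<in> Arr C;
    Cod C f = Dom C g; Cod C f' = Dom C g'; Cod C g \<otimes> Cod C g' = Dom C h\<rbrakk> \<Longrightarrow>
    (f \<boxtimes> f') ;; ((g \<boxtimes> g') ;; h) = ((f ;; g) \<boxtimes> (f' ;; g')) ;; h"
  by (simp add: Comp_reassoc[OF Comp_TArr])

end

text \<open>The laws \<open>RWhisk_RWhisk\<close>, \<open>LWhisk_RWhisk\<close> and
  \<open>LWhisk_LWhisk\<close> are naturality of the associator in its first, middle and last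
  variable once the associator is an identity.\<close>

locale strict_premonoidal = category C + strict_tensor_objects C
  for C :: "('o, 'm, 'z) premon_cat_scheme" (structure) +
  assumes LWhisk_Hom: "\<lbrakk>A \<in> Obj C; f \<in> Hom C B B'\<rbrakk> \<Longrightarrow> A \<ltimes> f \<in> Hom C (A \<otimes> B) (A \<otimes> B')"
    and RWhisk_Hom: "\<lbrakk>A \<in> Obj C; f \<in> Hom C B B'\<rbrakk> \<Longrightarrow> f \<rtimes> A \<in> Hom C (B \<otimes> A) (B' \<otimes> A)"
    and LWhisk_Ide [simp]: "\<lbrakk>A \<in> Obj C; B \<in> Obj C\<rbrakk> \<Longrightarrow> A \<ltimes> Ide C B = Ide C (A \<otimes> B)"
    and RWhisk_Ide [simp]: "\<lbrakk>A \<in> Obj C; B \<in> Obj C\<rbrakk> \<Longrightarrow> Ide C B \<rtimes> A = Ide C (B \<otimes> A)"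
    and LWhisk_Comp: "\<lbrakk>A \<in> Obj C; f \<in> Hom C B B'; g \<in> Hom C B' B''\<rbrakk> \<Longrightarrow>
      A \<ltimes> (f ;; g) = (A \<ltimes> f) ;; (A \<ltimes> g)"
    and RWhisk_Comp: "\<lbrakk>A \<in> Obj C; f \<in> Hom C B B'; g \<in> Hom C B' B''\<rbrakk> \<Longrightarrow>
      (f ;; g) \<rtimes> A = (f \<rtimes> A) ;; (g \<rtimes> A)"
    and LWhisk_LWhisk: "\<lbrakk>A \<in> Obj C; B \<in> Obj C; f \<in> Hom C D D'\<rbrakk> \<Longrightarrow> A \<ltimes> (B \<ltimes> f) = (A \<otimes> B) \<ltimes> f"
    and RWhisk_RWhisk: "\<lbrakk>A \<in> Obj C; B \<in> Obj C; f \<in> Hom C D D'\<rbrakk> \<Longrightarrow> (f \<rtimes> A) \<rtimes> B = f \<rtimes> (A \<otimes> B)"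
    and LWhisk_RWhisk: "\<lbrakk>A \<in> Obj C; B \<in> Obj C; f \<in> Hom C D D'\<rbrakk> \<Longrightarrow> (A \<ltimes> f) \<rtimes> B = A \<ltimes> (f \<rtimes> B)"
    and LWhisk_unit: "f \<in> Hom C A B \<Longrightarrow> Unit C \<ltimes> f = f"
    and RWhisk_unit: "f \<in> Hom C A B \<Longrightarrow> f \<rtimes> Unit C = f"
begin

lemma Whisk_simps [simp]:
  assumes "f \<in> Arr C" "A \<in> Obj C"
  shows "A \<ltimes> f \<in> Arr C" "Dom C (A \<ltimes> f) = A \<otimes> Dom C f" "Cod C (A \<ltimes> f) = A \<otimes> Cod C f"
    "f \<rtimes> A \<in> Arr C" "Dom C (f \<rtimes> A) = Dom C f \<otimes> A" "Cod C (f \<rtimes> A) = Cod C f \<otimes> A"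
  using LWhisk_Hom[OF _ in_Hom] RWhisk_Hom[OF _ in_Hom] assms by (auto simp: Hom_iff)

lemma Whisk_Comp_Arr [simp]:
  assumes "f \<in> Arr C" "g \<in> Arr C" "Cod C f = Dom C g" "A \<in> Obj C"
  shows "A \<ltimes> (f ;; g) = (A \<ltimes> f) ;; (A \<ltimes> g)" "(f ;; g) \<rtimes> A = (f \<rtimes> A) ;; (g \<rtimes> A)"
  using LWhisk_Comp RWhisk_Comp assms by (auto simp: Hom_iff)

lemma Whisk_Whisk_Arr [simp]:
  assumes "f \<in> Arr C" "A \<in> Obj C" "B \<in> Obj C"
  shows "A \<ltimes> (B \<ltimes> f) = (A \<otimes> B) \<ltimes> f" "(f \<rtimes> A) \<rtimes> B = f \<rtimes> (A \<otimes> B)"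
    "(A \<ltimes> f) \<rtimes> B = A \<ltimes> (f \<rtimes> B)"
  using LWhisk_LWhisk RWhisk_RWhisk LWhisk_RWhisk assms by (auto simp: Hom_iff)

lemma Whisk_unit_Arr [simp]:
  assumes "f \<in> Arr C"
  shows "Unit C \<ltimes> f = f" "f \<rtimes> Unit C = f"
  using LWhisk_unit RWhisk_unit assms by (auto simp: Hom_iff)

lemma central_Ide: "A \<in> Obj C \<Longrightarrow> central C (Ide C A)"
  by (simp add: central_def Let_def Dom_closed Cod_closed)

end

section \<open>Structures with identity coherences and the strict axioms\<close>

lemma category_prod_cat:
  assumes "category C" "category D"
  shows "category (prod_cat C D)"
proof -
  interpret C: category C by fact
  interpret D: category D by fact
  show ?thesis
    by unfold_locales
      (auto simp: prod_cat_def Hom_iff C.Dom_closed D.Dom_closed C.Cod_closed D.Cod_closed)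
qed

lemma Hom_prod_cat:
  "p \<in> Hom (prod_cat C D) A B \<longleftrightarrow> fst p \<in> Hom C (fst A) (fst B) \<and> snd p \<in> Hom D (snd A) (snd B)"
  by (cases p; cases A; cases B) (auto simp: prod_cat_def Hom_iff)

text \<open>Identity coherences cancel from their naturality squares, which leaves equations between
  the tensored arrows themselves.\<close>

lemma monoidal_category_imp_strict_monoidal:
  assumes "monoidal_category C" "strict_tensor C"
  shows "strict_monoidal C"
proof -
  interpret monoidal_category C by fact
  interpret T: cat_functor "prod_cat C C" C "\<lambda>(A, B). A \<otimes>\<^bsub>C\<^esub> B" "\<lambda>(f, g). f \<boxtimes>\<^bsub>C\<^esub> g"
    by (rule tensor_functor)
  have T: "f \<boxtimes>\<^bsub>C\<^esub> g \<in> Hom C (A \<otimes>\<^bsub>C\<^esub> A') (B \<otimes>\<^bsub>C\<^esub> B')" if "f \<in> Hom C A B" "g \<in> Hom C A' B'" for f g A B A' B'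
    using T.Fa_Hom[of "(f, g)" "(A, A')" "(B, B')"] that by (simp add: Hom_prod_cat)
  have O: "A \<otimes>\<^bsub>C\<^esub> B \<in> Obj C" if "A \<in> Obj C" "B \<in> Obj C" for A B
    using T.Fo_closed[of "(A, B)"] that by (simp add: prod_cat_def)
  interpret strict_tensor_objects C
    by (rule strict_tensor_objectsI)
      (use assms category_axioms Unit_closed O Assoc_Hom RUnit_Hom LUnit_Hom in auto)
  note S = assms(2)[unfolded strict_tensor_def, rule_format]
  have SA: "\<lbrakk>A \<in> Obj C; B \<in> Obj C; D \<in> Obj C\<rbrakk> \<Longrightarrow>
      Assoc C A B D = Ide C (A \<otimes>\<^bsub>C\<^esub> (B \<otimes>\<^bsub>C\<^esub> D))"
    "A \<in> Obj C \<Longrightarrow> RUnit C A = Ide C A" "A \<in> Obj C \<Longrightarrow> LUnit C A = Ide C A" for A B D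
    using S by auto
  show ?thesis
  proof
    fix f A B g A' B' assume "f \<in> Hom C A B" "g \<in> Hom C A' B'"
    then show "f \<boxtimes>\<^bsub>C\<^esub> g \<in> Hom C (A \<otimes>\<^bsub>C\<^esub> A') (B \<otimes>\<^bsub>C\<^esub> B')" by (rule T)
  next
    fix A B assume "A \<in> Obj C" "B \<in> Obj C"
    then show "Ide C A \<boxtimes>\<^bsub>C\<^esub> Ide C B = Ide C (A \<otimes>\<^bsub>C\<^esub> B)"
      using T.Fa_Ide[of "(A, B)"] by (simp add: prod_cat_def)
  next
    fix f A B g D f' A' B' g' D'
    assume "f \<in> Hom C A B" "g \<in> Hom C B D" "f' \<in> Hom C A' B'" "g' \<in> Hom C B' D'"
    then show "(f ;;\<^bsub>C\<^esub> g) \<boxtimes>\<^bsub>C\<^esub> (f' ;;\<^bsub>C\<^esub> g') = (f \<boxtimes>\<^bsub>C\<^esub> f') ;;\<^bsub>C\<^esub> (g \<boxtimes>\<^bsub>C\<^esub> g')"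
      using T.Fa_Comp[of "(f, f')" "(A, A')" "(B, B')" "(g, g')" "(D, D')"]
      by (simp add: Hom_prod_cat) (simp add: prod_cat_def)
  next
    fix f A B g A' B' h A'' B''
    assume f: "f \<in> Hom C A B" and g: "g \<in> Hom C A' B'" and h: "h \<in> Hom C A'' B''"
    note o = f[THEN Hom_Obj] g[THEN Hom_Obj] h[THEN Hom_Obj]
    show "(f \<boxtimes>\<^bsub>C\<^esub> g) \<boxtimes>\<^bsub>C\<^esub> h = f \<boxtimes>\<^bsub>C\<^esub> (g \<boxtimes>\<^bsub>C\<^esub> h)"
      using Assoc_natural[OF f g h] Ide_right[OF T[OF f T[OF g h]]] Ide_left[OF T[OF T[OF f g] h]] o
      by (simp add: SA)
  next
    fix f A B assume f: "f \<in> Hom C A B"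
    note o = f[THEN Hom_Obj]
    show "f \<boxtimes>\<^bsub>C\<^esub> Ide C (Unit C) = f" 
      using RUnit_natural[OF f] Ide_left[OF f] Ide_right[OF T[OF f Ide_Hom[OF Unit_closed]]] o
      by (simp add: SA)
    show "Ide C (Unit C) \<boxtimes>\<^bsub>C\<^esub> f = f" 
      using LUnit_natural[OF f] Ide_left[OF f] Ide_right[OF T[OF Ide_Hom[OF Unit_closed] f]] o
      by (simp add: SA)
  qed
qed

text \<open>The locale \<open>strict_monoidal\<close> does not constrain the fields
  \<open>Assoc\<close>, \<open>RUnit\<close> and \<open>LUnit\<close>; \<open>strict_tensor\<close>
  supplies their values.\<close>

lemma strict_monoidal_imp_monoidal_category:
  assumes "strict_monoidal C" "strict_tensor C"
  shows "monoidal_category C"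
proof -
  interpret strict_monoidal C by fact
  have S: "\<lbrakk>A \<in> Obj C; B \<in> Obj C; D \<in> Obj C\<rbrakk> \<Longrightarrow>
      Assoc C A B D = Ide C (A \<otimes>\<^bsub>C\<^esub> (B \<otimes>\<^bsub>C\<^esub> D))"
    "A \<in> Obj C \<Longrightarrow> RUnit C A = Ide C A" "A \<in> Obj C \<Longrightarrow> LUnit C A = Ide C A" for A B D
    using assms(2) unfolding strict_tensor_def by auto
  have tensor: "cat_functor (prod_cat C C) C (\<lambda>(A, B). A \<otimes>\<^bsub>C\<^esub> B) (\<lambda>(f, g). f \<boxtimes>\<^bsub>C\<^esub> g)"
  proof (rule cat_functorI)
    show "category (prod_cat C C)"
      by (intro category_prod_cat category_axioms)
  next
    fix f A B assume "f \<in> Hom (prod_cat C C) A B"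
    then show "(case f of (f, g) \<Rightarrow> f \<boxtimes>\<^bsub>C\<^esub> g) \<in>
        Hom C (case A of (A, B) \<Rightarrow> A \<otimes>\<^bsub>C\<^esub> B) (case B of (A, B) \<Rightarrow> A \<otimes>\<^bsub>C\<^esub> B)"
      by (auto simp: Hom_prod_cat TArr_Hom split: prod.splits)
  next
    fix f g A B E assume "f \<in> Hom (prod_cat C C) A B" "g \<in> Hom (prod_cat C C) B E"
    then show "(case f ;;\<^bsub>prod_cat C C\<^esub> g of (f, g) \<Rightarrow> f \<boxtimes>\<^bsub>C\<^esub> g) =
      (case f of (f, g) \<Rightarrow> f \<boxtimes>\<^bsub>C\<^esub> g) ;;\<^bsub>C\<^esub> (case g of (f, g) \<Rightarrow> f \<boxtimes>\<^bsub>C\<^esub> g)"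
      by (auto simp: Hom_prod_cat prod_cat_def Hom_iff Comp_TArr split: prod.splits)
  qed (auto simp: category_axioms TArr_Ide prod_cat_def split: prod.splits)
  have U: "Unit C \<in> Obj C" by simp
  show ?thesis
    by (intro monoidal_category.intro monoidal_category_axioms.intro category_axioms tensor)
      (auto simp: S Dom_closed Cod_closed Hom_iff TArr_Ide Ide_iso)
qed

lemma premonoidal_category_imp_strict_premonoidal:
  assumes "premonoidal_category C" "strict_tensor C"
  shows "strict_premonoidal C"
proof -
  interpret premonoidal_category C by fact
  note LW = cat_functor.Fo_closed[OF LWhisk_functor] cat_functor.Fa_Hom[OF LWhisk_functor]
    cat_functor.Fa_Ide[OF LWhisk_functor] cat_functor.Fa_Comp[OF LWhisk_functor]
  note RW = cat_functor.Fo_closed[OF RWhisk_functor] cat_functor.Fa_Hom[OF RWhisk_functor]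
    cat_functor.Fa_Ide[OF RWhisk_functor] cat_functor.Fa_Comp[OF RWhisk_functor]
  interpret strict_tensor_objects C
    by (rule strict_tensor_objectsI)
      (use assms category_axioms Unit_closed LW(1) Assoc_Hom RUnit_Hom LUnit_Hom in auto)
  have S: "\<lbrakk>A \<in> Obj C; B \<in> Obj C; D \<in> Obj C\<rbrakk> \<Longrightarrow>
      Assoc C A B D = Ide C (A \<otimes>\<^bsub>C\<^esub> (B \<otimes>\<^bsub>C\<^esub> D))"
    "A \<in> Obj C \<Longrightarrow> RUnit C A = Ide C A" "A \<in> Obj C \<Longrightarrow> LUnit C A = Ide C A" for A B D
    using assms(2) unfolding strict_tensor_def by auto
  show ?thesis
  proof
    fix A B f D D' assume A: "A \<in> Obj C" and B: "B \<in> Obj C" and f: "f \<in> Hom C D D'"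
    note o = f[THEN Hom_Obj] A B
    show "A \<ltimes>\<^bsub>C\<^esub> (B \<ltimes>\<^bsub>C\<^esub> f) = (A \<otimes>\<^bsub>C\<^esub> B) \<ltimes>\<^bsub>C\<^esub> f"
      using Assoc_natural_3[OF A B f] o Ide_right[OF LW(2)[OF A LW(2)[OF B f]]]
        Ide_left[OF LW(2)[OF TObj_closed[OF A B] f]] by (simp add: S)
    show "(f \<rtimes>\<^bsub>C\<^esub> A) \<rtimes>\<^bsub>C\<^esub> B = f \<rtimes>\<^bsub>C\<^esub> (A \<otimes>\<^bsub>C\<^esub> B)"
      using Assoc_natural_1[OF f A B] o Ide_left[OF RW(2)[OF B RW(2)[OF A f]]]
        Ide_right[OF RW(2)[OF TObj_closed[OF A B] f]] by (simp add: S)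
    show "(A \<ltimes>\<^bsub>C\<^esub> f) \<rtimes>\<^bsub>C\<^esub> B = A \<ltimes>\<^bsub>C\<^esub> (f \<rtimes>\<^bsub>C\<^esub> B)"
      using Assoc_natural_2[OF A f B] o Ide_left[OF RW(2)[OF B LW(2)[OF A f]]]
        Ide_right[OF LW(2)[OF A RW(2)[OF B f]]] by (simp add: S)
  next
    fix f A B assume f: "f \<in> Hom C A B"
    note o = f[THEN Hom_Obj]
    show "Unit C \<ltimes>\<^bsub>C\<^esub> f = f"
      using LUnit_natural[OF f] o Ide_right[OF LW(2)[OF Unit_closed f]] Ide_left[OF f]
      by (simp add: S)
    show "f \<rtimes>\<^bsub>C\<^esub> Unit C = f"
      using RUnit_natural[OF f] o Ide_right[OF RW(2)[OF Unit_closed f]] Ide_left[OF f]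
      by (simp add: S)
  qed (use LW RW in auto)
qed

lemma strict_premonoidal_imp_premonoidal_category:
  assumes "strict_premonoidal C" "strict_tensor C"
  shows "premonoidal_category C"
proof -
  interpret strict_premonoidal C by fact
  have S: "\<lbrakk>A \<in> Obj C; B \<in> Obj C; D \<in> Obj C\<rbrakk> \<Longrightarrow>
      Assoc C A B D = Ide C (A \<otimes>\<^bsub>C\<^esub> (B \<otimes>\<^bsub>C\<^esub> D))"
    "A \<in> Obj C \<Longrightarrow> RUnit C A = Ide C A" "A \<in> Obj C \<Longrightarrow> LUnit C A = Ide C A" for A B D
    using assms(2) unfolding strict_tensor_def by auto
  have "cat_functor C C (\<lambda>B. A \<otimes>\<^bsub>C\<^esub> B) (\<lambda>f. A \<ltimes>\<^bsub>C\<^esub> f)"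
    "cat_functor C C (\<lambda>B. B \<otimes>\<^bsub>C\<^esub> A) (\<lambda>f. f \<rtimes>\<^bsub>C\<^esub> A)" if "A \<in> Obj C" for A
    by (rule cat_functorI, (use that category_axioms in \<open>auto simp: Hom_iff\<close>))+
  then show ?thesis
    by unfold_locales
      (auto simp: S Dom_closed Cod_closed Hom_iff Ide_iso central_Ide)
qed

section \<open>Presented strict monoidal categories\<close>

lemma has_type_lists:
  "has_type P t A B \<Longrightarrow> A \<in> lists (OGens P) \<and> B \<in> lists (OGens P)"
  by (induction rule: has_type.induct) auto

lemma type_Id_boundary:
  "has_type P t A B \<Longrightarrow> has_type P (TId A) A A"
  "has_type P t A B \<Longrightarrow> has_type P (TId B) B B"
  by (simp_all add: has_type_lists type_Id)

text \<open>Boundaries are lists, and a tensor is often wanted at a boundary that only provably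
  equals the append; this form leaves that equation as a premise.\<close>

lemma type_Tens': "\<lbrakk>has_type P t A B; has_type P u A' B'; X = A @ A'; Y = B @ B'\<rbrakk> \<Longrightarrow>
    has_type P (TTens t u) X Y"
  by (simp add: type_Tens)

lemma mon_eq_type: "mon_eq P A B t u \<Longrightarrow> has_type P t A B \<and> has_type P u A B"
proof (induction rule: mon_eq.induct)
  case (eq_Tens_assoc t A B u A' B' w A'' B'')
  then show ?case by (auto intro: type_Tens' type_Tens)
next
  case (eq_Tens_Id A B)
  then show ?case by (simp add: type_Id type_Tens)
next
  case (eq_Tens_left t A B)
  then show ?case by (auto intro!: type_Tens'[where A = "[]" and B = "[]"] type_Id)
next
  case (eq_Tens_right t A B)
  then show ?case by (auto intro!: type_Tens'[where A' = "[]" and B' = "[]"] type_Id)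
qed (auto intro: has_type.intros type_Id_boundary)

text \<open>Reflexivity puts a typed term into its own class, so equality of classes gives back
  derivability.\<close>

lemma mclass_eq_iff:
  "has_type P t A B \<Longrightarrow> mclass P A B t = mclass P A' B' u \<longleftrightarrow> A = A' \<and> B = B' \<and> mon_eq P A B t u"
  unfolding mclass_def by (auto intro: eq_refl eq_sym eq_trans dest: mon_eq_type)

lemma mclass_eqI: "mon_eq P A B t u \<Longrightarrow> mclass P A B t = mclass P A B u"
  using mclass_eq_iff mon_eq_type by fastforce

lemma presented_simps [simp]:
  "Obj (presented_cat P) = lists (OGens P)"
  "Unit (presented_cat P) = []"
  "TObj (presented_cat P) = (@)"
  "Dom (presented_cat P) (mclass P A B t) = A"
  "Cod (presented_cat P) (mclass P A B t) = B"
  by (simp_all add: presented_cat_def mclass_def)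

lemma presented_Ide: "Ide (presented_cat P) A = mclass P A A (TId A)"
  by (simp add: presented_cat_def)

lemma Hom_presented:
  "f \<in> Hom (presented_cat P) A B \<longleftrightarrow> (\<exists>t. has_type P t A B \<and> f = mclass P A B t)"
  by (auto simp: Hom_iff presented_cat_def mclass_def)

lemma mclass_Hom: "has_type P t A B \<Longrightarrow> mclass P A B t \<in> Hom (presented_cat P) A B"
  using Hom_presented by blast

lemma Arr_presentedE:
  assumes "f \<in> Arr (presented_cat P)"
  obtains A B t where "has_type P t A B" "f = mclass P A B t"
  using assms by (auto simp: presented_cat_def)

text \<open>Composition of classes saturates over all representatives; by congruence a single pair
  of them already produces the whole class. The same argument serves
  \<open>TArr_mclass\<close>.\<close>

lemma Comp_mclass:
  assumes "has_type P t A B" "has_type P u B D"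
  shows "mclass P A B t ;;\<^bsub>presented_cat P\<^esub> mclass P B D u = mclass P A D (TComp t u)"
proof -
  have "mon_eq P A D (TComp t u) w \<longleftrightarrow>
      (\<exists>t'. mon_eq P A B t t' \<and> (\<exists>u'. mon_eq P B D u u' \<and> mon_eq P A D (TComp t' u') w))" for w
    using assms by (meson eq_Comp eq_refl eq_sym eq_trans)
  then show ?thesis by (auto simp: presented_cat_def mclass_def)
qed

lemma TArr_mclass:
  assumes "has_type P t A B" "has_type P u A' B'"
  shows "mclass P A B t \<boxtimes>\<^bsub>presented_cat P\<^esub> mclass P A' B' u = mclass P (A @ A') (B @ B') (TTens t u)"
proof -
  have "mon_eq P (A @ A') (B @ B') (TTens t u) w \<longleftrightarrow>
      (\<exists>t'. mon_eq P A B t t' \<and> (\<exists>u'. mon_eq P A' B' u u' \<and>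
        mon_eq P (A @ A') (B @ B') (TTens t' u') w))" for w
    using assms by (meson eq_Tens eq_refl eq_sym eq_trans)
  then show ?thesis by (auto simp: presented_cat_def mclass_def)
qed

lemma category_presented: "category (presented_cat P)"
proof
  fix f assume "f \<in> Arr (presented_cat P)"
  then show "Dom (presented_cat P) f \<in> Obj (presented_cat P)"
    "Cod (presented_cat P) f \<in> Obj (presented_cat P)"
    by (auto elim!: Arr_presentedE dest: has_type_lists)
next
  fix f A B assume "f \<in> Hom (presented_cat P) A B"
  then show "Ide (presented_cat P) A ;;\<^bsub>presented_cat P\<^esub> f = f"
    "f ;;\<^bsub>presented_cat P\<^esub> Ide (presented_cat P) B = f"
    by (auto simp: Hom_presented Comp_mclass type_Id_boundary presented_Ide
        intro!: mclass_eqI eq_Comp_left eq_Comp_right)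
next
  fix f A B g D h E
  assume "f \<in> Hom (presented_cat P) A B" "g \<in> Hom (presented_cat P) B D"
    "h \<in> Hom (presented_cat P) D E"
  then show "f ;;\<^bsub>presented_cat P\<^esub> g ;;\<^bsub>presented_cat P\<^esub> h =
      f ;;\<^bsub>presented_cat P\<^esub> (g ;;\<^bsub>presented_cat P\<^esub> h)"
    by (auto simp: Hom_presented Comp_mclass type_Comp intro!: mclass_eqI eq_Comp_assoc)
qed (auto simp: Hom_presented Comp_mclass presented_Ide intro: type_Id type_Comp)

lemma strict_monoidal_presented: "strict_monoidal (presented_cat P)"
proof -
  interpret category "presented_cat P" by (rule category_presented)
  show ?thesis
  proof
    fix f A B g A' B'
    assume "f \<in> Hom (presented_cat P) A B" "g \<in> Hom (presented_cat P) A' B'"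
    then show "f \<boxtimes>\<^bsub>presented_cat P\<^esub> g \<in> Hom (presented_cat P) (A \<otimes>\<^bsub>presented_cat P\<^esub> A')
        (B \<otimes>\<^bsub>presented_cat P\<^esub> B')"
      by (auto simp: Hom_presented TArr_mclass intro: type_Tens)
  next
    fix A B assume "A \<in> Obj (presented_cat P)" "B \<in> Obj (presented_cat P)"
    then show "Ide (presented_cat P) A \<boxtimes>\<^bsub>presented_cat P\<^esub> Ide (presented_cat P) B =
        Ide (presented_cat P) (A \<otimes>\<^bsub>presented_cat P\<^esub> B)"
      by (simp add: TArr_mclass type_Id mclass_eqI eq_Tens_Id presented_Ide)
  next
    fix f A B g D f' A' B' g' D'
    assume "f \<in> Hom (presented_cat P) A B" "g \<in> Hom (presented_cat P) B D"
      "f' \<in> Hom (presented_cat P) A' B'" "g' \<in> Hom (presented_cat P) B' D'"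
    then show "(f ;;\<^bsub>presented_cat P\<^esub> g) \<boxtimes>\<^bsub>presented_cat P\<^esub> (f' ;;\<^bsub>presented_cat P\<^esub> g') =
        (f \<boxtimes>\<^bsub>presented_cat P\<^esub> f') ;;\<^bsub>presented_cat P\<^esub> (g \<boxtimes>\<^bsub>presented_cat P\<^esub> g')"
      by (auto simp: Hom_presented Comp_mclass TArr_mclass type_Comp type_Tens
          intro!: mclass_eqI eq_interchange)
  next
    fix f A B g A' B' h A'' B''
    assume "f \<in> Hom (presented_cat P) A B" "g \<in> Hom (presented_cat P) A' B'"
      "h \<in> Hom (presented_cat P) A'' B''"
    then obtain t u w where
      *: "has_type P t A B" "has_type P u A' B'" "has_type P w A'' B''" and
      "f = mclass P A B t" "g = mclass P A' B' u" "h = mclass P A'' B'' w"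
      by (auto simp: Hom_presented)
    then show "f \<boxtimes>\<^bsub>presented_cat P\<^esub> g \<boxtimes>\<^bsub>presented_cat P\<^esub> h =
        f \<boxtimes>\<^bsub>presented_cat P\<^esub> (g \<boxtimes>\<^bsub>presented_cat P\<^esub> h)"
      using mclass_eqI[OF eq_Tens_assoc[OF *]]
      by (simp add: TArr_mclass type_Tens)
  next
    fix f A B assume "f \<in> Hom (presented_cat P) A B"
    then obtain t where *: "has_type P t A B" "f = mclass P A B t"
      by (auto simp: Hom_presented)
    have "has_type P (TId []) [] []" by (simp add: type_Id)
    with TArr_mclass[OF this *(1)] TArr_mclass[OF *(1) this]
    show "Ide (presented_cat P) (Unit (presented_cat P)) \<boxtimes>\<^bsub>presented_cat P\<^esub> f = f"
      "f \<boxtimes>\<^bsub>presented_cat P\<^esub> Ide (presented_cat P) (Unit (presented_cat P)) = f"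
      using mclass_eqI[OF eq_Tens_left[OF *(1)]] mclass_eqI[OF eq_Tens_right[OF *(1)]]
      by (simp_all add: * presented_Ide)
  qed simp_all
qed

lemma strict_tensor_presented: "strict_tensor (presented_cat P)"
  by (simp add: strict_tensor_def) (simp add: presented_cat_def)

section \<open>Interpreting terms in a strict monoidal category\<close>

fun term_fold :: "('p, 'n, 'z) mon_cat_scheme \<Rightarrow> ('x \<Rightarrow> 'p) \<Rightarrow> ('g \<Rightarrow> 'n) \<Rightarrow> ('x, 'g) mterm \<Rightarrow> 'n" where
  "term_fold K ob ar (TId A) = Ide K (tensor_list K (map ob A))"
| "term_fold K ob ar (TGen g) = ar g"
| "term_fold K ob ar (TComp t u) = term_fold K ob ar t ;;\<^bsub>K\<^esub> term_fold K ob ar u"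
| "term_fold K ob ar (TTens t u) = term_fold K ob ar t \<boxtimes>\<^bsub>K\<^esub> term_fold K ob ar u"

text \<open>The representative is picked by \<open>SOME\<close>; \<open>term_fold_sound\<close>
  makes the value independent of the choice.\<close>

definition arrow_fold :: "('p, 'n, 'z) mon_cat_scheme \<Rightarrow> ('x \<Rightarrow> 'p) \<Rightarrow> ('g \<Rightarrow> 'n) \<Rightarrow> ('x, 'g) marrow \<Rightarrow> 'n"
  where "arrow_fold K ob ar f = term_fold K ob ar (SOME t. t \<in> snd (snd f))"

text \<open>The existence half of the universal property of a presented category. It is used for
  three functors: \<open>Mon V\<close> into the runtime category, the runtime category into
  \<open>level_cat\<close>, and \<open>Mon V\<close> into the pure part of the target.\<close>

locale presentation_model = strict_monoidal K
  for K :: "('p, 'n, 'z) mon_cat_scheme" +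
  fixes P :: "('x, 'g) presentation" and ob :: "'x \<Rightarrow> 'p" and ar :: "'g \<Rightarrow> 'n"
  assumes ob_closed: "x \<in> OGens P \<Longrightarrow> ob x \<in> Obj K"
    and ar_Hom: "\<lbrakk>g \<in> MGens P; GDom P g \<in> lists (OGens P); GCod P g \<in> lists (OGens P)\<rbrakk> \<Longrightarrow>
      ar g \<in> Hom K (tensor_list K (map ob (GDom P g))) (tensor_list K (map ob (GCod P g)))"
    and rel_sound: "\<lbrakk>(t, u) \<in> Rels P; has_type P t A B; has_type P u A B\<rbrakk> \<Longrightarrow>
      term_fold K ob ar t = term_fold K ob ar u"
begin

abbreviation ob_list :: "'x list \<Rightarrow> 'p" where
  "ob_list A \<equiv> tensor_list K (map ob A)"

lemma map_ob_lists: "A \<in> lists (OGens P) \<Longrightarrow> map ob A \<in> lists (Obj K)"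
  using ob_closed by auto

lemma ob_list_closed: "A \<in> lists (OGens P) \<Longrightarrow> ob_list A \<in> Obj K"
  using map_ob_lists tensor_list_closed by blast

lemma ob_list_append:
  "\<lbrakk>A \<in> lists (OGens P); B \<in> lists (OGens P)\<rbrakk> \<Longrightarrow> ob_list (A @ B) = ob_list A \<otimes>\<^bsub>K\<^esub> ob_list B"
  using map_ob_lists by (simp add: tensor_list_append)

lemma term_fold_Hom: "has_type P t A B \<Longrightarrow> term_fold K ob ar t \<in> Hom K (ob_list A) (ob_list B)"
proof (induction rule: has_type.induct)
  case (type_Id A)
  then show ?case using Ide_Hom ob_list_closed by simp
next
  case (type_Comp t A B u C)
  then show ?case using Comp_Hom by simp
next
  case (type_Tens t A B u A' B')
  then show ?case using TArr_Hom
    by (metis has_type_lists ob_list_append term_fold.simps(4))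
qed (simp add: ar_Hom)

lemma term_fold_sound: "mon_eq P A B t u \<Longrightarrow> term_fold K ob ar t = term_fold K ob ar u"
proof (induction rule: mon_eq.induct)
  case (eq_Comp_left t A B)
  then show ?case using Ide_left[OF term_fold_Hom] by simp
next
  case (eq_Comp_right t A B)
  then show ?case using Ide_right[OF term_fold_Hom] by simp
next
  case (eq_Comp_assoc t A B u C w D)
  then show ?case using Comp_assoc[OF term_fold_Hom term_fold_Hom term_fold_Hom] by simp
next
  case (eq_Tens_assoc t A B u A' B' w A'' B'')
  then show ?case using TArr_assoc[OF term_fold_Hom term_fold_Hom term_fold_Hom] by simp
next
  case (eq_Tens_left t A B)
  then show ?case using TArr_unit_left[OF term_fold_Hom] by simp
next
  case (eq_Tens_right t A B)
  then show ?case using TArr_unit_right[OF term_fold_Hom] by simp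
next
  case (eq_Tens_Id A B)
  then show ?case by (simp add: TArr_Ide ob_list_closed ob_list_append[simplified])
next
  case (eq_interchange t A B u C t' A' B' u' C')
  then show ?case
    using interchange[OF term_fold_Hom term_fold_Hom term_fold_Hom term_fold_Hom] by simp
next
  case (eq_rel t u A B)
  then show ?case by (rule rel_sound)
qed auto

lemma arrow_fold_mclass:
  assumes "has_type P t A B"
  shows "arrow_fold K ob ar (mclass P A B t) = term_fold K ob ar t"
proof -
  have "t \<in> snd (snd (mclass P A B t))"
    using assms by (simp add: mclass_def eq_refl)
  then have "(SOME u. u \<in> snd (snd (mclass P A B t))) \<in> snd (snd (mclass P A B t))"
    by (rule someI)
  then show ?thesis
    unfolding arrow_fold_def by (simp add: mclass_def term_fold_sound[symmetric])
qed

lemma arrow_fold_Hom: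
  "f \<in> Hom (presented_cat P) A B \<Longrightarrow> arrow_fold K ob ar f \<in> Hom K (ob_list A) (ob_list B)"
  by (auto simp: Hom_presented arrow_fold_mclass term_fold_Hom)

lemma arrow_fold_Ide:
  "A \<in> lists (OGens P) \<Longrightarrow> arrow_fold K ob ar (Ide (presented_cat P) A) = Ide K (ob_list A)"
  by (simp add: presented_Ide arrow_fold_mclass type_Id)

lemma arrow_fold_Comp:
  "\<lbrakk>f \<in> Hom (presented_cat P) A B; g \<in> Hom (presented_cat P) B D\<rbrakk> \<Longrightarrow>
    arrow_fold K ob ar (f ;;\<^bsub>presented_cat P\<^esub> g) = arrow_fold K ob ar f ;;\<^bsub>K\<^esub> arrow_fold K ob ar g"
  by (auto simp: Hom_presented Comp_mclass arrow_fold_mclass type_Comp)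

lemma arrow_fold_TArr:
  "\<lbrakk>f \<in> Hom (presented_cat P) A B; g \<in> Hom (presented_cat P) A' B'\<rbrakk> \<Longrightarrow>
    arrow_fold K ob ar (f \<boxtimes>\<^bsub>presented_cat P\<^esub> g) = arrow_fold K ob ar f \<boxtimes>\<^bsub>K\<^esub> arrow_fold K ob ar g"
  by (auto simp: Hom_presented TArr_mclass arrow_fold_mclass type_Tens)

end

section \<open>The runtime monoidal category\<close>

text \<open>Trades \<open>take\<close> and \<open>drop\<close> for a split into three blocks, so
  that moving the runtime from \<open>i\<close> to \<open>j\<close> is braiding past the middle
  block.\<close>

lemma length_split3:
  assumes "i \<le> j" "j \<le> length As"
  obtains A1 A2 A3 where "As = A1 @ A2 @ A3" "i = length A1" "j = length A1 + length A2"
proof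
  show "As = take i As @ take (j - i) (drop i As) @ drop (j - i) (drop i As)"
    by (simp only: append_take_drop_id)
  show "i = length (take i As)" "j = length (take i As) + length (take (j - i) (drop i As))"
    using assms by simp_all
qed

locale polygraph_couple =
  fixes V :: "('o, 'v) polygraph" and G :: "('o, 'g) polygraph"
  assumes couple: "is_poly_couple (V, G)"
begin

abbreviation P where "P \<equiv> runtime_presentation (V, G)"
abbreviation M where "M \<equiv> MonRun (V, G)"
abbreviation OL where "OL \<equiv> lists (PObj V)"
abbreviation I where "I As \<equiv> Ide M (plain As)"
abbreviation IR where "IR \<equiv> Ide M [Runtime]"
abbreviation br where "br \<equiv> braiding (V, G)"
abbreviation bri where "bri \<equiv> braiding_inv (V, G)"
abbreviation comp_M (infixl "\<cdot>" 55) where "f \<cdot> g \<equiv> f ;;\<^bsub>M\<^esub> g"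
abbreviation tens_M (infixr "\<bullet>" 70) where "f \<bullet> g \<equiv> f \<boxtimes>\<^bsub>M\<^esub> g"

sublocale strict_monoidal M
  unfolding MonRun_def by (rule strict_monoidal_presented)

lemma M_simps [simp]: "Unit M = []" "TObj M = (@)"
  by (simp_all add: MonRun_def)

lemma PObj_G: "PObj G = PObj V"
  using couple by (simp add: is_poly_couple_def)

lemma OGens_P: "OGens P = insert Runtime (Plain ` PObj V)"
  by (simp add: runtime_presentation_def)

lemma Obj_M: "Obj M = lists (OGens P)"
  by (simp add: MonRun_def)

lemma Obj_M_simps [simp]:
  "[] \<in> Obj M"
  "A @ B \<in> Obj M \<longleftrightarrow> A \<in> Obj M \<and> B \<in> Obj M"
  "Runtime # A \<in> Obj M \<longleftrightarrow> A \<in> Obj M"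
  "Plain x # A \<in> Obj M \<longleftrightarrow> x \<in> PObj V \<and> A \<in> Obj M"
  "plain As \<in> Obj M \<longleftrightarrow> As \<in> OL"
  by (auto simp: Obj_M OGens_P)

lemma PArr_V_O: "v \<in> PArr V As Bs \<Longrightarrow> As \<in> OL \<and> Bs \<in> OL"
  using couple unfolding is_poly_couple_def is_polygraph_def split by (metis empty_iff)

lemma PArr_G_O: "g \<in> PArr G As Bs \<Longrightarrow> As \<in> OL \<and> Bs \<in> OL"
  using couple unfolding is_poly_couple_def is_polygraph_def split by (metis empty_iff)

definition gen :: "('o, 'v, 'g) rgen \<Rightarrow> ('o, 'v, 'g) rarrow" where
  "gen g = mclass P (rgen_dom g) (rgen_cod g) (TGen g)"

lemma type_rgen:
  assumes "g \<in> MGens P"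
  shows "has_type P (TGen g) (rgen_dom g) (rgen_cod g)"
proof -
  have "rgen_dom g \<in> Obj M \<and> rgen_cod g \<in> Obj M"
    using assms by (auto simp: runtime_presentation_def dest: PArr_V_O PArr_G_O)
  then have "has_type P (TGen g) (GDom P g) (GCod P g)"
    using assms by (intro type_Gen) (auto simp: Obj_M runtime_presentation_def)
  then show ?thesis by (simp add: runtime_presentation_def)
qed

lemma MGens_simps [simp]:
  "PureGen As Bs v \<in> MGens P \<longleftrightarrow> v \<in> PArr V As Bs"
  "EffGen As Bs g \<in> MGens P \<longleftrightarrow> g \<in> PArr G As Bs"
  "BraidR x \<in> MGens P \<longleftrightarrow> x \<in> PObj V"
  "BraidL x \<in> MGens P \<longleftrightarrow> x \<in> PObj V"
  by (auto simp: runtime_presentation_def)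

lemma type_gens:
  "v \<in> PArr V As Bs \<Longrightarrow> has_type P (TGen (PureGen As Bs v)) (plain As) (plain Bs)"
  "g \<in> PArr G As Bs \<Longrightarrow> has_type P (TGen (EffGen As Bs g)) (Runtime # plain As) (Runtime # plain Bs)"
  "x \<in> PObj V \<Longrightarrow> has_type P (TGen (BraidR x)) [Runtime, Plain x] [Plain x, Runtime]"
  "x \<in> PObj V \<Longrightarrow> has_type P (TGen (BraidL x)) [Plain x, Runtime] [Runtime, Plain x]"
  using type_rgen[of "PureGen As Bs v"] type_rgen[of "EffGen As Bs g"]
    type_rgen[of "BraidR x"] type_rgen[of "BraidL x"] by simp_all

lemma Rels_P:
  "x \<in> PObj V \<Longrightarrow> (TComp (TGen (BraidR x)) (TGen (BraidL x)), TId [Runtime, Plain x]) \<in> Rels P"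
  "x \<in> PObj V \<Longrightarrow> (TComp (TGen (BraidL x)) (TGen (BraidR x)), TId [Plain x, Runtime]) \<in> Rels P"
  "v \<in> PArr V As Bs \<Longrightarrow> (TComp (TTens (TId [Runtime]) (TGen (PureGen As Bs v))) (sigma Bs),
    TComp (sigma As) (TTens (TGen (PureGen As Bs v)) (TId [Runtime]))) \<in> Rels P"
  by (auto simp: runtime_presentation_def)

lemma type_Id_M: "A \<in> Obj M \<Longrightarrow> has_type P (TId A) A A"
  by (simp add: Obj_M type_Id)

lemma Ide_M: "Ide M A = mclass P A A (TId A)"
  by (simp add: MonRun_def presented_Ide)

lemma Hom_M: "f \<in> Hom M A B \<longleftrightarrow> (\<exists>t. has_type P t A B \<and> f = mclass P A B t)"
  by (simp add: MonRun_def Hom_presented)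

lemma mclass_M:
  assumes "has_type P t A B"
  shows "mclass P A B t \<in> Arr M" "Dom M (mclass P A B t) = A" "Cod M (mclass P A B t) = B"
  using assms Hom_M[of "mclass P A B t" A B] by (auto simp: Hom_iff)

lemma Comp_M: "\<lbrakk>has_type P t A B; has_type P u B D\<rbrakk> \<Longrightarrow>
    mclass P A B t \<cdot> mclass P B D u = mclass P A D (TComp t u)"
  by (simp add: MonRun_def Comp_mclass)

lemma TArr_M: "\<lbrakk>has_type P t A B; has_type P u A' B'\<rbrakk> \<Longrightarrow>
    mclass P A B t \<bullet> mclass P A' B' u = mclass P (A @ A') (B @ B') (TTens t u)"
  by (simp add: MonRun_def TArr_mclass)

lemma TArr_Ide_Nil [simp]:
  assumes "f \<in> Arr M"
  shows "Ide M [] \<bullet> f = f" "f \<bullet> Ide M [] = f"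
  using TArr_unit_Arr[OF assms] by simp_all

lemma Ide_append: "\<lbrakk>A \<in> Obj M; B \<in> Obj M\<rbrakk> \<Longrightarrow> Ide M (A @ B) = Ide M A \<bullet> Ide M B"
  using TArr_Ide[of A B] by simp

lemma Ide_Cons: "\<lbrakk>A \<in> Obj M; [x] \<in> Obj M\<rbrakk> \<Longrightarrow> Ide M (x # A) = Ide M [x] \<bullet> Ide M A"
  using TArr_Ide[of "[x]" A] by simp

lemma TArr_Comp_Ide:
  assumes "f \<in> Arr M" "g \<in> Arr M" "Cod M f = Dom M g" "A \<in> Obj M"
  shows "Ide M A \<bullet> (f \<cdot> g) = Ide M A \<bullet> f \<cdot> Ide M A \<bullet> g"
    "(f \<cdot> g) \<bullet> Ide M A = f \<bullet> Ide M A \<cdot> g \<bullet> Ide M A"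
  using assms by (simp_all add: Comp_TArr)

lemma type_sigma: "As \<in> OL \<Longrightarrow> has_type P (sigma As) (Runtime # plain As) (plain As @ [Runtime])"
proof (induction As)
  case (Cons x As)
  have "has_type P (TTens (TGen (BraidR x)) (TId (plain As)))
      (Runtime # plain (x # As)) ([Plain x] @ Runtime # plain As)"
    by (rule type_Tens') (use Cons in \<open>auto intro: type_gens type_Id_M\<close>)
  moreover have "has_type P (TTens (TId [Plain x]) (sigma As))
      ([Plain x] @ Runtime # plain As) (plain (x # As) @ [Runtime])"
    by (rule type_Tens') (use Cons in \<open>auto intro: type_gens type_Id_M\<close>)
  ultimately show ?case by (auto intro: type_Comp)
qed (simp add: type_Id_M)

lemma type_sigma_inv:
  "As \<in> OL \<Longrightarrow> has_type P (sigma_inv As) (plain As @ [Runtime]) (Runtime # plain As)"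
proof (induction As)
  case (Cons x As)
  have "has_type P (TTens (TGen (BraidL x)) (TId (plain As)))
      ([Plain x] @ Runtime # plain As) (Runtime # plain (x # As))"
    by (rule type_Tens') (use Cons in \<open>auto intro: type_gens type_Id_M\<close>)
  moreover have "has_type P (TTens (TId [Plain x]) (sigma_inv As))
      (plain (x # As) @ [Runtime]) ([Plain x] @ Runtime # plain As)"
    by (rule type_Tens') (use Cons in \<open>auto intro: type_gens type_Id_M\<close>)
  ultimately show ?case by (auto intro: type_Comp)
qed (simp add: type_Id_M)

lemma br_simps [simp]:
  assumes "As \<in> OL"
  shows "br As \<in> Arr M" "Dom M (br As) = Runtime # plain As" "Cod M (br As) = plain As @ [Runtime]"
    "bri As \<in> Arr M" "Dom M (bri As) = plain As @ [Runtime]" "Cod M (bri As) = Runtime # plain As"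
  unfolding braiding_def braiding_inv_def
  using type_sigma[OF assms] type_sigma_inv[OF assms] by (simp_all add: mclass_M)

lemma gen_simps [simp]:
  assumes "x \<in> PObj V"
  shows "gen (BraidR x) \<in> Arr M" "gen (BraidL x) \<in> Arr M"
    "Dom M (gen (BraidR x)) = [Runtime, Plain x]" "Cod M (gen (BraidR x)) = [Plain x, Runtime]"
    "Dom M (gen (BraidL x)) = [Plain x, Runtime]" "Cod M (gen (BraidL x)) = [Runtime, Plain x]"
  using type_gens(3,4)[OF assms] by (simp_all add: gen_def mclass_M)

lemma br_Nil [simp]: "br [] = IR" "bri [] = IR"
  by (simp_all add: braiding_def braiding_inv_def Ide_M)

lemma br_Cons:
  assumes "x \<in> PObj V" "As \<in> OL"
  shows "br (x # As) = gen (BraidR x) \<bullet> I As \<cdot> Ide M [Plain x] \<bullet> br As"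
    and "bri (x # As) = Ide M [Plain x] \<bullet> bri As \<cdot> gen (BraidL x) \<bullet> I As"
proof -
  note ty = type_gens(3,4)[OF assms(1)] type_Id_M[of "plain As"] type_Id_M[of "[Plain x]"]
    type_sigma[OF assms(2)] type_sigma_inv[OF assms(2)]
  show "br (x # As) = gen (BraidR x) \<bullet> I As \<cdot> Ide M [Plain x] \<bullet> br As"
    using assms TArr_M[OF ty(1,3)] TArr_M[OF ty(4,5)]
      Comp_M[OF type_Tens[OF ty(1,3)] type_Tens'[OF ty(4,5)]]
    by (simp add: braiding_def Ide_M gen_def)
  show "bri (x # As) = Ide M [Plain x] \<bullet> bri As \<cdot> gen (BraidL x) \<bullet> I As"
    using assms TArr_M[OF ty(2,3)] TArr_M[OF ty(4,6)]
      Comp_M[OF type_Tens[OF ty(4,6)] type_Tens'[OF ty(2,3)]]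
    by (simp add: braiding_inv_def Ide_M gen_def)
qed

lemma gen_inverse:
  assumes "x \<in> PObj V"
  shows "gen (BraidR x) \<cdot> gen (BraidL x) = Ide M [Runtime, Plain x]"
    "gen (BraidL x) \<cdot> gen (BraidR x) = Ide M [Plain x, Runtime]"
proof -
  note ty = type_gens(3,4)[OF assms]
  have "mon_eq P [Runtime, Plain x] [Runtime, Plain x]
      (TComp (TGen (BraidR x)) (TGen (BraidL x))) (TId [Runtime, Plain x])"
    by (rule eq_rel[OF Rels_P(1)[OF assms] type_Comp[OF ty(1,2)] type_Id_M]) (simp add: assms)
  then show "gen (BraidR x) \<cdot> gen (BraidL x) = Ide M [Runtime, Plain x]"
    using Comp_M[OF ty(1,2)] by (simp add: gen_def Ide_M mclass_eqI)
  have "mon_eq P [Plain x, Runtime] [Plain x, Runtime]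
      (TComp (TGen (BraidL x)) (TGen (BraidR x))) (TId [Plain x, Runtime])"
    by (rule eq_rel[OF Rels_P(2)[OF assms] type_Comp[OF ty(2,1)] type_Id_M]) (simp add: assms)
  then show "gen (BraidL x) \<cdot> gen (BraidR x) = Ide M [Plain x, Runtime]"
    using Comp_M[OF ty(2,1)] by (simp add: gen_def Ide_M mclass_eqI)
qed

lemma br_inverse:
  "As \<in> OL \<Longrightarrow> br As \<cdot> bri As = Ide M (Runtime # plain As)"
  "As \<in> OL \<Longrightarrow> bri As \<cdot> br As = Ide M (plain As @ [Runtime])"
proof (induction As)
  case (Cons x As)
  { case 1
    with Cons show ?case
      \<comment> \<open>In this order the braidings past the tail meet first and cancel by the
        induction hypothesis; in the other order the two generators meet first.\<close>
      by (simp add: br_Cons Comp_TArr Comp_TArr_reassoc gen_inverse TArr_Ide)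
  next
    case 2
    with Cons show ?case
      by (simp add: br_Cons Comp_TArr Comp_TArr_reassoc gen_inverse TArr_Ide) }
qed simp_all

text \<open>The hexagon law for the runtime: blocks are passed one after the other.\<close>

lemma br_append:
  "\<lbrakk>As \<in> OL; Bs \<in> OL\<rbrakk> \<Longrightarrow> br (As @ Bs) = br As \<bullet> I Bs \<cdot> I As \<bullet> br Bs"
proof (induction As)
  case (Cons x As)
  then show ?case
    by (simp add: br_Cons Ide_append Ide_Cons[of "map f xs" for f xs] TArr_Comp_Ide)
next
  case Nil
  have "IR \<bullet> I Bs = Ide M (Runtime # plain Bs)"
    using Nil by (simp add: Ide_Cons[of "map f xs" for f xs])
  then show ?case using Nil by simp
qed

subsection \<open>Pure morphisms\<close>

abbreviation PV where "PV \<equiv> polygraph_presentation V"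
abbreviation pure where "pure \<equiv> pure_to_run (V, G)"

lemma tensor_list_plain [simp]: "tensor_list M (map (\<lambda>x. [Plain x]) As) = plain As"
  by (induction As) auto

lemma PV_simps [simp]:
  "OGens PV = PObj V" "GDom PV (As, Bs, v) = As" "GCod PV (As, Bs, v) = Bs"
  "(As, Bs, v) \<in> MGens PV \<longleftrightarrow> v \<in> PArr V As Bs"
  "Rels PV = {}"
  by (simp_all add: polygraph_presentation_def)

text \<open>As \<open>PV\<close> has no relations, every well-typed assignment is a model. The fold
  it induces gives a second description of \<open>pure_to_run\<close>, from which functoriality is
  inherited.\<close>

sublocale pm: presentation_model M PV "\<lambda>x. [Plain x]" "\<lambda>g. gen (plain_gen g)"
proof
  fix g :: "'o list \<times> 'o list \<times> 'v"
  assume "g \<in> MGens PV"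
  moreover obtain As Bs v where "g = (As, Bs, v)" by (cases g)
  ultimately show "gen (plain_gen g) \<in> Hom M (tensor_list M (map (\<lambda>x. [Plain x]) (GDom PV g)))
      (tensor_list M (map (\<lambda>x. [Plain x]) (GCod PV g)))"
    using type_gens(1) by (auto simp: gen_def Hom_iff mclass_M)
qed simp_all

lemma pure_term:
  "has_type PV t A B \<Longrightarrow> has_type P (map_mterm Plain plain_gen t) (plain A) (plain B) \<and>
    term_fold M (\<lambda>x. [Plain x]) (\<lambda>g. gen (plain_gen g)) t =
      mclass P (plain A) (plain B) (map_mterm Plain plain_gen t)"
proof (induction rule: has_type.induct)
  case (type_Gen g)
  then show ?case by (cases g) (auto simp: gen_def intro: type_gens)
next
  case (type_Comp t A B u C)
  then show ?case by (auto simp: Comp_M intro: has_type.type_Comp)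
next
  case (type_Tens t A B u A' B')
  then show ?case by (auto simp: TArr_M intro: has_type.type_Tens)
qed (simp add: Ide_M type_Id_M)

text \<open>Equivalent terms have equal folds, and by \<open>pure_term\<close> a fold is the class
  of the renamed term; this replaces an induction over derivations.\<close>

lemma pure_mclass:
  assumes "has_type PV t A B"
  shows "pure (mclass PV A B t) = mclass P (plain A) (plain B) (map_mterm Plain plain_gen t)"
proof -
  have "mon_eq P (plain A) (plain B) (map_mterm Plain plain_gen t) (map_mterm Plain plain_gen u)"
    if "mon_eq PV A B t u" for u
    using pm.term_fold_sound[OF that] pure_term[of t A B] pure_term[of u A B] mon_eq_type[OF that]
    by (simp add: mclass_eq_iff)
  then show ?thesis
    using assms by (auto simp: pure_to_run_def mclass_def intro: eq_refl eq_trans)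
qed

lemma pure_arrow_fold:
  assumes "f \<in> Hom (Mon V) A B"
  shows "pure f = arrow_fold M (\<lambda>x. [Plain x]) (\<lambda>g. gen (plain_gen g)) f"
  using assms by (auto simp: Mon_def Hom_presented pure_mclass pm.arrow_fold_mclass pure_term)

lemma pure_Hom: "f \<in> Hom (Mon V) A B \<Longrightarrow> pure f \<in> Hom M (plain A) (plain B)"
  using pm.arrow_fold_Hom[of f A B] pure_arrow_fold[of f A B] by (simp add: Mon_def)

sublocale Mon: strict_monoidal "Mon V"
  unfolding Mon_def by (rule strict_monoidal_presented)

lemma Mon_simps [simp]: "Obj (Mon V) = OL" "Unit (Mon V) = []" "TObj (Mon V) = (@)"
  by (simp_all add: Mon_def)

lemma pure_Ide: "A \<in> OL \<Longrightarrow> pure (Ide (Mon V) A) = I A"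
  using pm.arrow_fold_Ide[of A] pure_arrow_fold[OF Mon.Ide_Hom, of A] by (simp add: Mon_def)

lemma pure_Comp:
  assumes "f \<in> Hom (Mon V) A B" "g \<in> Hom (Mon V) B D"
  shows "pure (f ;;\<^bsub>Mon V\<^esub> g) = pure f \<cdot> pure g"
  using pm.arrow_fold_Comp[OF assms[unfolded Mon_def]]
  by (simp add: pure_arrow_fold[OF assms(1)] pure_arrow_fold[OF assms(2)]
      pure_arrow_fold[OF Mon.Comp_Hom[OF assms]]) (simp add: Mon_def)

lemma pure_TArr:
  assumes "f \<in> Hom (Mon V) A B" "g \<in> Hom (Mon V) A' B'"
  shows "pure (f \<boxtimes>\<^bsub>Mon V\<^esub> g) = pure f \<bullet> pure g"
  using pm.arrow_fold_TArr[OF assms[unfolded Mon_def]]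
  by (simp add: pure_arrow_fold[OF assms(1)] pure_arrow_fold[OF assms(2)]
      pure_arrow_fold[OF Mon.TArr_Hom[OF assms]]) (simp add: Mon_def)

text \<open>The relations impose naturality on generators only. It passes to composites by pasting
  squares and to tensors by moving the runtime past the two factors in turn.\<close>

lemma br_natural_term:
  "has_type PV t A B \<Longrightarrow> IR \<bullet> pure (mclass PV A B t) \<cdot> br B = br A \<cdot> pure (mclass PV A B t) \<bullet> IR"
proof (induction rule: has_type.induct)
  case (type_Id A)
  then have "pure (mclass PV A A (TId A)) = I A"
    using pure_Ide by (simp add: Mon_def presented_Ide)
  then show ?case using type_Id by (simp add: TArr_Ide)
next
  case (type_Gen g)
  then obtain As Bs v where g: "g = (As, Bs, v)" "v \<in> PArr V As Bs" by (cases g) auto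
  note o = PArr_V_O[OF g(2)]
  note ty = type_gens(1)[OF g(2)] type_Id_M[of "[Runtime]"]
    type_sigma[OF conjunct1[OF o]] type_sigma[OF conjunct2[OF o]]
  have l: "has_type P (TTens (TId [Runtime]) (TGen (PureGen As Bs v)))
      (Runtime # plain As) (Runtime # plain Bs)"
    by (rule type_Tens'[OF ty(2,1)]) auto
  have r: "has_type P (TTens (TGen (PureGen As Bs v)) (TId [Runtime]))
      (plain As @ [Runtime]) (plain Bs @ [Runtime])"
    by (rule type_Tens'[OF ty(1,2)]) auto
  have "mon_eq P (Runtime # plain As) (plain Bs @ [Runtime])
    (TComp (TTens (TId [Runtime]) (TGen (PureGen As Bs v))) (sigma Bs))
    (TComp (sigma As) (TTens (TGen (PureGen As Bs v)) (TId [Runtime])))"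
    by (rule eq_rel[OF Rels_P(3)[OF g(2)] type_Comp[OF l ty(4)] type_Comp[OF ty(3) r]])
  from mclass_eqI[OF this] show ?case
    using g TArr_M[OF ty(2,1)] TArr_M[OF ty(1,2)] pure_mclass[OF has_type.type_Gen, OF type_Gen]
      Comp_M[OF l ty(4)] Comp_M[OF ty(3) r]
    by (simp add: braiding_def Ide_M)
next
  case (type_Comp t A B u D)
  let ?f = "mclass PV A B t" and ?g = "mclass PV B D u"
  have fg: "?f \<in> Hom (Mon V) A B" "?g \<in> Hom (Mon V) B D"
    using type_Comp mclass_Hom by (auto simp: Mon_def)
  have o: "A \<in> OL" "B \<in> OL" "D \<in> OL"
    using type_Comp.hyps[THEN has_type_lists] by auto
  have [simp]: "pure ?f \<in> Arr M" "Dom M (pure ?f) = plain A" "Cod M (pure ?f) = plain B"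
    "pure ?g \<in> Arr M" "Dom M (pure ?g) = plain B" "Cod M (pure ?g) = plain D"
    using pure_Hom[OF fg(1)] pure_Hom[OF fg(2)] by (auto simp: Hom_iff)
  have "pure (mclass PV A D (TComp t u)) = pure ?f \<cdot> pure ?g"
    using pure_Comp[OF fg] Comp_mclass[OF type_Comp.hyps] by (simp add: Mon_def)
  then show ?case
    using o type_Comp.IH Comp_reassoc[OF type_Comp.IH(1)] by (simp add: TArr_Comp_Ide)
next
  case (type_Tens t A B u A' B')
  let ?f = "mclass PV A B t" and ?g = "mclass PV A' B' u"
  have fg: "?f \<in> Hom (Mon V) A B" "?g \<in> Hom (Mon V) A' B'"
    using type_Tens mclass_Hom by (auto simp: Mon_def)
  have o: "A \<in> OL" "B \<in> OL" "A' \<in> OL" "B' \<in> OL"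
    using type_Tens.hyps[THEN has_type_lists] by auto
  have [simp]: "pure ?f \<in> Arr M" "Dom M (pure ?f) = plain A" "Cod M (pure ?f) = plain B"
    "pure ?g \<in> Arr M" "Dom M (pure ?g) = plain A'" "Cod M (pure ?g) = plain B'"
    using pure_Hom[OF fg(1)] pure_Hom[OF fg(2)] by (auto simp: Hom_iff)
  have pt: "pure (mclass PV (A @ A') (B @ B') (TTens t u)) = pure ?f \<bullet> pure ?g"
    using pure_TArr[OF fg] TArr_mclass[OF type_Tens.hyps] by (simp add: Mon_def)
  have "IR \<bullet> (pure ?f \<bullet> pure ?g) \<cdot> br (B @ B') = (IR \<bullet> pure ?f) \<bullet> pure ?g \<cdot> br B \<bullet> I B' \<cdot> I B \<bullet> br B'"
    using o by (simp add: br_append)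
  \<comment> \<open>Naturality for the left factor alone; the right one only shares the
    tensor.\<close>
  also have "\<dots> = (br A \<cdot> pure ?f \<bullet> IR) \<bullet> (I A' \<cdot> pure ?g) \<cdot> I B \<bullet> br B'"
    using o type_Tens.IH(1) by (simp add: Comp_TArr del: TArr_assoc_Arr)
  \<comment> \<open>Interchange delays the left factor, so that the runtime, now between the
    factors, meets the right one.\<close>
  also have "\<dots> = br A \<bullet> I A' \<cdot> pure ?f \<bullet> (IR \<bullet> pure ?g \<cdot> br B')"
    using o by (simp add: Comp_TArr[symmetric] del: Ide_left_Arr) (simp add: Comp_TArr)
  also have "\<dots> = br A \<bullet> I A' \<cdot> (I A \<cdot> pure ?f) \<bullet> (br A' \<cdot> pure ?g \<bullet> IR)"
    using o type_Tens.IH(2) by simp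
  also have "\<dots> = br (A @ A') \<cdot> (pure ?f \<bullet> pure ?g) \<bullet> IR"
    using o by (simp add: br_append Comp_TArr[symmetric] del: Ide_left_Arr)
  finally show ?case by (simp add: pt)
qed

lemma br_natural: "f \<in> Hom (Mon V) A B \<Longrightarrow> IR \<bullet> pure f \<cdot> br B = br A \<cdot> pure f \<bullet> IR"
  using br_natural_term by (auto simp: Mon_def Hom_presented)

section \<open>Braid cliques\<close>

abbreviation ci where "ci \<equiv> clique_iso (V, G)"

lemma clique_iso_right:
  assumes "A1 \<in> OL" "A2 \<in> OL" "A3 \<in> OL"
  shows "ci (A1 @ A2 @ A3) (length A1) (length A1 + length A2) = I A1 \<bullet> br A2 \<bullet> I A3"
proof -
  note ty = type_Id_M[of "plain A1"] type_sigma[OF assms(2)] type_Id_M[of "plain A3"]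
  show ?thesis
    using assms TArr_M[OF ty(2,3)] TArr_M[OF ty(1) type_Tens[OF ty(2,3)]]
    by (simp add: clique_iso_def clique_iso_term_def braid_clique_def braiding_def Ide_M)
qed

lemma clique_iso_left:
  assumes "A1 \<in> OL" "A2 \<in> OL" "A3 \<in> OL"
  shows "ci (A1 @ A2 @ A3) (length A1 + length A2) (length A1) = I A1 \<bullet> bri A2 \<bullet> I A3"
\<comment> \<open>With an empty middle block both positions coincide, and
  \<open>clique_iso_term\<close> takes its \<open>i \<le> j\<close> branch, which uses
  \<open>sigma\<close> and not \<open>sigma_inv\<close>.\<close>
proof (cases "A2 = []")
  case True
  then show ?thesis using clique_iso_right[OF assms] by simp
next
  case False
  note ty = type_Id_M[of "plain A1"] type_sigma_inv[OF assms(2)] type_Id_M[of "plain A3"]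
  show ?thesis
    using False assms TArr_M[OF ty(2,3)] TArr_M[OF ty(1) type_Tens[OF ty(2,3)]]
    by (simp add: clique_iso_def clique_iso_term_def braid_clique_def braiding_inv_def Ide_M)
qed

text \<open>One split into three blocks yields all five facts for an ordered pair of positions. The
  last composite starts at position 0 because, together with inverses, that case generates all
  others.\<close>

lemma clique_iso_inverse_aux:
  assumes "As \<in> OL" "i \<le> j" "j \<le> length As"
  shows "ci As i j \<in> Hom M (braid_clique As i) (braid_clique As j)"
    "ci As j i \<in> Hom M (braid_clique As j) (braid_clique As i)"
    "ci As i j \<cdot> ci As j i = Ide M (braid_clique As i)"
    "ci As j i \<cdot> ci As i j = Ide M (braid_clique As j)"
    "ci As 0 i \<cdot> ci As i j = ci As 0 j"
proof -
  obtain A1 A2 A3 where s: "As = A1 @ A2 @ A3" "i = length A1" "j = length A1 + length A2"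
    using assms length_split3 by blast
  have o: "A1 \<in> OL" "A2 \<in> OL" "A3 \<in> OL" using assms(1) s(1) by auto
  have c: "ci As i j = I A1 \<bullet> br A2 \<bullet> I A3" "ci As j i = I A1 \<bullet> bri A2 \<bullet> I A3"
    "ci As 0 i = br A1 \<bullet> I (A2 @ A3)" "ci As 0 j = br (A1 @ A2) \<bullet> I A3"
    using o clique_iso_right[of A1 A2 A3] clique_iso_left[of A1 A2 A3] 
      clique_iso_right[of "[]" A1 "A2 @ A3"] clique_iso_right[of "[]" "A1 @ A2" A3] by (simp_all add: s)
  have b: "braid_clique As i = plain A1 @ Runtime # plain A2 @ plain A3"
    "braid_clique As j = plain A1 @ plain A2 @ Runtime # plain A3"
    by (simp_all add: braid_clique_def s)
  show "ci As i j \<in> Hom M (braid_clique As i) (braid_clique As j)"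
    "ci As j i \<in> Hom M (braid_clique As j) (braid_clique As i)"
    unfolding c b using o by (simp_all add: Hom_iff)
  show "ci As i j \<cdot> ci As j i = Ide M (braid_clique As i)"
    "ci As j i \<cdot> ci As i j = Ide M (braid_clique As j)"
    unfolding c b using o by (simp_all add: Comp_TArr br_inverse TArr_Ide)
  show "ci As 0 i \<cdot> ci As i j = ci As 0 j"
    unfolding c b using o by (simp add: br_append Ide_append TArr_Comp_Ide)
qed

lemma clique_iso_Hom:
  "\<lbrakk>As \<in> OL; i \<le> length As; j \<le> length As\<rbrakk> \<Longrightarrow>
    ci As i j \<in> Hom M (braid_clique As i) (braid_clique As j)"
  using clique_iso_inverse_aux(1)[of As i j] clique_iso_inverse_aux(2)[of As j i]
  by (cases "i \<le> j") auto

lemma clique_iso_Arr [simp]: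
  "\<lbrakk>As \<in> OL; i \<le> length As; j \<le> length As\<rbrakk> \<Longrightarrow> ci As i j \<in> Arr M"
  "\<lbrakk>As \<in> OL; i \<le> length As; j \<le> length As\<rbrakk> \<Longrightarrow> Dom M (ci As i j) = braid_clique As i"
  "\<lbrakk>As \<in> OL; i \<le> length As; j \<le> length As\<rbrakk> \<Longrightarrow> Cod M (ci As i j) = braid_clique As j"
  using clique_iso_Hom by (auto simp: Hom_iff)

lemma clique_iso_inverse:
  "\<lbrakk>As \<in> OL; i \<le> length As; j \<le> length As\<rbrakk> \<Longrightarrow> ci As i j \<cdot> ci As j i = Ide M (braid_clique As i)"
  using clique_iso_inverse_aux(3)[of As i j] clique_iso_inverse_aux(4)[of As j i]
  by (cases "i \<le> j") auto

lemma clique_iso_from_0: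
  assumes "As \<in> OL" "i \<le> length As" "j \<le> length As"
  shows "ci As 0 i \<cdot> ci As i j = ci As 0 j"
proof (cases "i \<le> j")
  case True
  then show ?thesis using assms clique_iso_inverse_aux(5)[of As i j] by simp
next
  case False
  \<comment> \<open>For \<open>j < i\<close> the way from 0 to \<open>i\<close> passes through
    \<open>j\<close>, and its second leg cancels.\<close>
  then have "ci As 0 i \<cdot> ci As i j = (ci As 0 j \<cdot> ci As j i) \<cdot> ci As i j"
    using assms clique_iso_inverse_aux(5)[of As j i] by simp
  also have "\<dots> = ci As 0 j"
    using assms by (simp add: clique_iso_inverse)
  finally show ?thesis .
qed

text \<open>Each clique isomorphism factors through position 0, so that
  \<open>clique_iso_from_0\<close> collapses the composite.\<close>

lemma clique_iso_Comp:
  assumes "As \<in> OL" "i \<le> length As" "j \<le> length As" "k \<le> length As"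
  shows "ci As i j \<cdot> ci As j k = ci As i k"
proof -
  have *: "ci As i k = ci As i 0 \<cdot> ci As 0 k" if "k \<le> length As" for k
  proof -
    have "ci As i k = ci As i 0 \<cdot> (ci As 0 i \<cdot> ci As i k)"
      using assms that Comp_reassoc[OF clique_iso_inverse, of As i 0 "ci As i k"] by simp
    then show ?thesis using assms that clique_iso_from_0[of As i k] by simp
  qed
  show ?thesis
    using assms *[of j] *[of k] clique_iso_from_0[of As j k] by simp
qed

lemma clique_iso_same:
  assumes "As \<in> OL" "i \<le> length As"
  shows "ci As i i = Ide M (braid_clique As i)"
  using assms clique_iso_Comp[of As i i i] clique_iso_inverse[of As i i] by simp

lemma clique_iso_0_0:
  assumes "As \<in> OL"
  shows "ci As 0 0 = Ide M (Runtime # plain As)"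
  using clique_iso_right[of "[]" "[]" As] assms by (simp add: TArr_Ide)

lemma braid_clique_0 [simp]: "braid_clique As 0 = Runtime # plain As"
  by (simp add: braid_clique_def)

section \<open>Clique morphisms and their leftmost components\<close>

abbreviation cm where "cm \<equiv> clique_mor_of (V, G)"
abbreviation rlist :: "'o list \<Rightarrow> 'o robj list" where "rlist As \<equiv> Runtime # plain As"

text \<open>By coherence of the clique isomorphisms, both sides of the compatibility condition
  collapse to the path through the leftmost objects and \<open>m\<close>.\<close>

lemma is_clique_mor_of:
  assumes "As \<in> OL" "Bs \<in> OL" "m \<in> Hom M (rlist As) (rlist Bs)"
  shows "is_clique_mor (V, G) (cm As Bs m)"
proof -
  have [simp]: "m \<in> Arr M" "Dom M m = rlist As" "Cod M m = rlist Bs"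
    using assms(3) by (auto simp: Hom_iff)
  have "ci As i 0 \<cdot> m \<cdot> ci Bs 0 j \<cdot> ci Bs j k = ci As i l \<cdot> (ci As l 0 \<cdot> m \<cdot> ci Bs 0 k)"
    if "i \<le> length As" "l \<le> length As" "j \<le> length Bs" "k \<le> length Bs" for i j k l
    using that assms(1,2) Comp_reassoc[OF clique_iso_Comp, of As i l 0 "m \<cdot> ci Bs 0 k"]
    by (simp add: clique_iso_Comp)
  then show ?thesis
    using assms(1,2) by (auto simp: is_clique_mor_def clique_mor_of_def Hom_iff)
qed

lemma leftmost_clique_mor_of [simp]:
  assumes "As \<in> OL" "Bs \<in> OL" "m \<in> Hom M (rlist As) (rlist Bs)"
  shows "leftmost (cm As Bs m) = m"
proof -
  have [simp]: "m \<in> Arr M" "Dom M m = rlist As" "Cod M m = rlist Bs"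
    using assms(3) by (auto simp: Hom_iff)
  show ?thesis
    using assms by (simp add: leftmost_def clique_mor_of_def clique_iso_0_0)
qed

lemma clique_mor_of_leftmost:
  assumes f: "is_clique_mor (V, G) (As, Bs, f)"
  shows "As \<in> OL" "Bs \<in> OL" "leftmost (As, Bs, f) \<in> Hom M (rlist As) (rlist Bs)"
    "cm As Bs (leftmost (As, Bs, f)) = (As, Bs, f)"
proof -
  show o: "As \<in> OL" "Bs \<in> OL" using f by (auto simp: is_clique_mor_def)
  have h: "f (i, k) \<in> Hom M (braid_clique As i) (braid_clique Bs k)"
    if "i \<le> length As" "k \<le> length Bs" for i k
    using f that by (auto simp: is_clique_mor_def)
  show "leftmost (As, Bs, f) \<in> Hom M (rlist As) (rlist Bs)"
    using h[of 0 0] by (simp add: leftmost_def)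
  have c: "f (i, j) \<cdot> ci Bs j k = ci As i l \<cdot> f (l, k)"
    if "i \<le> length As" "l \<le> length As" "j \<le> length Bs" "k \<le> length Bs" for i j k l
    using f that unfolding is_clique_mor_def split by blast
  have "ci As i 0 \<cdot> f (0, 0) \<cdot> ci Bs 0 k = f (i, k)" if "i \<le> length As" "k \<le> length Bs" for i k
  proof -
    have [simp]: "f (i, k) \<in> Arr M" "Cod M (f (i, k)) = braid_clique Bs k"
      "f (0, 0) \<in> Arr M" "Dom M (f (0, 0)) = rlist As" "Cod M (f (0, 0)) = rlist Bs"
      "f (i, 0) \<in> Arr M" "Cod M (f (i, 0)) = rlist Bs"
      using h[OF that] h[of 0 0] h[of i 0] that by (auto simp: Hom_iff)
    \<comment> \<open>Compatibility is used twice: it first moves the domain index from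
      \<open>i\<close> to 0, then the codomain index from 0 to \<open>k\<close>.\<close>
    have "ci Bs 0 0 = Ide M (rlist Bs)" using o clique_iso_0_0 by blast
    then have "ci As i 0 \<cdot> f (0, 0) = f (i, 0)"
      using c[of i 0 0 0] that by simp
    moreover have "f (i, 0) \<cdot> ci Bs 0 k = f (i, k)"
      using c[of i i 0 k] h[OF that] that o by (simp add: clique_iso_same Hom_iff)
    ultimately show ?thesis by simp
  qed
  moreover have "f \<in> extensional ({..length As} \<times> {..length Bs})"
    using f by (auto simp: is_clique_mor_def)
  ultimately show "cm As Bs (leftmost (As, Bs, f)) = (As, Bs, f)"
    by (auto simp: clique_mor_of_def leftmost_def intro!: extensionalityI[of _ "{..length As} \<times> {..length Bs}"])
qed

section \<open>The free effectful category\<close>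

abbreviation F where "F \<equiv> FreeEff (V, G)"

lemma F_simps [simp]:
  "Obj F = OL" "Unit F = []" "TObj F = (@)"
  "Dom F (cm As Bs m) = As" "Cod F (cm As Bs m) = Bs"
  by (simp_all add: FreeEff_def Let_def clique_mor_of_def)

text \<open>Writing arrows of \<open>F\<close> as \<open>cm As Bs m\<close> turns equations between
  cliques into equations between leftmost components.\<close>

lemma Hom_F:
  "f \<in> Hom F As Bs \<longleftrightarrow>
    As \<in> OL \<and> Bs \<in> OL \<and> (\<exists>m. m \<in> Hom M (rlist As) (rlist Bs) \<and> f = cm As Bs m)"
proof
  assume "f \<in> Hom F As Bs"
  then obtain h where "is_clique_mor (V, G) (As, Bs, h)" "f = (As, Bs, h)"
    by (cases f) (auto simp: Hom_iff FreeEff_def Let_def)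
  with clique_mor_of_leftmost[of As Bs h]
  show "As \<in> OL \<and> Bs \<in> OL \<and> (\<exists>m. m \<in> Hom M (rlist As) (rlist Bs) \<and> f = cm As Bs m)"
    by metis
next
  assume "As \<in> OL \<and> Bs \<in> OL \<and> (\<exists>m. m \<in> Hom M (rlist As) (rlist Bs) \<and> f = cm As Bs m)"
  then obtain m where o: "As \<in> OL" "Bs \<in> OL" and m: "m \<in> Hom M (rlist As) (rlist Bs)"
    and f: "f = cm As Bs m" by blast
  have "f \<in> Arr F"
    unfolding f using is_clique_mor_of[OF o m] by (simp add: FreeEff_def Let_def)
  then show "f \<in> Hom F As Bs" by (simp add: Hom_iff f)
qed

lemma Hom_FE:
  assumes "f \<in> Hom F As Bs"
  obtains m where "As \<in> OL" "Bs \<in> OL" "m \<in> Hom M (rlist As) (rlist Bs)" "f = cm As Bs m"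
  using assms Hom_F by blast

lemma cm_Hom: "\<lbrakk>As \<in> OL; Bs \<in> OL; m \<in> Hom M (rlist As) (rlist Bs)\<rbrakk> \<Longrightarrow> cm As Bs m \<in> Hom F As Bs"
  using Hom_F by blast

lemma Ide_F: "Ide F As = cm As As (Ide M (rlist As))"
  by (simp add: FreeEff_def Let_def eff_Ide_def)

lemma Comp_F:
  assumes "As \<in> OL" "Bs \<in> OL" "Ds \<in> OL" "m \<in> Hom M (rlist As) (rlist Bs)" "n \<in> Hom M (rlist Bs) (rlist Ds)"
  shows "cm As Bs m ;;\<^bsub>F\<^esub> cm Bs Ds n = cm As Ds (m \<cdot> n)"
proof -
  have "cm As Bs m ;;\<^bsub>F\<^esub> cm Bs Ds n = cm As Ds (leftmost (cm As Bs m) \<cdot> leftmost (cm Bs Ds n))"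
    by (simp add: FreeEff_def Let_def) (simp add: clique_mor_of_def)
  then show ?thesis using assms by simp
qed

text \<open>A whiskered arrow must again have its runtime in front of everything, so the runtime is
  braided past \<open>Cs\<close>, used by \<open>m\<close>, and braided back.\<close>

definition lwhisk :: "'o list \<Rightarrow> 'o list \<Rightarrow> 'o list \<Rightarrow> ('o, 'v, 'g) rarrow \<Rightarrow> ('o, 'v, 'g) rarrow" where
  "lwhisk Cs As Bs m = br Cs \<bullet> I As \<cdot> I Cs \<bullet> m \<cdot> bri Cs \<bullet> I Bs"

lemma LWhisk_F:
  assumes "As \<in> OL" "Bs \<in> OL" "m \<in> Hom M (rlist As) (rlist Bs)"
  shows "Cs \<ltimes>\<^bsub>F\<^esub> cm As Bs m = cm (Cs @ As) (Cs @ Bs) (lwhisk Cs As Bs m)"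
proof -
  have "Cs \<ltimes>\<^bsub>F\<^esub> cm As Bs m = cm (Cs @ As) (Cs @ Bs) (lwhisk Cs As Bs (leftmost (cm As Bs m)))"
    by (simp add: FreeEff_def Let_def lwhisk_def) (simp add: clique_mor_of_def)
  then show ?thesis using assms by simp
qed

lemma RWhisk_F:
  assumes "As \<in> OL" "Bs \<in> OL" "m \<in> Hom M (rlist As) (rlist Bs)"
  shows "cm As Bs m \<rtimes>\<^bsub>F\<^esub> Cs = cm (As @ Cs) (Bs @ Cs) (m \<bullet> I Cs)"
proof -
  have "cm As Bs m \<rtimes>\<^bsub>F\<^esub> Cs = cm (As @ Cs) (Bs @ Cs) (leftmost (cm As Bs m) \<bullet> I Cs)"
    by (simp add: FreeEff_def Let_def) (simp add: clique_mor_of_def)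
  then show ?thesis using assms by simp
qed

lemma lwhisk_Hom:
  assumes "As \<in> OL" "Bs \<in> OL" "Cs \<in> OL" "m \<in> Hom M (rlist As) (rlist Bs)"
  shows "lwhisk Cs As Bs m \<in> Hom M (rlist (Cs @ As)) (rlist (Cs @ Bs))"
proof -
  have "m \<in> Arr M" "Dom M m = rlist As" "Cod M m = rlist Bs"
    using assms(4) by (auto simp: Hom_iff)
  with assms show ?thesis by (simp add: lwhisk_def Hom_iff)
qed

lemma rwhisk_Hom:
  assumes "Cs \<in> OL" "m \<in> Hom M (rlist As) (rlist Bs)"
  shows "m \<bullet> I Cs \<in> Hom M (rlist (As @ Cs)) (rlist (Bs @ Cs))"
  using TArr_Hom[OF assms(2), of "I Cs" "plain Cs" "plain Cs"] assms by (simp add: Hom_iff)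

text \<open>The braiding past \<open>Cs\<close> is invertible, so a left whiskering is the only
  solution of its square with the braidings. The laws of left whiskering are proved by exhibiting
  such squares, which keeps inverse braidings out of the calculations.\<close>

lemma lwhisk_unique:
  assumes "As \<in> OL" "Bs \<in> OL" "Cs \<in> OL" "m \<in> Hom M (rlist As) (rlist Bs)"
    "n \<in> Hom M (rlist (Cs @ As)) (rlist (Cs @ Bs))"
    "n \<cdot> br Cs \<bullet> I Bs = br Cs \<bullet> I As \<cdot> I Cs \<bullet> m"
  shows "lwhisk Cs As Bs m = n"
proof -
  have [simp]: "m \<in> Arr M" "Dom M m = rlist As" "Cod M m = rlist Bs"
    "n \<in> Arr M" "Dom M n = rlist (Cs @ As)" "Cod M n = rlist (Cs @ Bs)"
    using assms(4,5) by (auto simp: Hom_iff)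
  have "lwhisk Cs As Bs m = (n \<cdot> br Cs \<bullet> I Bs) \<cdot> bri Cs \<bullet> I Bs"
    unfolding lwhisk_def assms(6) by (rule refl)
  also have "\<dots> = n"
    using assms(1-3) by (simp add: Comp_TArr br_inverse TArr_Ide)
  finally show ?thesis .
qed

lemma lwhisk_br:
  assumes "As \<in> OL" "Bs \<in> OL" "Cs \<in> OL" "m \<in> Hom M (rlist As) (rlist Bs)"
  shows "lwhisk Cs As Bs m \<cdot> br Cs \<bullet> I Bs = br Cs \<bullet> I As \<cdot> I Cs \<bullet> m"
proof -
  have [simp]: "m \<in> Arr M" "Dom M m = rlist As" "Cod M m = rlist Bs"
    using assms(4) by (auto simp: Hom_iff)
  show ?thesis
    using assms(1-3) by (simp add: lwhisk_def Comp_TArr[of "bri Cs"] br_inverse TArr_Ide)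
qed

lemma category_F: "category F"
proof
  fix f assume "f \<in> Arr F"
  then have "f \<in> Hom F (Dom F f) (Cod F f)" by (simp add: Hom_iff)
  then show "Dom F f \<in> Obj F" "Cod F f \<in> Obj F" by (simp_all add: Hom_F)
next
  fix A assume "A \<in> Obj F"
  then show "Ide F A \<in> Hom F A A" by (simp add: Ide_F cm_Hom Ide_Hom)
next
  fix f A B assume "f \<in> Hom F A B"
  then show "Ide F A ;;\<^bsub>F\<^esub> f = f" "f ;;\<^bsub>F\<^esub> Ide F B = f"
    by (elim Hom_FE, simp add: Ide_F Comp_F Ide_Hom Ide_left Ide_right)+
next
  fix f A B g D assume "f \<in> Hom F A B" "g \<in> Hom F B D"
  then show "f ;;\<^bsub>F\<^esub> g \<in> Hom F A D"
    by (elim Hom_FE) (simp add: Comp_F Comp_Hom cm_Hom)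
next
  fix f A B g D h E assume "f \<in> Hom F A B" "g \<in> Hom F B D" "h \<in> Hom F D E"
  then obtain l m n where "A \<in> OL" "B \<in> OL" "D \<in> OL" "E \<in> OL"
    and lmn: "l \<in> Hom M (rlist A) (rlist B)" "m \<in> Hom M (rlist B) (rlist D)" "n \<in> Hom M (rlist D) (rlist E)"
    and "f = cm A B l" "g = cm B D m" "h = cm D E n"
    by (elim Hom_FE) blast
  then show "f ;;\<^bsub>F\<^esub> g ;;\<^bsub>F\<^esub> h = f ;;\<^bsub>F\<^esub> (g ;;\<^bsub>F\<^esub> h)"
    using Comp_assoc[OF lmn] Comp_Hom[OF lmn(1,2)] Comp_Hom[OF lmn(2,3)] by (simp add: Comp_F)
qed

lemma lwhisk_Ide:
  assumes "As \<in> OL" "Cs \<in> OL"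
  shows "lwhisk Cs As As (Ide M (rlist As)) = Ide M (rlist (Cs @ As))"
  using assms by (intro lwhisk_unique) (simp_all add: Hom_iff TArr_Ide)

lemma lwhisk_Comp:
  assumes "As \<in> OL" "Bs \<in> OL" "Cs \<in> OL" "Ds \<in> OL"
    "m \<in> Hom M (rlist As) (rlist Bs)" "n \<in> Hom M (rlist Bs) (rlist Ds)"
  shows "lwhisk Cs As Ds (m \<cdot> n) = lwhisk Cs As Bs m \<cdot> lwhisk Cs Bs Ds n"
proof -
  have [simp]: "m \<in> Arr M" "Dom M m = rlist As" "Cod M m = rlist Bs"
    "n \<in> Arr M" "Dom M n = rlist Bs" "Cod M n = rlist Ds"
    using assms(5,6) by (auto simp: Hom_iff)
  note h = lwhisk_Hom[OF assms(1-3,5)] lwhisk_Hom[OF assms(2,4,3,6)]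
  note [simp] = h[unfolded Hom_iff]
  have b: "lwhisk Cs As Bs m \<cdot> br Cs \<bullet> I Bs = br Cs \<bullet> I As \<cdot> I Cs \<bullet> m"
    "lwhisk Cs Bs Ds n \<cdot> br Cs \<bullet> I Ds = br Cs \<bullet> I Bs \<cdot> I Cs \<bullet> n"
    using lwhisk_br assms by blast+
  show ?thesis
    \<comment> \<open>The square of the composite is the pasting of the two squares in
      \<open>b\<close>.\<close>
    by (rule lwhisk_unique[OF assms(1,4,3) Comp_Hom[OF assms(5,6)] Comp_Hom[OF h]])
      (use assms(1-4) b Comp_reassoc[OF b(1), of "I Cs \<bullet> n"] in \<open>simp add: TArr_Comp_Ide\<close>)
qed

text \<open>By the hexagon law, the square for \<open>Cs @ Ds\<close> stacks the square for
  \<open>Cs\<close> and the square for \<open>Ds\<close> tensored with \<open>I Cs\<close>.\<close>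

lemma lwhisk_lwhisk:
  assumes "As \<in> OL" "Bs \<in> OL" "Cs \<in> OL" "Ds \<in> OL" "m \<in> Hom M (rlist As) (rlist Bs)"
  shows "lwhisk Cs (Ds @ As) (Ds @ Bs) (lwhisk Ds As Bs m) = lwhisk (Cs @ Ds) As Bs m"
proof -
  note h = lwhisk_Hom[OF assms(1,2,4,5)]
  have h': "lwhisk Cs (Ds @ As) (Ds @ Bs) (lwhisk Ds As Bs m)
      \<in> Hom M (rlist (Cs @ Ds @ As)) (rlist (Cs @ Ds @ Bs))"
    using lwhisk_Hom[OF _ _ assms(3) h] assms by simp
  have [simp]: "m \<in> Arr M" "Dom M m = rlist As" "Cod M m = rlist Bs"
    using assms(5) by (auto simp: Hom_iff)
  note [simp] = h[unfolded Hom_iff] h'[unfolded Hom_iff]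
  have b: "lwhisk Ds As Bs m \<cdot> br Ds \<bullet> I Bs = br Ds \<bullet> I As \<cdot> I Ds \<bullet> m"
    using lwhisk_br assms by blast
  have b': "lwhisk Cs (Ds @ As) (Ds @ Bs) (lwhisk Ds As Bs m) \<cdot> br Cs \<bullet> I Ds \<bullet> I Bs =
    br Cs \<bullet> I Ds \<bullet> I As \<cdot> I Cs \<bullet> lwhisk Ds As Bs m"
    using lwhisk_br[OF _ _ assms(3) h] assms(1-4) by (simp add: Ide_append)
  have "lwhisk (Cs @ Ds) As Bs m = lwhisk Cs (Ds @ As) (Ds @ Bs) (lwhisk Ds As Bs m)"
  proof (rule lwhisk_unique)
    have "lwhisk Cs (Ds @ As) (Ds @ Bs) (lwhisk Ds As Bs m) \<cdot> br (Cs @ Ds) \<bullet> I Bs =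
      br Cs \<bullet> I Ds \<bullet> I As \<cdot> I Cs \<bullet> (lwhisk Ds As Bs m \<cdot> br Ds \<bullet> I Bs)"
      using assms(1-4) Comp_reassoc[OF b', of "I Cs \<bullet> br Ds \<bullet> I Bs"]
      by (simp add: br_append TArr_Comp_Ide)
    also have "\<dots> = br (Cs @ Ds) \<bullet> I As \<cdot> I (Cs @ Ds) \<bullet> m"
      unfolding b using assms(1-4) by (simp add: br_append TArr_Comp_Ide Ide_append)
    finally show "lwhisk Cs (Ds @ As) (Ds @ Bs) (lwhisk Ds As Bs m) \<cdot> br (Cs @ Ds) \<bullet> I Bs =
      br (Cs @ Ds) \<bullet> I As \<cdot> I (Cs @ Ds) \<bullet> m" .
  qed (use assms h' in simp_all)
  then show ?thesis ..
qed

lemma lwhisk_rwhisk: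
  assumes "As \<in> OL" "Bs \<in> OL" "Cs \<in> OL" "Ds \<in> OL" "m \<in> Hom M (rlist As) (rlist Bs)"
  shows "lwhisk Cs (As @ Ds) (Bs @ Ds) (m \<bullet> I Ds) = lwhisk Cs As Bs m \<bullet> I Ds"
proof (rule lwhisk_unique)
  note h = lwhisk_Hom[OF assms(1,2,3,5)]
  show "lwhisk Cs As Bs m \<bullet> I Ds \<in> Hom M (rlist (Cs @ As @ Ds)) (rlist (Cs @ Bs @ Ds))"
    using rwhisk_Hom[OF assms(4) h] by simp
  have [simp]: "m \<in> Arr M" "Dom M m = rlist As" "Cod M m = rlist Bs"
    using assms(5) by (auto simp: Hom_iff)
  note [simp] = h[unfolded Hom_iff]
  have "lwhisk Cs As Bs m \<bullet> I Ds \<cdot> br Cs \<bullet> I (Bs @ Ds) = (lwhisk Cs As Bs m \<cdot> br Cs \<bullet> I Bs) \<bullet> I Ds"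
    using assms(1-4) by (simp add: TArr_Comp_Ide Ide_append)
  also have "\<dots> = (br Cs \<bullet> I As \<cdot> I Cs \<bullet> m) \<bullet> I Ds"
    using lwhisk_br assms by simp
  also have "\<dots> = br Cs \<bullet> I (As @ Ds) \<cdot> I Cs \<bullet> (m \<bullet> I Ds)"
    using assms(1-4) by (simp add: TArr_Comp_Ide Ide_append)
  finally show "lwhisk Cs As Bs m \<bullet> I Ds \<cdot> br Cs \<bullet> I (Bs @ Ds) =
    br Cs \<bullet> I (As @ Ds) \<cdot> I Cs \<bullet> (m \<bullet> I Ds)" .
qed (use assms rwhisk_Hom in simp_all)

lemma lwhisk_Nil:
  assumes "As \<in> OL" "Bs \<in> OL" "m \<in> Hom M (rlist As) (rlist Bs)"
  shows "lwhisk [] As Bs m = m"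
proof -
  have [simp]: "m \<in> Arr M" "Dom M m = rlist As" "Cod M m = rlist Bs"
    using assms(3) by (auto simp: Hom_iff)
  show ?thesis
    by (rule lwhisk_unique) (use assms in \<open>simp_all add: TArr_Ide\<close>)
qed

lemma strict_premonoidal_F: "strict_premonoidal F"
proof -
  interpret F: category F by (rule category_F)
  show ?thesis
  proof
    fix A f B B' assume "A \<in> Obj F" "f \<in> Hom F B B'"
    then show "A \<ltimes>\<^bsub>F\<^esub> f \<in> Hom F (A \<otimes>\<^bsub>F\<^esub> B) (A \<otimes>\<^bsub>F\<^esub> B')"
      "f \<rtimes>\<^bsub>F\<^esub> A \<in> Hom F (B \<otimes>\<^bsub>F\<^esub> A) (B' \<otimes>\<^bsub>F\<^esub> A)"
      by (elim Hom_FE, simp add: LWhisk_F RWhisk_F cm_Hom lwhisk_Hom[simplified] rwhisk_Hom[simplified])+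
  next
    fix A B assume "A \<in> Obj F" "B \<in> Obj F"
    then show "A \<ltimes>\<^bsub>F\<^esub> Ide F B = Ide F (A \<otimes>\<^bsub>F\<^esub> B)" "Ide F B \<rtimes>\<^bsub>F\<^esub> A = Ide F (B \<otimes>\<^bsub>F\<^esub> A)"
      by (simp_all add: Ide_F LWhisk_F RWhisk_F lwhisk_Ide Ide_Hom TArr_Ide)
  next
    fix A f B B' g B'' assume "A \<in> Obj F" "f \<in> Hom F B B'" "g \<in> Hom F B' B''"
    then obtain m n where o: "A \<in> OL" "B \<in> OL" "B' \<in> OL" "B'' \<in> OL"
      and mn: "m \<in> Hom M (rlist B) (rlist B')" "n \<in> Hom M (rlist B') (rlist B'')"
      and fg: "f = cm B B' m" "g = cm B' B'' n"
      by (elim Hom_FE) simp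
    note h = lwhisk_Hom[OF o(2,3,1) mn(1)] lwhisk_Hom[OF o(3,4,1) mn(2)]
      rwhisk_Hom[OF o(1) mn(1)] rwhisk_Hom[OF o(1) mn(2)] Comp_Hom[OF mn]
    show "A \<ltimes>\<^bsub>F\<^esub> (f ;;\<^bsub>F\<^esub> g) = (A \<ltimes>\<^bsub>F\<^esub> f) ;;\<^bsub>F\<^esub> (A \<ltimes>\<^bsub>F\<^esub> g)"
      using o mn h Comp_F[OF _ _ _ h(1,2)] by (simp add: fg Comp_F LWhisk_F lwhisk_Comp)
    show "(f ;;\<^bsub>F\<^esub> g) \<rtimes>\<^bsub>F\<^esub> A = (f \<rtimes>\<^bsub>F\<^esub> A) ;;\<^bsub>F\<^esub> (g \<rtimes>\<^bsub>F\<^esub> A)"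
      using o mn h Comp_F[OF _ _ _ h(3,4)] TArr_Comp_Ide(2)[of m n "plain A"]
      by (simp add: fg Comp_F RWhisk_F Hom_iff[of m] Hom_iff[of n])
  next
    fix A B f D D' assume "A \<in> Obj F" "B \<in> Obj F" "f \<in> Hom F D D'"
    then obtain m where o: "A \<in> OL" "B \<in> OL" "D \<in> OL" "D' \<in> OL"
      and m: "m \<in> Hom M (rlist D) (rlist D')" and f: "f = cm D D' m"
      by (elim Hom_FE) simp
    note h = lwhisk_Hom[OF o(3,4) _ m] rwhisk_Hom[OF _ m]
    show "A \<ltimes>\<^bsub>F\<^esub> (B \<ltimes>\<^bsub>F\<^esub> f) = (A \<otimes>\<^bsub>F\<^esub> B) \<ltimes>\<^bsub>F\<^esub> f"
      using o m LWhisk_F[OF _ _ h(1)[OF o(2)]] by (simp add: f LWhisk_F lwhisk_lwhisk)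
    show "(A \<ltimes>\<^bsub>F\<^esub> f) \<rtimes>\<^bsub>F\<^esub> B = A \<ltimes>\<^bsub>F\<^esub> (f \<rtimes>\<^bsub>F\<^esub> B)"
      using o m RWhisk_F[OF _ _ h(1)[OF o(1)]] LWhisk_F[OF _ _ h(2)[OF o(2)]]
      by (simp add: f LWhisk_F RWhisk_F lwhisk_rwhisk)
    show "(f \<rtimes>\<^bsub>F\<^esub> A) \<rtimes>\<^bsub>F\<^esub> B = f \<rtimes>\<^bsub>F\<^esub> (A \<otimes>\<^bsub>F\<^esub> B)"
      using o m RWhisk_F[OF _ _ h(2)[OF o(1)]] by (simp add: f RWhisk_F Ide_append Hom_iff)
  next
    fix f A B assume "f \<in> Hom F A B"
    then show "Unit F \<ltimes>\<^bsub>F\<^esub> f = f" "f \<rtimes>\<^bsub>F\<^esub> Unit F = f"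
      by (elim Hom_FE, simp add: LWhisk_F RWhisk_F lwhisk_Nil Hom_iff)+
  qed simp_all
qed

section \<open>The inclusion of pure arrows and its centrality\<close>

abbreviation E where "E \<equiv> free_effectful (V, G)"

lemma E_simps [simp]: "Pure E = Mon V" "Eff E = F"
  by (simp_all add: free_effectful_def)

lemma incl_Hom_eq:
  assumes "v \<in> Hom (Mon V) As Bs"
  shows "Incl E v = cm As Bs (IR \<bullet> pure v)"
  using assms by (auto simp: free_effectful_def Hom_iff)

lemma pure_lifted_Hom:
  assumes "v \<in> Hom (Mon V) As Bs"
  shows "IR \<bullet> pure v \<in> Hom M (rlist As) (rlist Bs)"
  using TArr_Hom[OF Ide_Hom pure_Hom[OF assms], of "[Runtime]"] by simp

lemma incl_Hom:
  assumes "v \<in> Hom (Mon V) As Bs"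
  shows "Incl E v \<in> Hom F As Bs"
  using Mon.Hom_Obj[OF assms] by (simp add: incl_Hom_eq[OF assms] cm_Hom pure_lifted_Hom[OF assms])

text \<open>The arrow \<open>pure v\<close> and the braidings past \<open>Cs\<close> act on disjoint
  factors, so interchange alone gives the square.\<close>

lemma lwhisk_pure:
  assumes "v \<in> Hom (Mon V) As Bs" "Cs \<in> OL"
  shows "lwhisk Cs As Bs (IR \<bullet> pure v) = IR \<bullet> I Cs \<bullet> pure v"
proof -
  have [simp]: "As \<in> OL" "Bs \<in> OL" using Mon.Hom_Obj[OF assms(1)] by simp_all
  have [simp]: "pure v \<in> Arr M" "Dom M (pure v) = plain As" "Cod M (pure v) = plain Bs"
    using pure_Hom[OF assms(1)] by (auto simp: Hom_iff)
  have *: "I Cs \<bullet> IR \<bullet> pure v = Ide M (plain Cs @ [Runtime]) \<bullet> pure v"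
    "IR \<bullet> I Cs \<bullet> pure v = Ide M (rlist Cs) \<bullet> pure v"
    using assms(2) by (simp_all add: Ide_append Ide_Cons[of "plain Cs"])
  show ?thesis
    by (rule lwhisk_unique[OF _ _ _ pure_lifted_Hom])
      (use assms in \<open>simp_all add: Hom_iff * Comp_TArr\<close>)
qed

lemma br_cancel:
  assumes "As \<in> OL" "Bs \<in> OL" "x \<in> Hom M X (rlist (As @ Bs))" "y \<in> Hom M X (rlist (As @ Bs))"
    "x \<cdot> br As \<bullet> I Bs = y \<cdot> br As \<bullet> I Bs"
  shows "x = y"
proof -
  have [simp]: "x \<in> Arr M" "Cod M x = rlist (As @ Bs)" "y \<in> Arr M" "Cod M y = rlist (As @ Bs)"
    using assms(3,4) by (auto simp: Hom_iff)
  have "x \<cdot> br As \<bullet> I Bs \<cdot> bri As \<bullet> I Bs = y \<cdot> br As \<bullet> I Bs \<cdot> bri As \<bullet> I Bs"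
    using assms(5) by simp
  then show ?thesis
    using assms(1,2) by (simp add: Comp_TArr br_inverse TArr_Ide)
qed

text \<open>The half of centrality that needs naturality: here the runtime has to pass
  \<open>v\<close> before reaching \<open>m\<close>. Both sides are compared after the runtime has
  been braided past \<open>B\<close>, which \<open>br_cancel\<close> undoes at the end.\<close>

lemma pure_central_left:
  assumes v: "v \<in> Hom (Mon V) A B" and m: "m \<in> Hom M (rlist A') (rlist B')"
    and o': "A' \<in> OL" "B' \<in> OL"
  shows "IR \<bullet> pure v \<bullet> I A' \<cdot> lwhisk B A' B' m = lwhisk A A' B' m \<cdot> IR \<bullet> pure v \<bullet> I B'"
proof -
  have o: "A \<in> OL" "B \<in> OL" using Mon.Hom_Obj[OF v] by simp_all
  have [simp]: "pure v \<in> Arr M" "Dom M (pure v) = plain A" "Cod M (pure v) = plain B"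
    using pure_Hom[OF v] by (auto simp: Hom_iff)
  have [simp]: "m \<in> Arr M" "Dom M m = rlist A'" "Cod M m = rlist B'"
    using m by (auto simp: Hom_iff)
  note [simp] = lwhisk_Hom[OF o' o(1) m, unfolded Hom_iff] lwhisk_Hom[OF o' o(2) m, unfolded Hom_iff]
  have n: "(IR \<bullet> pure v \<bullet> I D) \<cdot> br B \<bullet> I D = br A \<bullet> I D \<cdot> pure v \<bullet> Ide M (rlist D)" if "D \<in> OL" for D
  proof -
    have "(IR \<bullet> pure v \<bullet> I D) \<cdot> br B \<bullet> I D = (IR \<bullet> pure v \<cdot> br B) \<bullet> I D"
      using o that by (simp add: TArr_Comp_Ide)
    also have "\<dots> = (br A \<cdot> pure v \<bullet> IR) \<bullet> I D"
      using br_natural[OF v] by simp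
    also have "\<dots> = br A \<bullet> I D \<cdot> pure v \<bullet> Ide M (rlist D)"
      using o that by (simp add: TArr_Comp_Ide Ide_Cons[of "plain D"])
    finally show ?thesis .
  qed
  have "(IR \<bullet> pure v \<bullet> I A' \<cdot> lwhisk B A' B' m) \<cdot> br B \<bullet> I B' =
    IR \<bullet> pure v \<bullet> I A' \<cdot> br B \<bullet> I A' \<cdot> I B \<bullet> m"
    using o o' lwhisk_br[OF o' o(2) m] by simp
  \<comment> \<open>The meeting point of both sides: once the runtime has passed \<open>A\<close>,
    the arrows \<open>pure v\<close> and \<open>m\<close> stand side by side and may act in either
    order.\<close>
  also have "\<dots> = br A \<bullet> I A' \<cdot> pure v \<bullet> m"
    unfolding n[OF o'(1)] using o o' by (simp add: Comp_TArr)
  also have "\<dots> = br A \<bullet> I A' \<cdot> I A \<bullet> m \<cdot> pure v \<bullet> Ide M (rlist B')"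
    using o o' by (simp add: Comp_TArr)
  also have "\<dots> = lwhisk A A' B' m \<cdot> br A \<bullet> I B' \<cdot> pure v \<bullet> Ide M (rlist B')"
    unfolding lwhisk_br[OF o' o(1) m] ..
  also have "\<dots> = (lwhisk A A' B' m \<cdot> IR \<bullet> pure v \<bullet> I B') \<cdot> br B \<bullet> I B'"
    using o o' n[OF o'(2)] by simp
  finally show ?thesis
    by (rule br_cancel[OF o(2) o'(2), where X = "rlist (A @ A')", rotated 2])
      (use o o' in \<open>simp_all add: Hom_iff\<close>)
qed

lemma central_incl:
  assumes v: "v \<in> Hom (Mon V) A B"
  shows "central F (Incl E v)"
proof -
  interpret F: strict_premonoidal F by (rule strict_premonoidal_F)
  have o: "A \<in> OL" "B \<in> OL" using Mon.Hom_Obj[OF v] by simp_all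
  have pv [simp]: "pure v \<in> Arr M" "Dom M (pure v) = plain A" "Cod M (pure v) = plain B"
    using pure_Hom[OF v] by (auto simp: Hom_iff)
  note h = pure_lifted_Hom[OF v]
  have *: "(cm A B (IR \<bullet> pure v) \<rtimes>\<^bsub>F\<^esub> A') ;;\<^bsub>F\<^esub> (B \<ltimes>\<^bsub>F\<^esub> g) = (A \<ltimes>\<^bsub>F\<^esub> g) ;;\<^bsub>F\<^esub> (cm A B (IR \<bullet> pure v) \<rtimes>\<^bsub>F\<^esub> B') \<and>
      (A' \<ltimes>\<^bsub>F\<^esub> cm A B (IR \<bullet> pure v)) ;;\<^bsub>F\<^esub> (g \<rtimes>\<^bsub>F\<^esub> B) = (g \<rtimes>\<^bsub>F\<^esub> A) ;;\<^bsub>F\<^esub> (B' \<ltimes>\<^bsub>F\<^esub> cm A B (IR \<bullet> pure v))"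
    if g: "g \<in> Hom F A' B'" for g A' B'
  proof -
    obtain m where o': "A' \<in> OL" "B' \<in> OL" and m: "m \<in> Hom M (rlist A') (rlist B')" and g: "g = cm A' B' m"
      using g by (rule Hom_FE)
    have [simp]: "m \<in> Arr M" "Dom M m = rlist A'" "Cod M m = rlist B'"
      using m by (auto simp: Hom_iff)
    note l = lwhisk_Hom[OF o' o(1) m] lwhisk_Hom[OF o' o(2) m] lwhisk_Hom[OF o o'(1) h] lwhisk_Hom[OF o o'(2) h]
    note r = rwhisk_Hom[OF o'(1) h] rwhisk_Hom[OF o'(2) h] rwhisk_Hom[OF o(1) m] rwhisk_Hom[OF o(2) m]
    \<comment> \<open>In the other half of centrality the pure arrow stands to the right of the
      runtime throughout, and interchange is enough.\<close>
    have i: "IR \<bullet> I D \<bullet> pure v = Ide M (rlist D) \<bullet> pure v" if "D \<in> OL" for D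
      using that by (simp add: Ide_Cons[of "plain D"])
    show ?thesis
      using o o' h m l r pure_central_left[OF v m o']
      by (simp add: g LWhisk_F RWhisk_F Comp_F[of "A @ A'" _ "B @ B'"] Comp_F[of "A' @ A" _ "B' @ B"])
        (simp add: lwhisk_pure[OF v] i Comp_TArr)
  qed
  show ?thesis
    unfolding central_def Let_def
    using incl_Hom[OF v] *[OF F.in_Hom] by (simp add: Hom_iff incl_Hom_eq[OF v])
qed

lemma strict_tensor_F: "strict_tensor F"
  by (simp add: strict_tensor_def) (simp add: FreeEff_def Let_def)

lemma strict_effectful_free: "strict_effectful_category E"
proof -
  interpret F: strict_premonoidal F by (rule strict_premonoidal_F)
  have st: "strict_tensor (Mon V)"
    unfolding Mon_def by (rule strict_tensor_presented)
  have incl_Ide: "Incl E (Ide (Mon V) A) = Ide F A" if "A \<in> OL" for A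
    using that incl_Hom_eq[OF Mon.Ide_Hom, of A] by (simp add: Ide_F pure_Ide TArr_Ide)
  have incl_Comp: "Incl E (f ;;\<^bsub>Mon V\<^esub> g) = Incl E f ;;\<^bsub>F\<^esub> Incl E g"
    if fg: "f \<in> Hom (Mon V) A B" "g \<in> Hom (Mon V) B D" for f g A B D
    using Comp_F[OF _ _ _ fg[THEN pure_lifted_Hom]] Mon.Hom_Obj[OF fg(1)] Mon.Hom_Obj[OF fg(2)]
      fg[THEN pure_Hom]
    by (simp add: fg[THEN incl_Hom_eq] incl_Hom_eq[OF Mon.Comp_Hom[OF fg]] pure_Comp[OF fg])
      (simp add: Hom_iff Comp_TArr)
  have incl_LWhisk: "Incl E (Ide (Mon V) A \<boxtimes>\<^bsub>Mon V\<^esub> v) = A \<ltimes>\<^bsub>F\<^esub> Incl E v"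
    and incl_RWhisk: "Incl E (v \<boxtimes>\<^bsub>Mon V\<^esub> Ide (Mon V) A) = Incl E v \<rtimes>\<^bsub>F\<^esub> A"
    if A: "A \<in> OL" and v: "v \<in> Hom (Mon V) B D" for A v B D
  proof -
    have [simp]: "pure v \<in> Arr M" "Dom M (pure v) = plain B" "Cod M (pure v) = plain D"
      using pure_Hom[OF v] by (auto simp: Hom_iff)
    have i: "Ide (Mon V) A \<in> Hom (Mon V) A A" using A Mon.Ide_Hom by simp
    show "Incl E (Ide (Mon V) A \<boxtimes>\<^bsub>Mon V\<^esub> v) = A \<ltimes>\<^bsub>F\<^esub> Incl E v"
      using incl_Hom_eq[OF Mon.TArr_Hom[OF i v]] A Mon.Hom_Obj[OF v]
      by (simp add: incl_Hom_eq[OF v] pure_TArr[OF i v] pure_Ide LWhisk_F pure_lifted_Hom[OF v] lwhisk_pure[OF v])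
    show "Incl E (v \<boxtimes>\<^bsub>Mon V\<^esub> Ide (Mon V) A) = Incl E v \<rtimes>\<^bsub>F\<^esub> A"
      using incl_Hom_eq[OF Mon.TArr_Hom[OF v i]] A Mon.Hom_Obj[OF v]
      by (simp add: incl_Hom_eq[OF v] pure_TArr[OF v i] pure_Ide RWhisk_F pure_lifted_Hom[OF v])
  qed
  have "effectful_category E"
  proof (rule effectful_category.intro)
    show "monoidal_category (Pure E)"
      using strict_monoidal_imp_monoidal_category[OF Mon.strict_monoidal_axioms st] by simp
    show "premonoidal_category (Eff E)"
      using strict_premonoidal_imp_premonoidal_category[OF strict_premonoidal_F strict_tensor_F] by simp
    show "cat_functor (Pure E) (Eff E) (\<lambda>A. A) (Incl E)"
      by (rule cat_functorI) (simp_all add: Mon.category_axioms F.category_axioms incl_Ide incl_Comp incl_Hom)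
  next
    fix A v assume "A \<in> Obj (Pure E)" "v \<in> Arr (Pure E)"
    then have A: "A \<in> OL" and v: "v \<in> Hom (Mon V) (Dom (Mon V) v) (Cod (Mon V) v)"
      by (simp_all add: Hom_iff)
    show "Incl E (Ide (Pure E) A \<boxtimes>\<^bsub>Pure E\<^esub> v) = A \<ltimes>\<^bsub>Eff E\<^esub> Incl E v"
      "Incl E (v \<boxtimes>\<^bsub>Pure E\<^esub> Ide (Pure E) A) = Incl E v \<rtimes>\<^bsub>Eff E\<^esub> A"
      using incl_LWhisk[OF A v] incl_RWhisk[OF A v] by simp_all
  next
    fix v assume "v \<in> Arr (Pure E)"
    then show "central (Eff E) (Incl E v)"
      using central_incl[OF Mon.in_Hom, of v] by simp
  qed (use st strict_tensor_F incl_Ide in \<open>simp_all add: strict_tensor_def\<close>)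
  then show ?thesis
    using st strict_tensor_F by (simp add: strict_effectful_category_def strict_effectful_category_axioms_def)
qed

text \<open>Makes the boundary of a generator in the underlying polygraph agree with its list of
  objects; the map is restricted as \<open>generators\<close> requires.\<close>

lemma tensor_list_singletons:
  "As \<in> OL \<Longrightarrow> tensor_list (Mon V) (map (\<lambda>A\<in>PObj V. [A]) As) = As"
  "As \<in> OL \<Longrightarrow> tensor_list F (map (\<lambda>A\<in>PObj V. [A]) As) = As"
  by (induction As) auto

lemma generators_couple_mor: "is_couple_mor (V, G) (underlying_couple E) (generators (V, G))"
proof -
  let ?s = "\<lambda>A\<in>PObj V. [A]"
  have l: "map ?s As \<in> lists OL" if "As \<in> OL" for As
    using that by auto
  have "mclass PV As Bs (TGen (As, Bs, v)) \<in> Hom (Mon V) As Bs" if "v \<in> PArr V As Bs" for v As Bs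
    using that PArr_V_O[OF that] type_Gen[of "(As, Bs, v)" PV] by (auto simp: Mon_def intro: mclass_Hom)
  moreover have "cm As Bs (mclass P (rlist As) (rlist Bs) (TGen (EffGen As Bs g))) \<in> Hom F As Bs"
    if "g \<in> PArr G As Bs" for g As Bs
    using PArr_G_O[OF that] type_gens(2)[OF that] by (intro cm_Hom) (auto simp: Hom_iff mclass_M)
  ultimately show ?thesis
    using l by (auto simp: is_couple_mor_def underlying_couple_def generators_def is_poly_mor_def PObj_G
        underlying_polygraph_def tensor_list_singletons PArr_V_O PArr_G_O
        dest: PArr_V_O PArr_G_O simp del: in_lists_conv_set)
qed

lemma leftmost_bij_betw:
  assumes "A \<in> OL" "B \<in> OL"
  shows "bij_betw leftmost (Hom F A B) (Hom M (rlist A) (rlist B))"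
proof (rule bij_betwI[where g = "cm A B"])
  show "leftmost \<in> Hom F A B \<rightarrow> Hom M (rlist A) (rlist B)"
    by (rule funcsetI) (elim Hom_FE, simp)
  show "cm A B \<in> Hom M (rlist A) (rlist B) \<rightarrow> Hom F A B"
    using assms cm_Hom by blast
  show "cm A B (leftmost f) = f" if "f \<in> Hom F A B" for f
    using that by (elim Hom_FE) simp
  show "leftmost (cm A B m) = m" if "m \<in> Hom M (rlist A) (rlist B)" for m
    using assms that by simp
qed

section \<open>Generation of the runtime arrows\<close>

lemma pure_generator:
  assumes "v \<in> PArr V As Bs"
  shows "mclass PV As Bs (TGen (As, Bs, v)) \<in> Hom (Mon V) As Bs"
    "pure (mclass PV As Bs (TGen (As, Bs, v))) = gen (PureGen As Bs v)"
proof -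
  have t: "has_type PV (TGen (As, Bs, v)) As Bs"
    using type_Gen[of "(As, Bs, v)" PV] assms PArr_V_O[OF assms] by simp
  show "mclass PV As Bs (TGen (As, Bs, v)) \<in> Hom (Mon V) As Bs"
    using mclass_Hom[OF t] by (simp add: Mon_def)
  show "pure (mclass PV As Bs (TGen (As, Bs, v))) = gen (PureGen As Bs v)"
    using pure_mclass[OF t] by (simp add: gen_def)
qed

section \<open>The number of runtimes in a boundary\<close>

abbreviation runtimes :: "'o robj list \<Rightarrow> nat" where
  "runtimes X \<equiv> count_list X Runtime"

lemma runtimes_plain [simp]: "runtimes (plain As) = 0"
  by (induction As) auto

lemma runtimes_0:
  "\<lbrakk>X \<in> Obj M; runtimes X = 0\<rbrakk> \<Longrightarrow> \<exists>As \<in> OL. X = plain As"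
proof (induction X)
  case (Cons x X)
  then obtain a where x: "x = Plain a" "a \<in> PObj V" by (cases x) auto
  with Cons obtain As where "As \<in> OL" "X = plain As" by auto
  with x show ?case by (intro bexI[of _ "a # As"]) auto
qed simp

lemma runtimes_1:
  "\<lbrakk>X \<in> Obj M; runtimes X = 1\<rbrakk> \<Longrightarrow> \<exists>As \<in> OL. \<exists>Bs \<in> OL. X = plain As @ Runtime # plain Bs"
proof (induction X)
  case (Cons x X)
  show ?case
  proof (cases x)
    case Runtime
    with Cons.prems obtain Bs where "Bs \<in> OL" "X = plain Bs" using runtimes_0[of X] by auto
    with Runtime show ?thesis by (intro bexI[of _ "[]"] bexI[of _ Bs]) auto
  next
    case (Plain a)
    with Cons.prems have "X \<in> Obj M" "runtimes X = 1" "a \<in> PObj V" by auto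
    with Cons.IH obtain As Bs where "As \<in> OL" "Bs \<in> OL" "X = plain As @ Runtime # plain Bs" by blast
    with Plain \<open>a \<in> PObj V\<close> show ?thesis by (intro bexI[of _ "a # As"] bexI[of _ Bs]) auto
  qed
qed simp

lemma plain_inject [simp]: "plain As = plain Bs \<longleftrightarrow> As = Bs"
  by (metis inj_map_eq_map inj_onI robj.inject)

text \<open>The position of a single runtime is determined by the list, so blocks found by case
  analysis can be identified with prescribed ones.\<close>

lemma runtime_split_inject:
  "plain As @ Runtime # plain Bs = plain As' @ Runtime # plain Bs' \<longleftrightarrow> As = As' \<and> Bs = Bs'"
proof (induction As arbitrary: As')
  case Nil
  then show ?case by (cases As') auto
next
  case (Cons a As)
  then show ?case by (cases As') auto
qed

text \<open>Each generator has as many runtimes in its codomain as in its domain, and counts add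
  under tensor.\<close>

lemma runtimes_type: "has_type P t X Y \<Longrightarrow> runtimes X = runtimes Y"
proof (induction rule: has_type.induct)
  case (type_Gen g)
  then show ?case by (cases g) (auto simp: runtime_presentation_def)
qed simp_all

lemma has_type_Obj: "has_type P t X Y \<Longrightarrow> X \<in> Obj M \<and> Y \<in> Obj M"
  using has_type_lists by (simp add: Obj_M)

text \<open>All generators except the pure ones have a runtime in their domain, and a term with no
  runtime at its ends has none inside. Only fullness of \<open>pure\<close> is claimed here.\<close>

lemma pure_surjective:
  "\<lbrakk>has_type P t X Y; runtimes X = 0\<rbrakk> \<Longrightarrow>
    \<exists>A B v. X = plain A \<and> Y = plain B \<and> v \<in> Hom (Mon V) A B \<and> mclass P X Y t = pure v"
proof (induction rule: has_type.induct)
  case (type_Id X)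
  then obtain A where "A \<in> OL" "X = plain A" using runtimes_0 by (auto simp: Obj_M)
  then show ?case
    using Mon.Ide_Hom[of A] pure_Ide[of A] by (intro exI[of _ A] exI[of _ "Ide (Mon V) A"]) (simp add: Ide_M)
next
  case (type_Gen g)
  then obtain As Bs v where "g = PureGen As Bs v" "v \<in> PArr V As Bs"
    by (cases g) (auto simp: runtime_presentation_def)
  then show ?case
    using pure_generator[of v As Bs]
    by (intro exI[of _ As] exI[of _ Bs] exI[of _ "mclass PV As Bs (TGen (As, Bs, v))"])
      (simp add: runtime_presentation_def gen_def)
next
  case (type_Comp t X Y u Z)
  then have "runtimes Y = 0" using runtimes_type by metis
  with type_Comp obtain A B v B' D w where
    *: "X = plain A" "Y = plain B" "v \<in> Hom (Mon V) A B" "mclass P X Y t = pure v"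
    "Y = plain B'" "Z = plain D" "w \<in> Hom (Mon V) B' D" "mclass P Y Z u = pure w" by blast
  then have w: "w \<in> Hom (Mon V) B D" by simp
  have "mclass P X Z (TComp t u) = pure (v ;;\<^bsub>Mon V\<^esub> w)"
    using Comp_M[OF type_Comp.hyps] pure_Comp[OF *(3) w] *(4,8) by simp
  then show ?case using * Mon.Comp_Hom[OF *(3) w] by blast
next
  case (type_Tens t X Y u X' Y')
  then obtain A B v A' B' w where
    *: "X = plain A" "Y = plain B" "v \<in> Hom (Mon V) A B" "mclass P X Y t = pure v"
    "X' = plain A'" "Y' = plain B'" "w \<in> Hom (Mon V) A' B'" "mclass P X' Y' u = pure w" by auto
  have "mclass P (X @ X') (Y @ Y') (TTens t u) = pure (v \<boxtimes>\<^bsub>Mon V\<^esub> w)"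
    using TArr_M[OF type_Tens.hyps] pure_TArr[OF *(3,7)] *(4,8) by simp
  moreover have "X @ X' = plain (A @ A')" "Y @ Y' = plain (B @ B')" using * by simp_all
  ultimately show ?case using Mon.TArr_Hom[OF *(3,7)] by (metis Mon_simps(3))
qed

text \<open>A term with exactly one runtime is conjugated by braidings until the runtime is leftmost; below,
  \<open>N\<close> says that the conjugate satisfies \<open>Q\<close>.\<close>

lemma runtime_arrow_induct [consumes 3, case_names pure eff_gen comp rwhisk lwhisk]:
  fixes Q :: "'o list \<Rightarrow> 'o list \<Rightarrow> ('o, 'v, 'g) rarrow \<Rightarrow> bool"
  assumes m: "m \<in> Hom M (rlist A) (rlist B)" and "A \<in> OL" "B \<in> OL"
    and pure: "\<And>A B v. v \<in> Hom (Mon V) A B \<Longrightarrow> Q A B (IR \<bullet> pure v)"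
    and eff_gen: "\<And>As Bs g. g \<in> PArr G As Bs \<Longrightarrow> Q As Bs (gen (EffGen As Bs g))"
    and comp: "\<And>A B D m n. \<lbrakk>A \<in> OL; B \<in> OL; D \<in> OL; m \<in> Hom M (rlist A) (rlist B);
      n \<in> Hom M (rlist B) (rlist D); Q A B m; Q B D n\<rbrakk> \<Longrightarrow> Q A D (m \<cdot> n)"
    and rwhisk: "\<And>A B D m. \<lbrakk>A \<in> OL; B \<in> OL; D \<in> OL; m \<in> Hom M (rlist A) (rlist B); Q A B m\<rbrakk> \<Longrightarrow>
      Q (A @ D) (B @ D) (m \<bullet> I D)"
    and lwhisk: "\<And>A B D m. \<lbrakk>A \<in> OL; B \<in> OL; D \<in> OL; m \<in> Hom M (rlist A) (rlist B); Q A B m\<rbrakk> \<Longrightarrow>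
      Q (D @ A) (D @ B) (lwhisk D A B m)"
  shows "Q A B m"
proof -
  define N where "N A1 A2 B1 B2 n \<longleftrightarrow> (\<exists>x. x \<in> Hom M (rlist (A1 @ A2)) (rlist (B1 @ B2)) \<and>
    Q (A1 @ A2) (B1 @ B2) x \<and> x \<cdot> br B1 \<bullet> I B2 = br A1 \<bullet> I A2 \<cdot> n)" for A1 A2 B1 B2 n
  \<comment> \<open>Identities are included pure arrows, so the induction rule needs no case of its
    own for them.\<close>
  have Q_Ide: "Q A A (Ide M (rlist A))" if "A \<in> OL" for A
    using pure[OF Mon.Ide_Hom, of A] that by (simp add: pure_Ide TArr_Ide)
  have main: "N A1 A2 B1 B2 (mclass P X Y t)"
    if "has_type P t X Y" "X = plain A1 @ Runtime # plain A2" "Y = plain B1 @ Runtime # plain B2"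
    for t X Y A1 A2 B1 B2
    using that
  proof (induction arbitrary: A1 A2 B1 B2 rule: has_type.induct)
    case (type_Id X)
    then have eq: "B1 = A1" "B2 = A2" by (simp_all add: runtime_split_inject)
    have o: "A1 \<in> OL" "A2 \<in> OL" using type_Id by (auto simp flip: Obj_M)
    show ?case
      unfolding N_def eq Ide_M[symmetric] using o Q_Ide[of "A1 @ A2"] type_Id(2)
      by (intro exI[of _ "Ide M (rlist (A1 @ A2))"]) (auto simp: Hom_iff)
  next
    case (type_Gen g)
    have g: "mclass P (GDom P h) (GCod P h) (TGen h) = gen h" "GDom P = rgen_dom" "GCod P = rgen_cod" for h
      by (simp_all add: gen_def runtime_presentation_def)
    have sg: "plain A1 @ Runtime # plain A2 = Runtime # plain As \<longleftrightarrow> A1 = [] \<and> A2 = As" for A1 A2 As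
      using runtime_split_inject[of A1 A2 "[]" As] by simp
    have sg': "plain A1 @ Runtime # plain A2 = [Plain x, Runtime] \<longleftrightarrow> A1 = [x] \<and> A2 = []" for A1 A2 x
      using runtime_split_inject[of A1 A2 "[x]" "[]"] by simp
    show ?case
    proof (cases g)
      \<comment> \<open>Counting runtimes in the domain excludes this case.\<close>
      case (PureGen As Bs v)
      then have "plain As = plain A1 @ Runtime # plain A2"
        using type_Gen(4) unfolding g(2) PureGen by simp
      from arg_cong[OF this, of runtimes] show ?thesis by simp
    next
      case (EffGen As Bs h)
      have h: "h \<in> PArr G As Bs" using type_Gen(1) EffGen by simp
      have eq: "A1 = []" "A2 = As" "B1 = []" "B2 = Bs"
        using type_Gen(4,5)[symmetric] unfolding g(2,3) EffGen by (simp_all add: sg)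
      have h': "gen (EffGen As Bs h) \<in> Hom M (rlist As) (rlist Bs)"
        using type_gens(2)[OF h] by (simp add: gen_def Hom_iff mclass_M)
      show ?thesis
        unfolding g(1) N_def eq unfolding EffGen using eff_gen[OF h] PArr_G_O[OF h] h'
        by (intro exI[of _ "gen (EffGen As Bs h)"]) (simp add: Hom_iff TArr_Ide)
    next
      \<comment> \<open>Both braidings conjugate to an identity: \<open>BraidR x\<close> equals the
        braiding on its codomain side, and \<open>BraidL x\<close> cancels the braiding on its
        domain side.\<close>
      case (BraidR x)
      have x: "x \<in> PObj V" using type_Gen(1) BraidR by simp
      have eq: "A1 = []" "A2 = [x]" "B1 = [x]" "B2 = []"
        using type_Gen(4,5)[symmetric] sg[of _ _ "[x]"] unfolding g(2,3) BraidR by (simp_all add: sg')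
      show ?thesis
        unfolding g(1) N_def eq unfolding BraidR using Q_Ide[of "[x]"] x
        by (intro exI[of _ "Ide M (rlist [x])"]) (simp add: Hom_iff TArr_Ide br_Cons)
    next
      case (BraidL x)
      have x: "x \<in> PObj V" using type_Gen(1) BraidL by simp
      have eq: "B1 = []" "B2 = [x]" "A1 = [x]" "A2 = []"
        using type_Gen(4,5)[symmetric] sg[of _ _ "[x]"] unfolding g(2,3) BraidL by (simp_all add: sg')
      show ?thesis
        unfolding g(1) N_def eq unfolding BraidL using Q_Ide[of "[x]"] x
        by (intro exI[of _ "Ide M (rlist [x])"]) (simp add: Hom_iff TArr_Ide br_Cons gen_inverse)
    qed
  next
    case (type_Comp t X Y u Z A1 A2 D1 D2)
    \<comment> \<open>Invariance of the count locates the runtime in the middle object, where the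
      two squares are pasted.\<close>
    have "Y \<in> Obj M" "runtimes Y = 1"
      using has_type_Obj[OF type_Comp(1)] runtimes_type[OF type_Comp(1)] type_Comp(5) by auto
    then obtain B1 B2 where Y: "Y = plain B1 @ Runtime # plain B2" and oB: "B1 \<in> OL" "B2 \<in> OL"
      using runtimes_1 by blast
    have o: "A1 \<in> OL" "A2 \<in> OL" "D1 \<in> OL" "D2 \<in> OL"
      using has_type_Obj[OF type_Comp(1)] has_type_Obj[OF type_Comp(2)] type_Comp(5,6) by simp_all
    obtain x where x: "x \<in> Hom M (rlist (A1 @ A2)) (rlist (B1 @ B2))" "Q (A1 @ A2) (B1 @ B2) x"
      "x \<cdot> br B1 \<bullet> I B2 = br A1 \<bullet> I A2 \<cdot> mclass P X Y t"
      using type_Comp(3)[OF type_Comp(5) Y] by (auto simp: N_def)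
    obtain y where y: "y \<in> Hom M (rlist (B1 @ B2)) (rlist (D1 @ D2))" "Q (B1 @ B2) (D1 @ D2) y"
      "y \<cdot> br D1 \<bullet> I D2 = br B1 \<bullet> I B2 \<cdot> mclass P Y Z u"
      using type_Comp(4)[OF Y type_Comp(6)] by (auto simp: N_def)
    note [simp] = x(1)[unfolded Hom_iff] y(1)[unfolded Hom_iff]
      mclass_M[OF type_Comp(1), unfolded type_Comp(5) Y] mclass_M[OF type_Comp(2), unfolded Y]
    have "(x \<cdot> y) \<cdot> br D1 \<bullet> I D2 = (x \<cdot> br B1 \<bullet> I B2) \<cdot> mclass P Y Z u"
      using o oB y(3) Y by simp
    also have "\<dots> = br A1 \<bullet> I A2 \<cdot> (mclass P X Y t \<cdot> mclass P Y Z u)"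
      unfolding x(3) using o oB type_Comp(5) Y by simp
    finally show ?case
      unfolding N_def Comp_M[OF type_Comp(1,2)]
      using comp[OF _ _ _ x(1) y(1) x(2) y(2)] o oB Comp_Hom[OF x(1) y(1)]
      by (intro exI[of _ "x \<cdot> y"]) simp
  next
    case (type_Tens t X Y u X' Y' C1 C2 D1 D2)
    have o: "X \<in> Obj M" "Y \<in> Obj M" "X' \<in> Obj M" "Y' \<in> Obj M"
      using has_type_Obj[OF type_Tens(1)] has_type_Obj[OF type_Tens(2)] by simp_all
    note r = runtimes_type[OF type_Tens(1)] runtimes_type[OF type_Tens(2)]
    define mt where "mt = mclass P X Y t"
    define mu where "mu = mclass P X' Y' u"
    have [simp]: "mt \<in> Arr M" "Dom M mt = X" "Cod M mt = Y" "mu \<in> Arr M" "Dom M mu = X'" "Cod M mu = Y'"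
      using mclass_M[OF type_Tens(1)] mclass_M[OF type_Tens(2)] by (simp_all add: mt_def mu_def)
    \<comment> \<open>Exactly one factor holds the runtime, and the other is pure by
      \<open>pure_surjective\<close>.\<close>
    have "runtimes X + runtimes X' = 1"
      using arg_cong[OF type_Tens(5), of runtimes] by simp
    then consider "runtimes X = 1" "runtimes X' = 0" | "runtimes X = 0" "runtimes X' = 1" by linarith
    then show ?case
    proof cases
      case 1
      obtain A1 A2 where X: "X = plain A1 @ Runtime # plain A2" and oA: "A1 \<in> OL" "A2 \<in> OL"
        using runtimes_1[OF o(1)] 1 by blast
      obtain B1 B2 where Y: "Y = plain B1 @ Runtime # plain B2" and oB: "B1 \<in> OL" "B2 \<in> OL"
        using runtimes_1[OF o(2)] 1 r by auto
      obtain A B v where X': "X' = plain A" and Y': "Y' = plain B" and v: "v \<in> Hom (Mon V) A B"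
        and u: "mu = pure v"
        using pure_surjective[OF type_Tens(2) 1(2)] unfolding mu_def by blast
      have oAB: "A \<in> OL" "B \<in> OL" using Mon.Hom_Obj[OF v] by simp_all
      have eq: "C1 = A1" "C2 = A2 @ A" "D1 = B1" "D2 = B2 @ B"
        using type_Tens(5,6) runtime_split_inject[of A1 "A2 @ A" C1 C2] runtime_split_inject[of B1 "B2 @ B" D1 D2]
        by (simp_all add: X X' Y Y')
      obtain x where x: "x \<in> Hom M (rlist (A1 @ A2)) (rlist (B1 @ B2))" "Q (A1 @ A2) (B1 @ B2) x"
        "x \<cdot> br B1 \<bullet> I B2 = br A1 \<bullet> I A2 \<cdot> mt"
        using type_Tens(3)[OF X Y] unfolding N_def mt_def by blast
      note [simp] = x(1)[unfolded Hom_iff] pure_Hom[OF v, unfolded Hom_iff]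
      have i: "Ide (Mon V) (B1 @ B2) \<in> Hom (Mon V) (B1 @ B2) (B1 @ B2)"
        using Mon.Ide_Hom oB by simp
      \<comment> \<open>With the runtime in the left factor, the conjugate is
        \<open>x \<bullet> pure v\<close>. It splits into a right whiskering of \<open>x\<close> and
        a lifted pure arrow, two cases that \<open>Q\<close> covers.\<close>
      define rw where "rw = x \<bullet> I A"
      define pw where "pw = IR \<bullet> pure (Ide (Mon V) (B1 @ B2) \<boxtimes>\<^bsub>Mon V\<^esub> v)"
      have rw: "rw \<in> Hom M (rlist (A1 @ A2 @ A)) (rlist (B1 @ B2 @ A))" "Q (A1 @ A2 @ A) (B1 @ B2 @ A) rw"
        using rwhisk_Hom[OF oAB(1) x(1)] rwhisk[OF _ _ oAB(1) x(1,2)] oA oB by (simp_all add: rw_def)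
      have pw: "pw \<in> Hom M (rlist (B1 @ B2 @ A)) (rlist (B1 @ B2 @ B))" "Q (B1 @ B2 @ A) (B1 @ B2 @ B) pw"
        using pure_lifted_Hom[OF Mon.TArr_Hom[OF i v]] pure[OF Mon.TArr_Hom[OF i v]]
        by (simp_all add: pw_def)
      have "pw = Ide M (rlist (B1 @ B2)) \<bullet> pure v"
        using oB by (simp add: pw_def pure_TArr[OF i v] pure_Ide Ide_append Ide_Cons[of "plain B1 @ plain B2"])
      then have "rw \<cdot> pw = x \<bullet> pure v"
        using oB oAB by (simp add: rw_def Comp_TArr)
      then have q: "Q (C1 @ C2) (D1 @ D2) (x \<bullet> pure v)"
        using comp[OF _ _ _ rw(1) pw(1) rw(2) pw(2)] oA oB oAB by (simp add: eq)
      have "(x \<bullet> pure v) \<cdot> br B1 \<bullet> I (B2 @ B) = (x \<cdot> br B1 \<bullet> I B2) \<bullet> pure v"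
        using oB oAB Comp_TArr[of x "pure v" "br B1 \<bullet> I B2" "I B"] by (simp add: Ide_append)
      also have "\<dots> = (br A1 \<bullet> I A2) \<bullet> I A \<cdot> mt \<bullet> mu"
        unfolding x(3) u using oA oAB X by (subst Comp_TArr) simp_all
      finally show ?thesis
        unfolding N_def TArr_M[OF type_Tens(1,2), symmetric] mt_def[symmetric] mu_def[symmetric]
        using q oA oAB by (intro exI[of _ "x \<bullet> pure v"]) (simp add: eq Hom_iff Ide_append)
    next
      case 2
      obtain A1 A2 where X': "X' = plain A1 @ Runtime # plain A2" and oA: "A1 \<in> OL" "A2 \<in> OL"
        using runtimes_1[OF o(3)] 2 by blast
      obtain B1 B2 where Y': "Y' = plain B1 @ Runtime # plain B2" and oB: "B1 \<in> OL" "B2 \<in> OL"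
        using runtimes_1[OF o(4)] 2 r by auto
      obtain A B v where X: "X = plain A" and Y: "Y = plain B" and v: "v \<in> Hom (Mon V) A B"
        and t: "mt = pure v"
        using pure_surjective[OF type_Tens(1) 2(1)] unfolding mt_def by blast
      have oAB: "A \<in> OL" "B \<in> OL" using Mon.Hom_Obj[OF v] by simp_all
      have eq: "C1 = A @ A1" "C2 = A2" "D1 = B @ B1" "D2 = B2"
        using type_Tens(5,6) runtime_split_inject[of "A @ A1" A2 C1 C2] runtime_split_inject[of "B @ B1" B2 D1 D2]
        by (simp_all add: X X' Y Y')
      obtain x where x: "x \<in> Hom M (rlist (A1 @ A2)) (rlist (B1 @ B2))" "Q (A1 @ A2) (B1 @ B2) x"
        "x \<cdot> br B1 \<bullet> I B2 = br A1 \<bullet> I A2 \<cdot> mu"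
        using type_Tens(4)[OF X' Y'] unfolding N_def mu_def by blast
      \<comment> \<open>With the runtime in the right factor, the conjugate keeps it in front of the
        pure factor: \<open>v\<close> acts first, and then \<open>x\<close> is whiskered on the left
        by the codomain \<open>B\<close> of \<open>v\<close>.\<close>
      define pv where "pv = IR \<bullet> pure v \<bullet> I (A1 @ A2)"
      define lw where "lw = lwhisk B (A1 @ A2) (B1 @ B2) x"
      note [simp] = x(1)[unfolded Hom_iff] pure_Hom[OF v, unfolded Hom_iff]
      have i: "Ide (Mon V) (A1 @ A2) \<in> Hom (Mon V) (A1 @ A2) (A1 @ A2)"
        using Mon.Ide_Hom oA by simp
      have lw: "lw \<in> Hom M (rlist (B @ A1 @ A2)) (rlist (B @ B1 @ B2))"
        unfolding lw_def using lwhisk_Hom[OF _ _ oAB(2) x(1)] oA oB by simp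
      have pv: "pv \<in> Hom M (rlist (A @ A1 @ A2)) (rlist (B @ A1 @ A2))"
        "Q (A @ A1 @ A2) (B @ A1 @ A2) pv"
        using pure_lifted_Hom[OF Mon.TArr_Hom[OF v i]] pure[OF Mon.TArr_Hom[OF v i]] oA
        by (simp_all add: pv_def pure_TArr[OF v i] pure_Ide)
      note [simp] = lw[unfolded Hom_iff] pv(1)[unfolded Hom_iff]
      have q: "Q (C1 @ C2) (D1 @ D2) (pv \<cdot> lw)"
        using comp[OF _ _ _ pv(1) lw pv(2)] lwhisk[OF _ _ oAB(2) x(1,2)] oA oB oAB by (simp add: eq lw_def)
      have "(pv \<cdot> lw) \<cdot> br (B @ B1) \<bullet> I B2 = pv \<cdot> (lw \<cdot> br B \<bullet> I (B1 @ B2)) \<cdot> I B \<bullet> br B1 \<bullet> I B2"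
        using oA oB oAB by (simp add: br_append TArr_Comp_Ide Ide_append)
      also have "\<dots> = pv \<cdot> br B \<bullet> I (A1 @ A2) \<cdot> I B \<bullet> (x \<cdot> br B1 \<bullet> I B2)"
        using lwhisk_br[OF _ _ oAB(2) x(1)] oA oB oAB by (simp add: lw_def[symmetric] TArr_Comp_Ide)
      also have "\<dots> = (IR \<bullet> pure v \<cdot> br B) \<bullet> I (A1 @ A2) \<cdot> I B \<bullet> (br A1 \<bullet> I A2 \<cdot> mu)"
        using oA oB oAB by (simp add: pv_def x(3) TArr_Comp_Ide)
      \<comment> \<open>Naturality replaces the braiding past \<open>B\<close> after
        \<open>v\<close> by the braiding past \<open>A\<close> before it.\<close>
      also have "\<dots> = br A \<bullet> I (A1 @ A2) \<cdot> (pure v \<bullet> Ide M (rlist (A1 @ A2)) \<cdot> I B \<bullet> (br A1 \<bullet> I A2 \<cdot> mu))"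
        unfolding br_natural[OF v]
        using oA oB oAB X' by (simp add: TArr_Comp_Ide Ide_Cons[of "plain A1 @ plain A2"])
      also have "\<dots> = br A \<bullet> I (A1 @ A2) \<cdot> pure v \<bullet> (br A1 \<bullet> I A2 \<cdot> mu)"
        using oA oB oAB X' by (simp add: Comp_TArr)
      also have "pure v \<bullet> (br A1 \<bullet> I A2 \<cdot> mu) = I A \<bullet> br A1 \<bullet> I A2 \<cdot> pure v \<bullet> mu"
        using oA oB oAB X' by (simp add: Comp_TArr)
      also have "br A \<bullet> I (A1 @ A2) \<cdot> (I A \<bullet> br A1 \<bullet> I A2 \<cdot> pure v \<bullet> mu) =
          br (A @ A1) \<bullet> I A2 \<cdot> mt \<bullet> mu"
        using oA oB oAB X' by (simp add: br_append TArr_Comp_Ide Ide_append t)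
      finally show ?thesis
        unfolding N_def TArr_M[OF type_Tens(1,2), symmetric] mt_def[symmetric] mu_def[symmetric]
        using q Comp_Hom[OF pv(1) lw] by (intro exI[of _ "pv \<cdot> lw"]) (simp add: eq)
    qed
  qed
  obtain t where t: "has_type P t (rlist A) (rlist B)" "m = mclass P (rlist A) (rlist B) t"
    using m Hom_M by blast
  \<comment> \<open>With the runtime leftmost at both ends the conjugating braidings pass the empty
    list, so the conjugate is \<open>m\<close> itself.\<close>
  from main[OF t(1), of "[]" A "[]" B] obtain x where
    "x \<in> Hom M (rlist A) (rlist B)" "Q A B x" "x \<cdot> IR \<bullet> I B = IR \<bullet> I A \<cdot> m"
    by (auto simp: N_def t(2))
  moreover from this m assms(2,3) have "x = m"
    by (simp add: TArr_Ide Hom_iff)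
  ultimately show ?thesis by simp
qed

end

section \<open>Counting the runtime in a strict effectful category\<close>

text \<open>Terms of the runtime category over lists with at most one runtime are interpreted in an effectful
  category: in the pure part if there is no runtime, in the effectful part if there is one. To have
  a total interpretation, all arrows between lists with at least two runtimes are identified.\<close>

datatype ('p, 'n, 'm) level_arrow = LPure 'n | LEff (un_LEff: 'm) | LTriv 'p 'p

fun level_dom :: "('p, 'n, 'm) eff_cat \<Rightarrow> ('p, 'n, 'm) level_arrow \<Rightarrow> 'p \<times> nat" where
  "level_dom T (LPure v) = (Dom (Pure T) v, 0)"
| "level_dom T (LEff f) = (Dom (Eff T) f, 1)"
| "level_dom T (LTriv A B) = (A, 2)"

fun level_cod :: "('p, 'n, 'm) eff_cat \<Rightarrow> ('p, 'n, 'm) level_arrow \<Rightarrow> 'p \<times> nat" where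
  "level_cod T (LPure v) = (Cod (Pure T) v, 0)"
| "level_cod T (LEff f) = (Cod (Eff T) f, 1)"
| "level_cod T (LTriv A B) = (B, 2)"

text \<open>Composable arrows lie at the same level, so among them the last clause concerns only two
  \<open>LTriv\<close> arrows.\<close>

fun level_comp :: "('p, 'n, 'm) eff_cat \<Rightarrow> ('p, 'n, 'm) level_arrow \<Rightarrow> ('p, 'n, 'm) level_arrow \<Rightarrow>
    ('p, 'n, 'm) level_arrow" where
  "level_comp T (LPure v) (LPure w) = LPure (v ;;\<^bsub>Pure T\<^esub> w)"
| "level_comp T (LEff f) (LEff g) = LEff (f ;;\<^bsub>Eff T\<^esub> g)"
| "level_comp T x y = LTriv (fst (level_dom T x)) (fst (level_cod T y))"

text \<open>In the mixed clauses the left factor acts first; the other order gives the same arrow,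
  as pure arrows are central. Two effectful factors fall to the last clause, since a premonoidal
  category gives them no tensor.\<close>

fun level_tensor :: "('p, 'n, 'm) eff_cat \<Rightarrow> ('p, 'n, 'm) level_arrow \<Rightarrow> ('p, 'n, 'm) level_arrow \<Rightarrow>
    ('p, 'n, 'm) level_arrow" where
  "level_tensor T (LPure v) (LPure w) = LPure (v \<boxtimes>\<^bsub>Pure T\<^esub> w)"
| "level_tensor T (LPure v) (LEff g) =
    LEff ((Incl T v \<rtimes>\<^bsub>Eff T\<^esub> Dom (Eff T) g) ;;\<^bsub>Eff T\<^esub> (Cod (Pure T) v \<ltimes>\<^bsub>Eff T\<^esub> g))"
| "level_tensor T (LEff f) (LPure w) =
    LEff ((f \<rtimes>\<^bsub>Eff T\<^esub> Dom (Pure T) w) ;;\<^bsub>Eff T\<^esub> (Cod (Eff T) f \<ltimes>\<^bsub>Eff T\<^esub> Incl T w))"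
| "level_tensor T x y = LTriv (fst (level_dom T x) \<otimes>\<^bsub>Pure T\<^esub> fst (level_dom T y))
    (fst (level_cod T x) \<otimes>\<^bsub>Pure T\<^esub> fst (level_cod T y))"

text \<open>Addition capped at 2 is still associative, and 2 stands for any larger count. The
  coherence fields stay \<open>undefined\<close> because \<open>strict_monoidal\<close> does not
  mention them.\<close>

definition level_cat :: "('p, 'n, 'm) eff_cat \<Rightarrow> ('p \<times> nat, ('p, 'n, 'm) level_arrow) mon_cat" where
  "level_cat T = \<lparr>
     Obj = Obj (Pure T) \<times> {..2},
     Arr = LPure ` Arr (Pure T) \<union> LEff ` Arr (Eff T) \<union>
       {LTriv A B | A B. A \<in> Obj (Pure T) \<and> B \<in> Obj (Pure T)},
     Dom = level_dom T,
     Cod = level_cod T,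
     Ide = (\<lambda>(A, i). if i = 0 then LPure (Ide (Pure T) A) else if i = 1 then LEff (Ide (Eff T) A)
       else LTriv A A),
     Comp = level_comp T,
     Unit = (Unit (Pure T), 0),
     TObj = (\<lambda>(A, i) (B, j). (A \<otimes>\<^bsub>Pure T\<^esub> B, min 2 (i + j))),
     Assoc = (\<lambda>A B C. undefined),
     RUnit = (\<lambda>A. undefined),
     LUnit = (\<lambda>A. undefined),
     TArr = level_tensor T \<rparr>"

lemma level_cat_simps [simp]:
  "(A, i) \<in> Obj (level_cat T) \<longleftrightarrow> A \<in> Obj (Pure T) \<and> i \<le> 2"
  "LPure v \<in> Arr (level_cat T) \<longleftrightarrow> v \<in> Arr (Pure T)"
  "LEff f \<in> Arr (level_cat T) \<longleftrightarrow> f \<in> Arr (Eff T)"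
  "LTriv A B \<in> Arr (level_cat T) \<longleftrightarrow> A \<in> Obj (Pure T) \<and> B \<in> Obj (Pure T)"
  "Dom (level_cat T) = level_dom T"
  "Cod (level_cat T) = level_cod T"
  "Ide (level_cat T) (A, 0) = LPure (Ide (Pure T) A)"
  "Ide (level_cat T) (A, Suc 0) = LEff (Ide (Eff T) A)"
  "Ide (level_cat T) (A, 2) = LTriv A A"
  "Ide (level_cat T) (A, Suc (Suc 0)) = LTriv A A"
  "Comp (level_cat T) = level_comp T"
  "TArr (level_cat T) = level_tensor T"
  "Unit (level_cat T) = (Unit (Pure T), 0)"
  "TObj (level_cat T) (A, i) (B, j) = (A \<otimes>\<^bsub>Pure T\<^esub> B, min 2 (i + j))"
  by (auto simp: level_cat_def)

section \<open>The level category is strict monoidal\<close>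

context strict_effectful_category
begin

sublocale Pu: strict_monoidal "Pure E"
  using pure_monoidal strict_pure by (rule monoidal_category_imp_strict_monoidal)

sublocale Ef: strict_premonoidal "Eff E"
  using eff_premonoidal strict_eff by (rule premonoidal_category_imp_strict_premonoidal)

declare same_Obj [simp] same_Unit [simp] same_TObj [simp]

lemma Incl_simps [simp]:
  assumes "v \<in> Arr (Pure E)"
  shows "Incl E v \<in> Arr (Eff E)" "Dom (Eff E) (Incl E v) = Dom (Pure E) v"
    "Cod (Eff E) (Incl E v) = Cod (Pure E) v"
  using cat_functor.Fa_Hom[OF incl_functor Pu.in_Hom[OF assms]] by (auto simp: Hom_iff)

lemma Incl_Ide [simp]: "A \<in> Obj (Pure E) \<Longrightarrow> Incl E (Ide (Pure E) A) = Ide (Eff E) A"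
  using cat_functor.Fa_Ide[OF incl_functor] by simp

lemma Incl_Comp [simp]:
  "\<lbrakk>v \<in> Arr (Pure E); w \<in> Arr (Pure E); Cod (Pure E) v = Dom (Pure E) w\<rbrakk> \<Longrightarrow>
    Incl E (v ;;\<^bsub>Pure E\<^esub> w) = Incl E v ;;\<^bsub>Eff E\<^esub> Incl E w"
  using cat_functor.Fa_Comp[OF incl_functor] by (simp add: Hom_iff)

lemma Dom_Cod_Obj [simp]:
  "v \<in> Arr (Pure E) \<Longrightarrow> Dom (Pure E) v \<in> Obj (Pure E)"
  "v \<in> Arr (Pure E) \<Longrightarrow> Cod (Pure E) v \<in> Obj (Pure E)"
  "f \<in> Arr (Eff E) \<Longrightarrow> Dom (Eff E) f \<in> Obj (Pure E)"
  "f \<in> Arr (Eff E) \<Longrightarrow> Cod (Eff E) f \<in> Obj (Pure E)"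
  using Pu.Dom_closed Pu.Cod_closed Ef.Dom_closed Ef.Cod_closed by simp_all

lemma Whisk_Unit_Pure [simp]:
  assumes "f \<in> Arr (Eff E)"
  shows "Unit (Pure E) \<ltimes>\<^bsub>Eff E\<^esub> f = f" "f \<rtimes>\<^bsub>Eff E\<^esub> Unit (Pure E) = f"
  using Ef.Whisk_unit_Arr[OF assms] by simp_all

text \<open>Interchange in the pure part brings a tensor of two pure arrows into the shape of the
  mixed clauses of \<open>level_tensor\<close>.\<close>

lemma Incl_TArr:
  assumes "v \<in> Arr (Pure E)" "w \<in> Arr (Pure E)"
  shows "Incl E (v \<boxtimes>\<^bsub>Pure E\<^esub> w) =
    (Incl E v \<rtimes>\<^bsub>Eff E\<^esub> Dom (Pure E) w) ;;\<^bsub>Eff E\<^esub> (Cod (Pure E) v \<ltimes>\<^bsub>Eff E\<^esub> Incl E w)"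
proof -
  have "v \<boxtimes>\<^bsub>Pure E\<^esub> w =
    (v \<boxtimes>\<^bsub>Pure E\<^esub> Ide (Pure E) (Dom (Pure E) w)) ;;\<^bsub>Pure E\<^esub> (Ide (Pure E) (Cod (Pure E) v) \<boxtimes>\<^bsub>Pure E\<^esub> w)"
    using assms by (simp add: Pu.Comp_TArr)
  then show ?thesis
    using assms by (simp add: incl_LWhisk incl_RWhisk)
qed

lemma Incl_swap:
  assumes "v \<in> Arr (Pure E)" "g \<in> Arr (Eff E)"
  shows "(Incl E v \<rtimes>\<^bsub>Eff E\<^esub> Dom (Eff E) g) ;;\<^bsub>Eff E\<^esub> (Cod (Pure E) v \<ltimes>\<^bsub>Eff E\<^esub> g) =
      (Dom (Pure E) v \<ltimes>\<^bsub>Eff E\<^esub> g) ;;\<^bsub>Eff E\<^esub> (Incl E v \<rtimes>\<^bsub>Eff E\<^esub> Cod (Eff E) g)"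
    "(g \<rtimes>\<^bsub>Eff E\<^esub> Dom (Pure E) v) ;;\<^bsub>Eff E\<^esub> (Cod (Eff E) g \<ltimes>\<^bsub>Eff E\<^esub> Incl E v) =
      (Dom (Eff E) g \<ltimes>\<^bsub>Eff E\<^esub> Incl E v) ;;\<^bsub>Eff E\<^esub> (g \<rtimes>\<^bsub>Eff E\<^esub> Cod (Pure E) v)"
  using incl_central[OF assms(1)] assms by (simp_all add: central_def Let_def)

lemma Incl_swap_right:
  assumes "v \<in> Arr (Pure E)" "g \<in> Arr (Eff E)" "h \<in> Arr (Eff E)"
  shows "Dom (Eff E) h = Cod (Pure E) v \<otimes>\<^bsub>Pure E\<^esub> Cod (Eff E) g \<Longrightarrow>
      (Incl E v \<rtimes>\<^bsub>Eff E\<^esub> Dom (Eff E) g) ;;\<^bsub>Eff E\<^esub> ((Cod (Pure E) v \<ltimes>\<^bsub>Eff E\<^esub> g) ;;\<^bsub>Eff E\<^esub> h) =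
      (Dom (Pure E) v \<ltimes>\<^bsub>Eff E\<^esub> g) ;;\<^bsub>Eff E\<^esub> ((Incl E v \<rtimes>\<^bsub>Eff E\<^esub> Cod (Eff E) g) ;;\<^bsub>Eff E\<^esub> h)"
    "Dom (Eff E) h = Cod (Eff E) g \<otimes>\<^bsub>Pure E\<^esub> Cod (Pure E) v \<Longrightarrow>
      (g \<rtimes>\<^bsub>Eff E\<^esub> Dom (Pure E) v) ;;\<^bsub>Eff E\<^esub> ((Cod (Eff E) g \<ltimes>\<^bsub>Eff E\<^esub> Incl E v) ;;\<^bsub>Eff E\<^esub> h) =
      (Dom (Eff E) g \<ltimes>\<^bsub>Eff E\<^esub> Incl E v) ;;\<^bsub>Eff E\<^esub> ((g \<rtimes>\<^bsub>Eff E\<^esub> Cod (Pure E) v) ;;\<^bsub>Eff E\<^esub> h)"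
  using assms Ef.Comp_reassoc[OF Incl_swap(1)[OF assms(1,2)], of h]
    Ef.Comp_reassoc[OF Incl_swap(2)[OF assms(1,2)], of h]
  by simp_all

lemma level_arrow_cases [consumes 1, case_names Pure Eff Triv]:
  assumes "x \<in> Arr (level_cat E)"
  obtains v where "x = LPure v" "v \<in> Arr (Pure E)"
  | f where "x = LEff f" "f \<in> Arr (Eff E)"
  | A B where "x = LTriv A B" "A \<in> Obj (Pure E)" "B \<in> Obj (Pure E)"
  using assms by (auto simp: level_cat_def)

lemma level_object_cases:
  assumes "X \<in> Obj (level_cat E)"
  obtains A where "A \<in> Obj (Pure E)" "X = (A, 0)" | A where "A \<in> Obj (Pure E)" "X = (A, Suc 0)"
  | A where "A \<in> Obj (Pure E)" "X = (A, 2)"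
proof -
  obtain A i where X: "X = (A, i)" "A \<in> Obj (Pure E)" "i \<le> 2"
    using assms by (cases X) auto
  then have "i = 0 \<or> i = Suc 0 \<or> i = 2" by auto
  with X that show ?thesis by blast
qed

lemma category_level_cat: "category (level_cat E)"
proof
  fix f assume "f \<in> Arr (level_cat E)"
  then show "Dom (level_cat E) f \<in> Obj (level_cat E)" "Cod (level_cat E) f \<in> Obj (level_cat E)"
    by (cases rule: level_arrow_cases, simp_all)+
next
  fix A assume "A \<in> Obj (level_cat E)"
  then show "Ide (level_cat E) A \<in> Hom (level_cat E) A A"
    by (cases rule: level_object_cases) (simp_all add: Hom_iff)
next
  fix f A B assume "f \<in> Hom (level_cat E) A B"
  then have "f \<in> Arr (level_cat E)" "A = level_dom E f" "B = level_cod E f" by (simp_all add: Hom_iff)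
  then show "Ide (level_cat E) A ;;\<^bsub>level_cat E\<^esub> f = f" "f ;;\<^bsub>level_cat E\<^esub> Ide (level_cat E) B = f"
    by (cases rule: level_arrow_cases, simp_all)+
next
  fix f A B g D assume "f \<in> Hom (level_cat E) A B" "g \<in> Hom (level_cat E) B D"
  then have "f \<in> Arr (level_cat E)" "g \<in> Arr (level_cat E)" "A = level_dom E f"
    "level_cod E f = level_dom E g" "D = level_cod E g" by (simp_all add: Hom_iff)
  then show "f ;;\<^bsub>level_cat E\<^esub> g \<in> Hom (level_cat E) A D"
    by (elim level_arrow_cases) (simp_all add: Hom_iff)
next
  fix f A B g D h X
  assume "f \<in> Hom (level_cat E) A B" "g \<in> Hom (level_cat E) B D" "h \<in> Hom (level_cat E) D X"
  then have "f \<in> Arr (level_cat E)" "g \<in> Arr (level_cat E)" "h \<in> Arr (level_cat E)"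
    "level_cod E f = level_dom E g" "level_cod E g = level_dom E h" by (simp_all add: Hom_iff)
  then show "f ;;\<^bsub>level_cat E\<^esub> g ;;\<^bsub>level_cat E\<^esub> h = f ;;\<^bsub>level_cat E\<^esub> (g ;;\<^bsub>level_cat E\<^esub> h)"
    by (elim level_arrow_cases) simp_all
qed

text \<open>Centrality enters \<open>level_cat\<close> here: of the four whiskered arrows on each
  side, the two in the middle are one pure and one effectful arrow, and they have to swap.\<close>

lemma level_interchange:
  assumes "v \<in> Arr (Pure E)" "w \<in> Arr (Pure E)" "Cod (Pure E) v = Dom (Pure E) w"
    "f \<in> Arr (Eff E)" "g \<in> Arr (Eff E)" "Cod (Eff E) f = Dom (Eff E) g"
  shows "level_tensor E (LPure (v ;;\<^bsub>Pure E\<^esub> w)) (LEff (f ;;\<^bsub>Eff E\<^esub> g)) =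
      level_comp E (level_tensor E (LPure v) (LEff f)) (level_tensor E (LPure w) (LEff g))"
    "level_tensor E (LEff (f ;;\<^bsub>Eff E\<^esub> g)) (LPure (v ;;\<^bsub>Pure E\<^esub> w)) =
      level_comp E (level_tensor E (LEff f) (LPure v)) (level_tensor E (LEff g) (LPure w))"
proof -
  have "(Incl E w \<rtimes>\<^bsub>Eff E\<^esub> Dom (Eff E) f) ;;\<^bsub>Eff E\<^esub> ((Cod (Pure E) w \<ltimes>\<^bsub>Eff E\<^esub> f) ;;\<^bsub>Eff E\<^esub> (Cod (Pure E) w \<ltimes>\<^bsub>Eff E\<^esub> g)) =
    (Dom (Pure E) w \<ltimes>\<^bsub>Eff E\<^esub> f) ;;\<^bsub>Eff E\<^esub> ((Incl E w \<rtimes>\<^bsub>Eff E\<^esub> Cod (Eff E) f) ;;\<^bsub>Eff E\<^esub> (Cod (Pure E) w \<ltimes>\<^bsub>Eff E\<^esub> g))"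
    by (rule Incl_swap_right(1)) (use assms in simp_all)
  then show "level_tensor E (LPure (v ;;\<^bsub>Pure E\<^esub> w)) (LEff (f ;;\<^bsub>Eff E\<^esub> g)) =
      level_comp E (level_tensor E (LPure v) (LEff f)) (level_tensor E (LPure w) (LEff g))"
    using assms by simp
  have "(g \<rtimes>\<^bsub>Eff E\<^esub> Dom (Pure E) v) ;;\<^bsub>Eff E\<^esub> ((Cod (Eff E) g \<ltimes>\<^bsub>Eff E\<^esub> Incl E v) ;;\<^bsub>Eff E\<^esub> (Cod (Eff E) g \<ltimes>\<^bsub>Eff E\<^esub> Incl E w)) =
    (Dom (Eff E) g \<ltimes>\<^bsub>Eff E\<^esub> Incl E v) ;;\<^bsub>Eff E\<^esub> ((g \<rtimes>\<^bsub>Eff E\<^esub> Cod (Pure E) v) ;;\<^bsub>Eff E\<^esub> (Cod (Eff E) g \<ltimes>\<^bsub>Eff E\<^esub> Incl E w))"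
    by (rule Incl_swap_right(2)) (use assms in simp_all)
  then show "level_tensor E (LEff (f ;;\<^bsub>Eff E\<^esub> g)) (LPure (v ;;\<^bsub>Pure E\<^esub> w)) =
      level_comp E (level_tensor E (LEff f) (LPure v)) (level_tensor E (LEff g) (LPure w))"
    using assms by simp
qed

lemma level_composable_cases:
  assumes "x \<in> Hom (level_cat E) X Y" "y \<in> Hom (level_cat E) Y Z"
  obtains v w where "x = LPure v" "y = LPure w" "v \<in> Arr (Pure E)" "w \<in> Arr (Pure E)"
    "Cod (Pure E) v = Dom (Pure E) w"
  | f g where "x = LEff f" "y = LEff g" "f \<in> Arr (Eff E)" "g \<in> Arr (Eff E)"
    "Cod (Eff E) f = Dom (Eff E) g"
  | A B D where "x = LTriv A B" "y = LTriv B D" "A \<in> Obj (Pure E)" "B \<in> Obj (Pure E)" "D \<in> Obj (Pure E)"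
  using assms by (cases x; cases y) (auto simp: Hom_iff intro: that)

lemma strict_monoidal_level_cat: "strict_monoidal (level_cat E)"
proof -
  interpret category "level_cat E" by (rule category_level_cat)
  show ?thesis
  proof
    fix f A B g A' B'
    assume "f \<in> Hom (level_cat E) A B" "g \<in> Hom (level_cat E) A' B'"
    then have "f \<in> Arr (level_cat E)" "g \<in> Arr (level_cat E)" "A = level_dom E f"
      "A' = level_dom E g" "B = level_cod E f" "B' = level_cod E g" by (simp_all add: Hom_iff)
    then show "f \<boxtimes>\<^bsub>level_cat E\<^esub> g \<in> Hom (level_cat E) (A \<otimes>\<^bsub>level_cat E\<^esub> A') (B \<otimes>\<^bsub>level_cat E\<^esub> B')"
      by (elim level_arrow_cases) (simp_all add: Hom_iff)
  next
    fix A B assume "A \<in> Obj (level_cat E)" "B \<in> Obj (level_cat E)"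
    then show "Ide (level_cat E) A \<boxtimes>\<^bsub>level_cat E\<^esub> Ide (level_cat E) B = Ide (level_cat E) (A \<otimes>\<^bsub>level_cat E\<^esub> B)"
      by (elim level_object_cases) (simp_all add: Pu.TArr_Ide)
  next
    fix f A B g D f' A' B' g' D'
    assume fg: "f \<in> Hom (level_cat E) A B" "g \<in> Hom (level_cat E) B D"
      and fg': "f' \<in> Hom (level_cat E) A' B'" "g' \<in> Hom (level_cat E) B' D'"
    have "level_tensor E (level_comp E f g) (level_comp E f' g') =
        level_comp E (level_tensor E f f') (level_tensor E g g')"
      using fg
    proof (cases rule: level_composable_cases)
      case (1 v w)
      note vw = 1
      from fg' show ?thesis
      proof (cases rule: level_composable_cases)
        case (1 v' w')
        with vw show ?thesis by (simp add: Pu.Comp_TArr)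
      next
        case (2 f' g')
        with 1 show ?thesis
          using level_interchange(1)[of v w f' g'] by (simp only: level_comp.simps)
      next
        case 3
        with 1 show ?thesis by simp
      qed
    next
      case (2 k l)
      from fg' show ?thesis
      proof (cases rule: level_composable_cases)
        case (1 v w)
        with 2 show ?thesis
          using level_interchange(2)[of v w k l] by (simp only: level_comp.simps)
      qed (use 2 in simp_all)
    next
      case 3
      from fg' show ?thesis
        by (cases rule: level_composable_cases) (simp_all add: 3)
    qed
    then show "(f ;;\<^bsub>level_cat E\<^esub> g) \<boxtimes>\<^bsub>level_cat E\<^esub> (f' ;;\<^bsub>level_cat E\<^esub> g') =
        (f \<boxtimes>\<^bsub>level_cat E\<^esub> f') ;;\<^bsub>level_cat E\<^esub> (g \<boxtimes>\<^bsub>level_cat E\<^esub> g')"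
      by simp
  next
    fix f A B g A' B' h A'' B''
    assume "f \<in> Hom (level_cat E) A B" "g \<in> Hom (level_cat E) A' B'" "h \<in> Hom (level_cat E) A'' B''"
    then have "f \<in> Arr (level_cat E)" "g \<in> Arr (level_cat E)" "h \<in> Arr (level_cat E)"
      by (simp_all add: Hom_iff)
    then show "f \<boxtimes>\<^bsub>level_cat E\<^esub> g \<boxtimes>\<^bsub>level_cat E\<^esub> h = f \<boxtimes>\<^bsub>level_cat E\<^esub> (g \<boxtimes>\<^bsub>level_cat E\<^esub> h)"
      \<comment> \<open>Below level 2 at most one factor is effectful; when two adjacent factors are
        pure, their tensor has to be included, which is \<open>Incl_TArr\<close>.\<close>
      by (elim level_arrow_cases) (simp_all add: Incl_TArr)
  next
    fix f A B assume "f \<in> Hom (level_cat E) A B"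
    then have f: "f \<in> Arr (level_cat E)" by (simp add: Hom_iff)
    then show "Ide (level_cat E) (Unit (level_cat E)) \<boxtimes>\<^bsub>level_cat E\<^esub> f = f"
      by (rule level_arrow_cases) simp_all
    from f show "f \<boxtimes>\<^bsub>level_cat E\<^esub> Ide (level_cat E) (Unit (level_cat E)) = f"
      by (rule level_arrow_cases) simp_all
  next
    fix A B D assume "A \<in> Obj (level_cat E)" "B \<in> Obj (level_cat E)" "D \<in> Obj (level_cat E)"
    then show "(A \<otimes>\<^bsub>level_cat E\<^esub> B) \<otimes>\<^bsub>level_cat E\<^esub> D = A \<otimes>\<^bsub>level_cat E\<^esub> (B \<otimes>\<^bsub>level_cat E\<^esub> D)"
      by (cases A; cases B; cases D) (simp add: min_def)
  next
    fix A B assume "A \<in> Obj (level_cat E)" "B \<in> Obj (level_cat E)"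
    then show "A \<otimes>\<^bsub>level_cat E\<^esub> B \<in> Obj (level_cat E)"
      by (cases A; cases B) simp
  next
    fix A assume "A \<in> Obj (level_cat E)"
    then show "Unit (level_cat E) \<otimes>\<^bsub>level_cat E\<^esub> A = A" "A \<otimes>\<^bsub>level_cat E\<^esub> Unit (level_cat E) = A"
      by (cases A, simp)+
  qed simp
qed

end

section \<open>The universal property\<close>

locale couple_interpretation = polygraph_couple V G + T: strict_effectful_category T
  for V :: "('o, 'v) polygraph" and G :: "('o, 'g) polygraph" and T :: "('p, 'n, 'm) eff_cat" +
  fixes F0 :: "('o, 'v, 'p, 'n) poly_mor" and F1 :: "('o, 'g, 'p, 'm) poly_mor"
  assumes couple_mor: "is_couple_mor (V, G) (underlying_couple T) (F0, F1)"
begin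

abbreviation fo where "fo \<equiv> MObj F0"
abbreviation K where "K \<equiv> level_cat T"
abbreviation ol where "ol As \<equiv> tensor_list (Pure T) (map fo As)"

lemma poly_mors:
  "is_poly_mor V (underlying_polygraph (Pure T)) F0" "is_poly_mor G (underlying_polygraph (Eff T)) F1"
  and MObj_F1: "MObj F1 = fo"
  using couple_mor by (simp_all add: is_couple_mor_def underlying_couple_def)

lemma fo_closed [simp]:
  assumes "x \<in> PObj V"
  shows "fo x \<in> Obj (Pure T)"
proof -
  have "fo \<in> PObj V \<rightarrow>\<^sub>E Obj (Pure T)"
    using poly_mors(1) by (simp add: is_poly_mor_def underlying_polygraph_def)
  then show ?thesis using assms by (rule PiE_mem)
qed

lemma map_fo_lists: "As \<in> OL \<Longrightarrow> map fo As \<in> lists (Obj (Pure T))"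
  by auto

lemma ol_closed [simp]: "As \<in> OL \<Longrightarrow> ol As \<in> Obj (Pure T)"
  using T.Pu.tensor_list_closed map_fo_lists by blast

lemma ol_append: "\<lbrakk>As \<in> OL; Bs \<in> OL\<rbrakk> \<Longrightarrow> ol (As @ Bs) = ol As \<otimes>\<^bsub>Pure T\<^esub> ol Bs"
  using T.Pu.tensor_list_append map_fo_lists by (metis map_append)

text \<open>Lets \<open>ol\<close>, formed in the pure part, serve as boundary for effectful arrows
  as well.\<close>

lemma tensor_list_Eff:
  "Xs \<in> lists (Obj (Pure T)) \<Longrightarrow> tensor_list (Eff T) Xs = tensor_list (Pure T) Xs"
  by (induction Xs) auto

lemma MArr_F0_Hom:
  assumes "v \<in> PArr V As Bs"
  shows "MArr F0 As Bs v \<in> Hom (Pure T) (ol As) (ol Bs)"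
proof -
  have "MArr F0 As Bs \<in> PArr V As Bs \<rightarrow>\<^sub>E PArr (underlying_polygraph (Pure T)) (map fo As) (map fo Bs)"
    using poly_mors(1) by (simp add: is_poly_mor_def)
  then have "MArr F0 As Bs v \<in> PArr (underlying_polygraph (Pure T)) (map fo As) (map fo Bs)"
    using assms by (rule PiE_mem)
  then show ?thesis by (simp add: underlying_polygraph_def split: if_splits)
qed

lemma MArr_F1_Hom:
  assumes "g \<in> PArr G As Bs"
  shows "MArr F1 As Bs g \<in> Hom (Eff T) (ol As) (ol Bs)"
proof -
  have "MArr F1 As Bs \<in> PArr G As Bs \<rightarrow>\<^sub>E PArr (underlying_polygraph (Eff T)) (map fo As) (map fo Bs)"
    using poly_mors(2) by (simp add: is_poly_mor_def MObj_F1)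
  then have "MArr F1 As Bs g \<in> PArr (underlying_polygraph (Eff T)) (map fo As) (map fo Bs)"
    using assms by (rule PiE_mem)
  then show ?thesis
    using PArr_G_O[OF assms] map_fo_lists
    by (simp add: underlying_polygraph_def tensor_list_Eff split: if_splits)
qed

text \<open>The runtime contributes the unit object and one unit of count.\<close>

fun level_ob :: "'o robj \<Rightarrow> 'p \<times> nat" where
  "level_ob Runtime = (Unit (Pure T), 1)"
| "level_ob (Plain x) = (fo x, 0)"

text \<open>With the runtime sent to the unit, both boundaries of a braiding denote the object
  \<open>fo x\<close> at count 1, so an identity has the right type.\<close>

fun level_gen :: "('o, 'v, 'g) rgen \<Rightarrow> ('p, 'n, 'm) level_arrow" where
  "level_gen (PureGen As Bs v) = LPure (MArr F0 As Bs v)"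
| "level_gen (EffGen As Bs g) = LEff (MArr F1 As Bs g)"
| "level_gen (BraidR x) = LEff (Ide (Eff T) (fo x))"
| "level_gen (BraidL x) = LEff (Ide (Eff T) (fo x))"

lemma tensor_list_level [simp]:
  "tensor_list K (map level_ob (plain As)) = (ol As, 0)"
  by (induction As) auto

lemma tensor_list_level' [simp]: "tensor_list K (map (level_ob \<circ> Plain) As) = (ol As, 0)"
  using tensor_list_level by simp

abbreviation tf where "tf \<equiv> term_fold K level_ob level_gen"

lemma tf_sigma: "As \<in> OL \<Longrightarrow> tf (sigma As) = LEff (Ide (Eff T) (ol As))"
  by (induction As) simp_all

lemma Rels_P_cases:
  assumes "(t, u) \<in> Rels P"
  obtains x where "x \<in> PObj V" "t = TComp (TGen (BraidR x)) (TGen (BraidL x))" "u = TId [Runtime, Plain x]"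
  | x where "x \<in> PObj V" "t = TComp (TGen (BraidL x)) (TGen (BraidR x))" "u = TId [Plain x, Runtime]"
  | As Bs v where "v \<in> PArr V As Bs"
    "t = TComp (TTens (TId [Runtime]) (TGen (PureGen As Bs v))) (sigma Bs)"
    "u = TComp (sigma As) (TTens (TGen (PureGen As Bs v)) (TId [Runtime]))"
  using assms by (auto simp: runtime_presentation_def)

sublocale lm: presentation_model K P level_ob level_gen
proof -
  interpret K: strict_monoidal K by (rule T.strict_monoidal_level_cat)
  show "presentation_model K P level_ob level_gen"
  proof
    fix x assume "x \<in> OGens P"
    then show "level_ob x \<in> Obj K" by (auto simp: OGens_P)
  next
    fix g assume "g \<in> MGens P"
    then show "level_gen g \<in> Hom K (tensor_list K (map level_ob (GDom P g)))
        (tensor_list K (map level_ob (GCod P g)))"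
      using MArr_F0_Hom MArr_F1_Hom PArr_G_O
      by (cases g) (auto simp: Hom_iff runtime_presentation_def)
  next
    fix t u assume "(t, u) \<in> Rels P"
    then show "tf t = tf u"
    proof (cases rule: Rels_P_cases)
      \<comment> \<open>Braidings vanish, and both sides reduce to the inclusion of the image of
        \<open>v\<close>.\<close>
      case (3 As Bs v)
      then show ?thesis
        using MArr_F0_Hom[of v As Bs] PArr_V_O[of v As Bs] by (simp add: tf_sigma Hom_iff)
    qed simp_all
  qed
qed

fun pure_gen :: "'o list \<times> 'o list \<times> 'v \<Rightarrow> 'n" where
  "pure_gen (As, Bs, v) = MArr F0 As Bs v"

sublocale pf: presentation_model "Pure T" PV fo pure_gen
proof
  fix g assume "g \<in> MGens PV"
  then show "pure_gen g \<in> Hom (Pure T) (ol (GDom PV g)) (ol (GCod PV g))"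
    by (cases g) (simp add: MArr_F0_Hom)
qed simp_all

section \<open>Values of the interpretation\<close>

abbreviation pure_fold where "pure_fold \<equiv> arrow_fold (Pure T) fo pure_gen"
abbreviation level_fold where "level_fold \<equiv> arrow_fold K level_ob level_gen"

text \<open>The selector \<open>un_LEff\<close> is meaningful at level 1 only;
  \<open>level_fold_eff\<close> puts arrows from \<open>R \<otimes> A\<close> to
  \<open>R \<otimes> B\<close> there.\<close>

definition eff_fold :: "('o, 'v, 'g) rarrow \<Rightarrow> 'm" where
  "eff_fold m = un_LEff (level_fold m)"

lemma pure_fold_Hom: "v \<in> Hom (Mon V) A B \<Longrightarrow> pure_fold v \<in> Hom (Pure T) (ol A) (ol B)"
  using pf.arrow_fold_Hom by (simp add: Mon_def)

text \<open>Level 0 of \<open>level_cat\<close> is a copy of the pure part of the target, so both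
  folds compute the same arrow.\<close>

lemma level_fold_pure:
  assumes "v \<in> Hom (Mon V) A B"
  shows "level_fold (pure v) = LPure (pure_fold v)"
proof -
  obtain t where t: "has_type PV t A B" "v = mclass PV A B t"
    using assms by (auto simp: Mon_def Hom_presented)
  have "tf (map_mterm Plain plain_gen t) = LPure (term_fold (Pure T) fo pure_gen t)"
    using t(1)
  proof (induction rule: has_type.induct)
    case (type_Gen g)
    then show ?case by (cases g) simp
  qed simp_all
  then show ?thesis
    using t pure_term[OF t(1)] by (simp add: pure_mclass lm.arrow_fold_mclass pf.arrow_fold_mclass)
qed

lemma level_fold_Hom:
  assumes "m \<in> Hom M X Y"
  shows "level_fold m \<in> Hom K (tensor_list K (map level_ob X)) (tensor_list K (map level_ob Y))"
  using assms lm.arrow_fold_Hom by (simp add: MonRun_def)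

lemma level_fold_Comp:
  "\<lbrakk>m \<in> Hom M X Y; n \<in> Hom M Y Z\<rbrakk> \<Longrightarrow> level_fold (m \<cdot> n) = level_comp T (level_fold m) (level_fold n)"
  using lm.arrow_fold_Comp[of m X Y n Z] by (simp add: MonRun_def)

lemma level_fold_TArr:
  "\<lbrakk>m \<in> Hom M X Y; n \<in> Hom M X' Y'\<rbrakk> \<Longrightarrow> level_fold (m \<bullet> n) = level_tensor T (level_fold m) (level_fold n)"
  using lm.arrow_fold_TArr[of m X Y n X' Y'] by (simp add: MonRun_def)

lemma level_fold_Ide:
  "X \<in> Obj M \<Longrightarrow> level_fold (Ide M X) = Ide K (tensor_list K (map level_ob X))"
  using lm.arrow_fold_Ide[of X] by (simp add: MonRun_def)

lemma level_fold_I: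
  "As \<in> OL \<Longrightarrow> level_fold (I As) = LPure (Ide (Pure T) (ol As))"
  "level_fold IR = LEff (Ide (Eff T) (Unit (Pure T)))"
  "As \<in> OL \<Longrightarrow> level_fold (Ide M (rlist As)) = LEff (Ide (Eff T) (ol As))"
  by (simp_all add: level_fold_Ide)

lemma tf_sigma_inv: "As \<in> OL \<Longrightarrow> tf (sigma_inv As) = LEff (Ide (Eff T) (ol As))"
  by (induction As) simp_all

lemma level_fold_br:
  "As \<in> OL \<Longrightarrow> level_fold (br As) = LEff (Ide (Eff T) (ol As))"
  "As \<in> OL \<Longrightarrow> level_fold (bri As) = LEff (Ide (Eff T) (ol As))"
  unfolding braiding_def braiding_inv_def
  by (simp_all add: lm.arrow_fold_mclass type_sigma type_sigma_inv tf_sigma tf_sigma_inv)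

lemma level_fold_eff:
  assumes "m \<in> Hom M (rlist As) (rlist Bs)" "As \<in> OL" "Bs \<in> OL"
  shows "level_fold m = LEff (eff_fold m)" "eff_fold m \<in> Hom (Eff T) (ol As) (ol Bs)"
proof -
  have "level_fold m \<in> Arr K" "level_dom T (level_fold m) = (ol As, 1)" "level_cod T (level_fold m) = (ol Bs, 1)"
    using level_fold_Hom[OF assms(1)] assms(2,3) by (simp_all add: Hom_iff)
  then have "\<exists>e. level_fold m = LEff e \<and> e \<in> Hom (Eff T) (ol As) (ol Bs)"
    by (cases "level_fold m") (auto simp: Hom_iff)
  then show "level_fold m = LEff (eff_fold m)" "eff_fold m \<in> Hom (Eff T) (ol As) (ol Bs)"
    by (auto simp: eff_fold_def)
qed

lemma eff_fold_Ide: "As \<in> OL \<Longrightarrow> eff_fold (Ide M (rlist As)) = Ide (Eff T) (ol As)"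
  by (simp add: eff_fold_def level_fold_I)

lemma eff_fold_Comp:
  assumes "m \<in> Hom M (rlist As) (rlist Bs)" "n \<in> Hom M (rlist Bs) (rlist Cs)"
    "As \<in> OL" "Bs \<in> OL" "Cs \<in> OL"
  shows "eff_fold (m \<cdot> n) = eff_fold m ;;\<^bsub>Eff T\<^esub> eff_fold n"
  using level_fold_Comp[OF assms(1,2)] level_fold_eff(1)[OF assms(1,3,4)] level_fold_eff(1)[OF assms(2,4,5)]
  by (simp add: eff_fold_def[of "m \<cdot> n"])

lemma eff_fold_rwhisk:
  assumes "m \<in> Hom M (rlist As) (rlist Bs)" "As \<in> OL" "Bs \<in> OL" "Cs \<in> OL"
  shows "eff_fold (m \<bullet> I Cs) = eff_fold m \<rtimes>\<^bsub>Eff T\<^esub> ol Cs"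
proof -
  note e = level_fold_eff[OF assms(1-3)]
  have "level_fold (m \<bullet> I Cs) = level_tensor T (LEff (eff_fold m)) (LPure (Ide (Pure T) (ol Cs)))"
    using level_fold_TArr[OF assms(1) Ide_Hom, of "plain Cs"] assms(4) e(1) by (simp add: level_fold_I)
  then show ?thesis
    using e(2) assms(2-4) by (simp add: eff_fold_def[of "m \<bullet> I Cs"] Hom_iff)
qed

text \<open>The two braidings in \<open>lwhisk\<close> fold to identities, and what remains is a
  left whiskering in the target.\<close>

lemma eff_fold_lwhisk:
  assumes "m \<in> Hom M (rlist As) (rlist Bs)" "As \<in> OL" "Bs \<in> OL" "Cs \<in> OL"
  shows "eff_fold (lwhisk Cs As Bs m) = ol Cs \<ltimes>\<^bsub>Eff T\<^esub> eff_fold m"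
proof -
  note e = level_fold_eff[OF assms(1-3)]
  have h: "br Cs \<in> Hom M (rlist Cs) (plain Cs @ [Runtime])" "bri Cs \<in> Hom M (plain Cs @ [Runtime]) (rlist Cs)"
    "I As \<in> Hom M (plain As) (plain As)" "I Bs \<in> Hom M (plain Bs) (plain Bs)" "I Cs \<in> Hom M (plain Cs) (plain Cs)"
    using assms(2-4) by (simp_all add: Hom_iff)
  note t = TArr_Hom[OF h(1,3), simplified] TArr_Hom[OF h(5) assms(1), simplified] TArr_Hom[OF h(2,4), simplified]
  have "level_fold (lwhisk Cs As Bs m) =
    level_comp T (level_comp T (level_tensor T (LEff (Ide (Eff T) (ol Cs))) (LPure (Ide (Pure T) (ol As))))
      (level_tensor T (LPure (Ide (Pure T) (ol Cs))) (LEff (eff_fold m))))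
      (level_tensor T (LEff (Ide (Eff T) (ol Cs))) (LPure (Ide (Pure T) (ol Bs))))"
    unfolding lwhisk_def
    using level_fold_Comp[OF Comp_Hom[OF t(1,2)] t(3)] level_fold_Comp[OF t(1,2)]
      level_fold_TArr[OF h(1,3)] level_fold_TArr[OF h(5) assms(1)] level_fold_TArr[OF h(2,4)] assms(2-4) e(1)
    by (simp add: level_fold_I level_fold_br)
  then show ?thesis
    using e(2) assms(2-4) by (simp add: eff_fold_def[of "lwhisk Cs As Bs m"] Hom_iff)
qed

lemma eff_fold_pure:
  assumes "v \<in> Hom (Mon V) A B"
  shows "eff_fold (IR \<bullet> pure v) = Incl T (pure_fold v)"
proof -
  have "level_fold (IR \<bullet> pure v) = level_tensor T (LEff (Ide (Eff T) (Unit (Pure T)))) (LPure (pure_fold v))"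
    using level_fold_TArr[OF Ide_Hom pure_Hom[OF assms], of "[Runtime]"] level_fold_pure[OF assms]
    by (simp add: level_fold_I)
  then show ?thesis
    using pure_fold_Hom[OF assms] Mon.Hom_Obj[OF assms] by (simp add: eff_fold_def Hom_iff)
qed

end

text \<open>Both morphisms are extensional, so their values on the polygraph decide
  equality.\<close>

lemma poly_mor_eq_iff:
  fixes F F' :: "('o, 'a, 'p, 'b) poly_mor"
  assumes "MObj F \<in> extensional (PObj G)" "MObj F' \<in> extensional (PObj G)"
    and "\<And>As Bs. MArr F As Bs \<in> extensional (PArr G As Bs)"
    and "\<And>As Bs. MArr F' As Bs \<in> extensional (PArr G As Bs)"
  shows "F = F' \<longleftrightarrow> (\<forall>x\<in>PObj G. MObj F x = MObj F' x) \<and>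
    (\<forall>As Bs. \<forall>a\<in>PArr G As Bs. MArr F As Bs a = MArr F' As Bs a)"
proof (intro iffI)
  assume eq: "(\<forall>x\<in>PObj G. MObj F x = MObj F' x) \<and>
    (\<forall>As Bs. \<forall>a\<in>PArr G As Bs. MArr F As Bs a = MArr F' As Bs a)"
  show "F = F'"
  proof (rule poly_mor.equality)
    show "MObj F = MObj F'"
      using eq assms(1,2) by (intro extensionalityI[of _ "PObj G"]) auto
    have "MArr F As Bs = MArr F' As Bs" for As Bs
      using eq by (intro extensionalityI[OF assms(3,4)]) simp
    then show "MArr F = MArr F'" by (intro ext) simp
  qed simp
qed simp

section \<open>Existence and uniqueness of the extension\<close>

context couple_interpretation
begin

abbreviation eta_pure where "eta_pure As Bs v \<equiv> mclass PV As Bs (TGen (As, Bs, v))"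
abbreviation eta_eff where "eta_eff As Bs g \<equiv> cm As Bs (gen (EffGen As Bs g))"

lemma eta_eff_Hom:
  assumes "g \<in> PArr G As Bs"
  shows "gen (EffGen As Bs g) \<in> Hom M (rlist As) (rlist Bs)" "eta_eff As Bs g \<in> Hom F As Bs"
proof -
  show "gen (EffGen As Bs g) \<in> Hom M (rlist As) (rlist Bs)"
    using type_gens(2)[OF assms] by (simp add: gen_def Hom_iff mclass_M)
  then show "eta_eff As Bs g \<in> Hom F As Bs"
    using PArr_G_O[OF assms] by (simp add: cm_Hom)
qed

text \<open>The factorisation condition as a list of values on generators, the form in which
  existence proves it and uniqueness uses it.\<close>

lemma extends_generators_iff:
  "(F0, F1) = couple_mor_comp (V, G) (generators (V, G)) (underlying_couple_mor E H) \<longleftrightarrow>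
    (\<forall>x\<in>PObj V. fo x = F0Obj H [x] \<and> fo x = FObj H [x]) \<and>
    (\<forall>As Bs. \<forall>v\<in>PArr V As Bs. MArr F0 As Bs v = F0Arr H (eta_pure As Bs v)) \<and>
    (\<forall>As Bs. \<forall>g\<in>PArr G As Bs. MArr F1 As Bs g = FArr H (eta_eff As Bs g))"
proof -
  let ?g0 = "fst (generators (V, G))" and ?g1 = "snd (generators (V, G))"
  let ?h0 = "fst (underlying_couple_mor E H)" and ?h1 = "snd (underlying_couple_mor E H)"
  have l: "map (\<lambda>A\<in>PObj V. [A]) As \<in> lists OL" if "As \<in> OL" for As
    using that by auto
  have F0: "F0 = poly_mor_comp V ?g0 ?h0 \<longleftrightarrow> (\<forall>x\<in>PObj V. fo x = F0Obj H [x]) \<and>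
      (\<forall>As Bs. \<forall>v\<in>PArr V As Bs. MArr F0 As Bs v = F0Arr H (eta_pure As Bs v))"
  proof (subst poly_mor_eq_iff[where G = V])
    show "MObj F0 \<in> extensional (PObj V)" "MArr F0 As Bs \<in> extensional (PArr V As Bs)" for As Bs
      using poly_mors(1) by (auto simp: is_poly_mor_def PiE_def)
    \<comment> \<open>The arrow maps of \<open>underlying_couple_mor\<close> are restricted to the
      underlying polygraph; generators lie in it, so the restriction does not change their
      values.\<close>
    have "eta_pure As Bs v \<in> PArr (underlying_polygraph (Mon V)) (map (\<lambda>A\<in>PObj V. [A]) As)
        (map (\<lambda>A\<in>PObj V. [A]) Bs)"
      if "v \<in> PArr V As Bs" for As Bs v
      using pure_generator(1)[OF that] PArr_V_O[OF that] l
      by (simp add: underlying_polygraph_def tensor_list_singletons)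
    then show "((\<forall>x\<in>PObj V. fo x = MObj (poly_mor_comp V ?g0 ?h0) x) \<and>
       (\<forall>As Bs. \<forall>a\<in>PArr V As Bs. MArr F0 As Bs a = MArr (poly_mor_comp V ?g0 ?h0) As Bs a)) =
      ((\<forall>x\<in>PObj V. fo x = F0Obj H [x]) \<and>
       (\<forall>As Bs. \<forall>v\<in>PArr V As Bs. MArr F0 As Bs v = F0Arr H (eta_pure As Bs v)))"
      by (simp add: poly_mor_comp_def generators_def underlying_couple_mor_def compose_def)
  qed (simp_all add: poly_mor_comp_def compose_def)
  have F1: "F1 = poly_mor_comp G ?g1 ?h1 \<longleftrightarrow> (\<forall>x\<in>PObj V. fo x = FObj H [x]) \<and>
      (\<forall>As Bs. \<forall>g\<in>PArr G As Bs. MArr F1 As Bs g = FArr H (eta_eff As Bs g))"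
  proof (subst poly_mor_eq_iff[where G = G])
    show "MObj F1 \<in> extensional (PObj G)" "MArr F1 As Bs \<in> extensional (PArr G As Bs)" for As Bs
      using poly_mors(2) by (auto simp: is_poly_mor_def PiE_def)
    have "eta_eff As Bs g \<in> PArr (underlying_polygraph F) (map (\<lambda>A\<in>PObj V. [A]) As)
        (map (\<lambda>A\<in>PObj V. [A]) Bs)"
      if "g \<in> PArr G As Bs" for As Bs g
      using eta_eff_Hom(2)[OF that] PArr_G_O[OF that] l
      by (simp add: underlying_polygraph_def tensor_list_singletons)
    then show "((\<forall>x\<in>PObj G. MObj F1 x = MObj (poly_mor_comp G ?g1 ?h1) x) \<and>
       (\<forall>As Bs. \<forall>a\<in>PArr G As Bs. MArr F1 As Bs a = MArr (poly_mor_comp G ?g1 ?h1) As Bs a)) =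
      ((\<forall>x\<in>PObj V. fo x = FObj H [x]) \<and>
       (\<forall>As Bs. \<forall>g\<in>PArr G As Bs. MArr F1 As Bs g = FArr H (eta_eff As Bs g)))"
      by (simp add: poly_mor_comp_def generators_def underlying_couple_mor_def compose_def PObj_G MObj_F1 gen_def)
  qed (simp_all add: poly_mor_comp_def compose_def)
  have "couple_mor_comp (V, G) (generators (V, G)) (underlying_couple_mor E H) =
      (poly_mor_comp V ?g0 ?h0, poly_mor_comp G ?g1 ?h1)"
    by (simp add: couple_mor_comp_def generators_def underlying_couple_mor_def)
  with F0 F1 show ?thesis by auto
qed

definition free_functor ::
    "('o list, ('o, 'o list \<times> 'o list \<times> 'v) marrow, ('o, 'v, 'g) clique_mor, 'p, 'n, 'm) eff_fun" where
  "free_functor = \<lparr>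
     FObj = restrict (\<lambda>As. ol As) OL,
     FArr = restrict (\<lambda>f. eff_fold (leftmost f)) (Arr F),
     F0Obj = restrict (\<lambda>As. ol As) OL,
     F0Arr = restrict pure_fold (Arr (Mon V)),
     Eps = Ide (Pure T) (Unit (Pure T)),
     Mu = restrict (\<lambda>(As, Bs). Ide (Pure T) (ol As \<otimes>\<^bsub>Pure T\<^esub> ol Bs)) (OL \<times> OL) \<rparr>"

lemma free_functor_simps [simp]:
  "As \<in> OL \<Longrightarrow> FObj free_functor As = ol As"
  "As \<in> OL \<Longrightarrow> F0Obj free_functor As = ol As"
  "v \<in> Arr (Mon V) \<Longrightarrow> F0Arr free_functor v = pure_fold v"
  "Eps free_functor = Ide (Pure T) (Unit (Pure T))"
  "\<lbrakk>As \<in> OL; Bs \<in> OL\<rbrakk> \<Longrightarrow> Mu free_functor (As, Bs) = Ide (Pure T) (ol As \<otimes>\<^bsub>Pure T\<^esub> ol Bs)"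
  by (simp_all add: free_functor_def)

lemma free_functor_cm [simp]:
  assumes "As \<in> OL" "Bs \<in> OL" "m \<in> Hom M (rlist As) (rlist Bs)"
  shows "FArr free_functor (cm As Bs m) = eff_fold m"
  using assms cm_Hom[OF assms] by (simp add: free_functor_def Hom_iff[of _ F])

lemma free_functor_strict_effectful: "strict_effectful_functor E T free_functor"
proof -
  interpret E: strict_effectful_category E by (rule strict_effectful_free)
  have st: "strict_tensor (Mon V)" "strict_tensor (Pure T)"
    using E.strict_pure T.strict_pure by simp_all
  have pf: "pure_fold v \<in> Arr (Pure T)" "Dom (Pure T) (pure_fold v) = ol A"
    "Cod (Pure T) (pure_fold v) = ol B" if "v \<in> Hom (Mon V) A B" for v A B
    using pure_fold_Hom[OF that] by (simp_all add: Hom_iff)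
  have hv: "v \<in> Arr (Mon V)" "A \<in> OL" "B \<in> OL" if "v \<in> Hom (Mon V) A B" for v A B
    using that Mon.Hom_Obj[OF that] by (simp_all add: Hom_iff)
  have pf_Ide: "pure_fold (Ide (Mon V) A) = Ide (Pure T) (ol A)" if "A \<in> OL" for A
    using that pf.arrow_fold_Ide[of A] by (simp add: Mon_def)
  have fun_pure: "cat_functor (Mon V) (Pure T) (F0Obj free_functor) (F0Arr free_functor)"
  proof (rule cat_functorI)
    fix f g A B D assume f: "f \<in> Hom (Mon V) A B" and g: "g \<in> Hom (Mon V) B D"
    show "F0Arr free_functor (f ;;\<^bsub>Mon V\<^esub> g) = F0Arr free_functor f ;;\<^bsub>Pure T\<^esub> F0Arr free_functor g"
      using hv(1)[OF f] hv(1)[OF g] hv(1)[OF Mon.Comp_Hom[OF f g]] pf.arrow_fold_Comp[of f A B g D] f g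
      by (simp add: Mon_def)
  next
    fix f A B assume f: "f \<in> Hom (Mon V) A B"
    show "F0Arr free_functor f \<in> Hom (Pure T) (F0Obj free_functor A) (F0Obj free_functor B)"
      using hv[OF f] pure_fold_Hom[OF f] by simp
  qed (simp_all add: Mon.category_axioms T.Pu.category_axioms pf_Ide)
  have fun_eff: "cat_functor F (Eff T) (FObj free_functor) (FArr free_functor)"
  proof (rule cat_functorI)
    fix f A B assume "f \<in> Hom F A B"
    then show "FArr free_functor f \<in> Hom (Eff T) (FObj free_functor A) (FObj free_functor B)"
      by (rule Hom_FE) (simp add: level_fold_eff(2))
  next
    fix A assume "A \<in> Obj F"
    then show "FArr free_functor (Ide F A) = Ide (Eff T) (FObj free_functor A)"
      by (simp add: Ide_F Ide_Hom eff_fold_Ide)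
  next
    fix f g A B D assume "f \<in> Hom F A B" "g \<in> Hom F B D"
    then show "FArr free_functor (f ;;\<^bsub>F\<^esub> g) = FArr free_functor f ;;\<^bsub>Eff T\<^esub> FArr free_functor g"
      by (elim Hom_FE) (simp add: Comp_F Comp_Hom eff_fold_Comp)
  qed (simp_all add: category_F T.Ef.category_axioms)
  have mon: "iso_monoidal_functor (Mon V) (Pure T) (F0Obj free_functor) (F0Arr free_functor)
      (Eps free_functor) (Mu free_functor)"
  proof (intro iso_monoidal_functor.intro iso_monoidal_functor_axioms.intro fun_pure)
    show "monoidal_category (Mon V)" "monoidal_category (Pure T)"
      using E.pure_monoidal T.pure_monoidal by simp_all
  next
    fix f A A' g B B' assume f: "f \<in> Hom (Mon V) A A'" and g: "g \<in> Hom (Mon V) B B'"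
    show "F0Arr free_functor (f \<boxtimes>\<^bsub>Mon V\<^esub> g) ;;\<^bsub>Pure T\<^esub> Mu free_functor (A', B') =
       Mu free_functor (A, B) ;;\<^bsub>Pure T\<^esub> (F0Arr free_functor f \<boxtimes>\<^bsub>Pure T\<^esub> F0Arr free_functor g)"
      using hv[OF f] hv[OF g] hv(1)[OF Mon.TArr_Hom[OF f g]] pf[OF f] pf[OF g]
        pf.arrow_fold_TArr[of f A A' g B B'] f g
      by (simp add: Mon_def)
  next
    fix A B D assume o: "A \<in> Obj (Mon V)" "B \<in> Obj (Mon V)" "D \<in> Obj (Mon V)"
    then have "Assoc (Mon V) A B D = Ide (Mon V) (A @ B @ D)"
      "Assoc (Pure T) (ol A) (ol B) (ol D) = Ide (Pure T) (ol A \<otimes>\<^bsub>Pure T\<^esub> (ol B \<otimes>\<^bsub>Pure T\<^esub> ol D))"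
      using st by (simp_all add: strict_tensor_def)
    then show "F0Arr free_functor (Assoc (Mon V) A B D) ;;\<^bsub>Pure T\<^esub> Mu free_functor (A \<otimes>\<^bsub>Mon V\<^esub> B, D) ;;\<^bsub>Pure T\<^esub>
        (Mu free_functor (A, B) \<boxtimes>\<^bsub>Pure T\<^esub> Ide (Pure T) (F0Obj free_functor D)) =
      Mu free_functor (A, B \<otimes>\<^bsub>Mon V\<^esub> D) ;;\<^bsub>Pure T\<^esub>
        (Ide (Pure T) (F0Obj free_functor A) \<boxtimes>\<^bsub>Pure T\<^esub> Mu free_functor (B, D)) ;;\<^bsub>Pure T\<^esub>
        Assoc (Pure T) (F0Obj free_functor A) (F0Obj free_functor B) (F0Obj free_functor D)"
      using o ol_append[of A "B @ D"] ol_append[of B D] ol_append[of A B]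
      by (simp add: pf_Ide T.Pu.TArr_Ide)
  next
    fix A e assume o: "A \<in> Obj (Mon V)" and e: "inverse_arrows (Pure T) (Eps free_functor) e"
    have e: "e = Ide (Pure T) (Unit (Pure T))"
      using T.Pu.inverse_Ide[OF T.Pu.Unit_closed] e by simp
    have "RUnit (Mon V) A = Ide (Mon V) A" "LUnit (Mon V) A = Ide (Mon V) A"
      "RUnit (Pure T) (ol A) = Ide (Pure T) (ol A)" "LUnit (Pure T) (ol A) = Ide (Pure T) (ol A)"
      using st o by (simp_all add: strict_tensor_def)
    then show "Mu free_functor (A, Unit (Mon V)) ;;\<^bsub>Pure T\<^esub>
        (Ide (Pure T) (F0Obj free_functor A) \<boxtimes>\<^bsub>Pure T\<^esub> e) ;;\<^bsub>Pure T\<^esub> RUnit (Pure T) (F0Obj free_functor A) =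
        F0Arr free_functor (RUnit (Mon V) A)"
      "Mu free_functor (Unit (Mon V), A) ;;\<^bsub>Pure T\<^esub>
        (e \<boxtimes>\<^bsub>Pure T\<^esub> Ide (Pure T) (F0Obj free_functor A)) ;;\<^bsub>Pure T\<^esub> LUnit (Pure T) (F0Obj free_functor A) =
        F0Arr free_functor (LUnit (Mon V) A)"
      using o by (simp_all add: e pf_Ide)
  qed (simp_all add: Hom_iff T.Pu.Ide_iso ol_append[simplified])
  have eff: "effectful_functor E T free_functor"
  proof (intro effectful_functor.intro effectful_functor_axioms.intro)
    show "effectful_category E" "effectful_category T"
      by (rule E.effectful_category_axioms T.effectful_category_axioms)+
    show "cat_functor (Eff E) (Eff T) (FObj free_functor) (FArr free_functor)"
      using fun_eff by simp
    show "iso_monoidal_functor (Pure E) (Pure T) (F0Obj free_functor) (F0Arr free_functor)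
        (Eps free_functor) (Mu free_functor)"
      using mon by simp
  next
    fix v assume "v \<in> Arr (Pure E)"
    then have v: "v \<in> Hom (Mon V) (Dom (Mon V) v) (Cod (Mon V) v)" by (simp add: Hom_iff)
    show "FArr free_functor (Incl E v) = Incl T (F0Arr free_functor v)"
      using hv[OF v] by (simp add: incl_Hom_eq[OF v] pure_lifted_Hom[OF v] eff_fold_pure[OF v])
  next
    fix f A A' B assume "f \<in> Hom (Eff E) A A'" "B \<in> Obj (Eff E)"
    then obtain m where o: "A \<in> OL" "A' \<in> OL" "B \<in> OL" and m: "m \<in> Hom M (rlist A) (rlist A')"
      and f: "f = cm A A' m"
      by simp (elim Hom_FE)
    note e = level_fold_eff(2)[OF m o(1,2), unfolded Hom_iff]
    show "FArr free_functor (f \<rtimes>\<^bsub>Eff E\<^esub> B) ;;\<^bsub>Eff T\<^esub> Incl T (Mu free_functor (A', B)) =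
      Incl T (Mu free_functor (A, B)) ;;\<^bsub>Eff T\<^esub> (FArr free_functor f \<rtimes>\<^bsub>Eff T\<^esub> FObj free_functor B)"
      using o m e rwhisk_Hom[OF o(3) m] free_functor_cm[of "A @ B" "A' @ B"]
      by (simp add: f RWhisk_F eff_fold_rwhisk[OF m])
    show "FArr free_functor (B \<ltimes>\<^bsub>Eff E\<^esub> f) ;;\<^bsub>Eff T\<^esub> Incl T (Mu free_functor (B, A')) =
      Incl T (Mu free_functor (B, A)) ;;\<^bsub>Eff T\<^esub> (FObj free_functor B \<ltimes>\<^bsub>Eff T\<^esub> FArr free_functor f)"
      using o m e lwhisk_Hom[OF o m] free_functor_cm[of "B @ A" "B @ A'"]
      by (simp add: f LWhisk_F eff_fold_lwhisk[OF m])
  qed (simp_all add: free_functor_def)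
  show ?thesis
    by (intro strict_effectful_functor.intro strict_effectful_functor_axioms.intro eff) simp_all
qed

lemma free_functor_extends_generators:
  "(F0, F1) = couple_mor_comp (V, G) (generators (V, G)) (underlying_couple_mor E free_functor)"
proof -
  have "MArr F0 As Bs v = F0Arr free_functor (eta_pure As Bs v)" if "v \<in> PArr V As Bs" for As Bs v
  proof -
    have "has_type PV (TGen (As, Bs, v)) As Bs"
      using type_Gen[of "(As, Bs, v)" PV] that PArr_V_O[OF that] by simp
    then show ?thesis
      using pure_generator(1)[OF that] by (simp add: Hom_iff[of _ "Mon V"] pf.arrow_fold_mclass)
  qed
  moreover have "MArr F1 As Bs g = FArr free_functor (eta_eff As Bs g)" if "g \<in> PArr G As Bs" for As Bs g
  proof -
    have "level_fold (gen (EffGen As Bs g)) = LEff (MArr F1 As Bs g)"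
      using lm.arrow_fold_mclass[OF type_gens(2)[OF that]] by (simp add: gen_def)
    then show ?thesis
      using eta_eff_Hom(1)[OF that] PArr_G_O[OF that] by (simp add: eff_fold_def)
  qed
  ultimately show ?thesis by (simp add: extends_generators_iff)
qed

text \<open>Objects are settled by induction over lists, pure arrows by induction over terms, and
  effectful arrows by \<open>runtime_arrow_induct\<close>.\<close>

lemma free_functor_unique:
  assumes H: "strict_effectful_functor E T H"
    and ext: "(F0, F1) = couple_mor_comp (V, G) (generators (V, G)) (underlying_couple_mor E H)"
  shows "H = free_functor"
proof -
  interpret H: strict_effectful_functor E T H by (rule H)
  interpret HM: iso_monoidal_functor "Mon V" "Pure T" "F0Obj H" "F0Arr H" "Eps H" "Mu H"
    using H.F0_monoidal by simp
  interpret HE: cat_functor F "Eff T" "FObj H" "FArr H"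
    using H.F_functor by simp
  note gens = ext[unfolded extends_generators_iff]
  have Mu: "Mu H (A, B) = Ide (Pure T) (F0Obj H A \<otimes>\<^bsub>Pure T\<^esub> F0Obj H B)" if "A \<in> OL" "B \<in> OL" for A B
    using H.Mu_identity[of A B] that by simp
  have c: "F0Obj H A \<in> Obj (Pure T)" if "A \<in> OL" for A
    using HM.Fo_closed that by simp
  \<comment> \<open>An identity typed from the image of a tensor to the tensor of the images forces
    these objects to be equal.\<close>
  have app: "F0Obj H (A @ B) = F0Obj H A \<otimes>\<^bsub>Pure T\<^esub> F0Obj H B" if "A \<in> OL" "B \<in> OL" for A B
    using HM.m_Hom[of A B] that by (simp add: Mu c Hom_iff)
  have nil: "F0Obj H [] = Unit (Pure T)"
    using HM.e_Hom H.Eps_identity by (simp add: Hom_iff)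
  have o0: "F0Obj H As = ol As" if "As \<in> OL" for As
    using that
  proof (induction As)
    case (Cons a As)
    then show ?case using app[of "[a]" As] gens by simp
  qed (simp add: nil)
  have o1: "FObj H As = ol As" if "As \<in> OL" for As
    using H.square_Obj[of As] o0[OF that] that by simp
  have "F0Arr H (mclass PV A B t) = term_fold (Pure T) fo pure_gen t" if "has_type PV t A B" for A B t
    using that
  proof (induction rule: has_type.induct)
    case (type_Id A)
    then show ?case
      using HM.Fa_Ide[of A] by (simp add: o0 Mon_def presented_Ide)
  next
    case (type_Gen g)
    then show ?case using gens by (cases g) simp
  next
    case (type_Comp t A B u D)
    then show ?case
      using HM.Fa_Comp[of "mclass PV A B t" A B "mclass PV B D u" D]
      by (simp add: Mon_def mclass_Hom Comp_mclass)
  next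
    case (type_Tens t A B u A' B')
    have o: "A \<in> OL" "B \<in> OL" "A' \<in> OL" "B' \<in> OL"
      using type_Tens(1,2)[THEN has_type_lists] by simp_all
    have h: "mclass PV A B t \<in> Hom (Mon V) A B" "mclass PV A' B' u \<in> Hom (Mon V) A' B'"
      using type_Tens(1,2)[THEN mclass_Hom] by (simp_all add: Mon_def)
    have ht: "mclass PV A B t \<boxtimes>\<^bsub>Mon V\<^esub> mclass PV A' B' u = mclass PV (A @ A') (B @ B') (TTens t u)"
      using TArr_mclass[OF type_Tens(1,2)] by (simp add: Mon_def)
    \<comment> \<open>The typing allows the identity \<open>Mu\<close> to be dropped from its
      naturality square; the whiskering cases below do the same.\<close>
    have "F0Arr H (mclass PV (A @ A') (B @ B') (TTens t u)) \<in> Hom (Pure T) (ol (A @ A')) (ol (B @ B'))"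
      using HM.Fa_Hom[OF Mon.TArr_Hom[OF h]] o by (simp only: ht) (simp add: o0)
    then show ?case
      using HM.m_natural[OF h] HM.Fa_Hom[OF h(1)] HM.Fa_Hom[OF h(2)] type_Tens(3,4) o
      by (simp add: Mu o0 ht Hom_iff ol_append[simplified])
  qed
  then have a0: "F0Arr H v = pure_fold v" if "v \<in> Hom (Mon V) A B" for v A B
    using that by (auto simp: Mon_def Hom_presented pf.arrow_fold_mclass)
  \<comment> \<open>Each case of the induction is a preservation property of \<open>H\<close>: the
    square with the inclusions, agreement on generators, functoriality, and naturality of
    \<open>Mu\<close> in either variable.\<close>
  have a1: "FArr H (cm A B m) = eff_fold m" if "m \<in> Hom M (rlist A) (rlist B)" "A \<in> OL" "B \<in> OL" for m A B
    using that
  proof (induction rule: runtime_arrow_induct)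
    case (pure A B v)
    then show ?case
      using H.square_Arr[of v] by (simp add: incl_Hom_eq Hom_iff[of v] eff_fold_pure a0)
  next
    case (eff_gen As Bs g)
    then show ?case
      using gens level_fold_eff(1) lm.arrow_fold_mclass[OF type_gens(2)[OF eff_gen]] by (simp add: gen_def eff_fold_def)
  next
    case (comp A B D m n)
    then show ?case
      using HE.Fa_Comp[OF cm_Hom cm_Hom, of A B m D n] by (simp add: Comp_F eff_fold_Comp)
  next
    case (rwhisk A B D m)
    note e = level_fold_eff(2)[OF rwhisk(4,1,2), unfolded Hom_iff]
    have "FArr H (cm (A @ D) (B @ D) (m \<bullet> I D)) \<in> Hom (Eff T) (ol (A @ D)) (ol (B @ D))"
      using HE.Fa_Hom[OF cm_Hom[OF _ _ rwhisk_Hom[OF rwhisk(3,4)]]] rwhisk(1-3) by (simp add: o1)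
    then show ?case
      using H.Mu_natural_1[of "cm A B m" A B D] rwhisk e
      by (simp add: cm_Hom Mu o0 o1 RWhisk_F Hom_iff[of _ "Eff T"] ol_append[simplified] eff_fold_rwhisk)
  next
    case (lwhisk A B D m)
    note e = level_fold_eff(2)[OF lwhisk(4,1,2), unfolded Hom_iff]
    have "FArr H (cm (D @ A) (D @ B) (lwhisk D A B m)) \<in> Hom (Eff T) (ol (D @ A)) (ol (D @ B))"
      using HE.Fa_Hom[OF cm_Hom[OF _ _ lwhisk_Hom[OF lwhisk(1-4)]]] lwhisk(1-3) by (simp add: o1)
    then show ?case
      using H.Mu_natural_2[of D "cm A B m" A B] lwhisk e
      by (simp add: cm_Hom Mu o0 o1 LWhisk_F Hom_iff[of _ "Eff T"] ol_append[simplified] eff_fold_lwhisk)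
  qed
  show ?thesis
  proof (rule eff_fun.equality)
    show "FObj H = FObj free_functor" "F0Obj H = F0Obj free_functor"
      using H.extensional(1,3) o0 o1
      by (auto intro!: extensionalityI[of _ OL] simp: free_functor_def simp del: in_lists_conv_set)
    show "F0Arr H = F0Arr free_functor"
      using H.extensional(4) a0[OF Mon.in_Hom]
      by (intro extensionalityI[of _ "Arr (Mon V)"]) (simp_all add: free_functor_def)
    show "FArr H = FArr free_functor"
    proof (rule extensionalityI[of _ "Arr F"])
      fix f assume "f \<in> Arr F"
      then have "f \<in> Hom F (Dom F f) (Cod F f)" by (simp add: Hom_iff)
      then show "FArr H f = FArr free_functor f"
        by (rule Hom_FE) (metis a1 free_functor_cm)
    qed (use H.extensional(2) in \<open>simp_all add: free_functor_def\<close>)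
    show "Eps H = Eps free_functor"
      using H.Eps_identity by simp
    show "Mu H = Mu free_functor"
    proof (rule extensionalityI[of _ "OL \<times> OL"])
      fix p assume "p \<in> OL \<times> OL"
      then show "Mu H p = Mu free_functor p"
        by (cases p) (simp add: Mu o0)
    qed (use H.extensional(5) in \<open>simp_all add: free_functor_def\<close>)
  qed simp
qed

end

theorem theorem2p14:
  fixes V :: "('o, 'v) polygraph" and G :: "('o, 'g) polygraph"
  assumes couple: "is_poly_couple (V, G)"
  shows "strict_effectful_category (free_effectful (V, G)) \<and>
    is_couple_mor (V, G) (underlying_couple (free_effectful (V, G))) (generators (V, G)) \<and>
    (\<forall>(E :: ('p, 'n, 'm) eff_cat) F.
      strict_effectful_category E \<longrightarrow>
      is_couple_mor (V, G) (underlying_couple E) F \<longrightarrow>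
      (\<exists>!H. strict_effectful_functor (free_effectful (V, G)) E H \<and>
        F = couple_mor_comp (V, G) (generators (V, G))
              (underlying_couple_mor (free_effectful (V, G)) H))) \<and>
    (\<forall>A \<in> lists (PObj V). \<forall>B \<in> lists (PObj V).
      bij_betw leftmost
        (Hom (Eff (free_effectful (V, G))) A B)
        (Hom (MonRun (V, G)) (Runtime # plain A) (Runtime # plain B)))"
proof -
  interpret polygraph_couple V G
    using couple by (rule polygraph_couple.intro)
  have "\<exists>!H. strict_effectful_functor (free_effectful (V, G)) T H \<and>
      F = couple_mor_comp (V, G) (generators (V, G)) (underlying_couple_mor (free_effectful (V, G)) H)"
    if "strict_effectful_category T" "is_couple_mor (V, G) (underlying_couple T) F"
    for T :: "('p, 'n, 'm) eff_cat" and F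
  proof -
    obtain F0 F1 where F: "F = (F0, F1)" by (cases F)
    interpret couple_interpretation V G T F0 F1
      using that polygraph_couple_axioms
      by (simp add: F couple_interpretation_def couple_interpretation_axioms_def)
    show ?thesis
      unfolding F
      using free_functor_strict_effectful free_functor_extends_generators free_functor_unique by blast
  qed
  then show ?thesis
    using strict_effectful_free generators_couple_mor leftmost_bij_betw by simp
qed

end
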